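(* Let $A$ be a generalized Cartan matrix with associated data $\mathfrak h_{\mathbb R}^*,\Pi,W,\overline C$, let $\mu\in\overline C$, and let $H$ be the convex hull of $W\mu$. The following are equivalent: (a) $(\Pi^*\cap J_0)^0=\Pi^*\cap J_0$. (b) $H\cap\overline C$ is closed. In particular, if the Kac-Moody algebra $\mathfrak g(A)$ is of finite, affine, or strongly hyperbolic type, then $H\cap\overline C$ is closed.
   Context: Let $A=(a_{ij})_{i,j=1}^m$ be a generalized Cartan matrix (integral, $a_{ii}=2$, $a_{ij}\le 0$ for $i\ne j$, $a_{ij}=0\Rightarrow a_{ji}=0$) of rank $l$. Let $(\mathfrak h_{\mathbb R},\Pi,\Pi^\vee)$ be a realization of $A$ over $\mathbb R$: $\mathfrak h_{\mathbb R}$ is a real vector space of dimension $2m-l$, and $\Pi=\{\alpha_1,\dots,\alpha_m\}\subset\mathfrak h_{\mathbb R}^*$ and $\Pi^\vee=\{\alpha_1^\vee,\dots,\alpha_m^\vee\}\subset\mathfrak h_{\mathbb R}$ are linearly independent with $\langle\alpha_j,\alpha_i^\vee\rangle=a_{ij}$. The Weyl group $W\subset GL(\mathfrak h_{\mathbb R}^* )$ is generated by the reflections $r_{\alpha_i}(\eta)=\eta-\langle\eta,\alpha_i^\vee\rangle\alpha_i$. The fundamental chamber is $\overline C=\{\eta\in\mathfrak h_{\mathbb R}^*\mid\langle\eta,\alpha^\vee\rangle\ge 0\ \forall\alpha\in\Pi\}$. Set $J_0=\{\alpha\in\Pi\mid\langle\mu,\alpha^\vee\rangle=0\}$. Connected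 components of a subset of $\Pi$ are taken in the Dynkin diagram of $A$ (distinct $\alpha,\beta\in\Pi$ are adjacent iff $\langle\alpha,\beta^\vee\rangle\ne 0$). A subset $I\subseteq\Pi$ is $\mu$-connected if no connected component of $I$ is contained in $J_0$ (the empty set is $\mu$-connected). $\Pi^*$ is the biggest $\mu$-connected subset of $\Pi$, i.e. the union of the connected components of $\Pi$ not contained in $J_0$. For $K\subseteq\Pi$, $K^0$ is the union of those connected components of $K$ whose generalized Cartan submatrix is of finite type ($\emptyset^0=\emptyset$). The finite/affine/indefinite classification is the standard one (Kac) for Kac-Moody algebras $\mathfrak g(A)$ with indecomposable $A$; $\mathfrak g(A)$ is of strongly hyperbolic type if it is of indefinite type and every proper nonempty indecomposable generalized Cartan submatrix of $A$ is of finite type. *)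

theory Defs
  imports "HOL-Analysis.Analysis" "HOL-Algebra.Generated_Groups"
begin

text \<open>
  Matrices are indexed by a finite type \<open>'n\<close>, so \<open>m = CARD('n)\<close>. The index set also
  stands for the set of simple roots: \<open>i\<close> represents \<open>\<alpha> i\<close>, and subsets of
  \<open>\<Pi>\<close> are sets of indices (\<open>\<alpha>\<close> is injective in a realization).
\<close>

definition gen_cartan_matrix :: "real^'n^'n \<Rightarrow> bool" where
  "gen_cartan_matrix A \<longleftrightarrow>
     (\<forall>i j. A $ i $ j \<in> \<int>) \<and>
     (\<forall>i. A $ i $ i = 2) \<and>
     (\<forall>i j. i \<noteq> j \<longrightarrow> A $ i $ j \<le> 0) \<and>
     (\<forall>i j. A $ i $ j = 0 \<longrightarrow> A $ j $ i = 0)"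

text \<open>
  The real form of the Cartan subalgebra is a Euclidean space \<open>'h\<close> of which only the
  vector space structure and its canonical topology matter; its dual is
  \<open>'h \<Rightarrow>\<^sub>L real\<close>, as every linear functional is bounded in finite dimension.
\<close>

definition realization ::
  "real^'n^'n \<Rightarrow> ('n \<Rightarrow> ('h::euclidean_space \<Rightarrow>\<^sub>L real)) \<Rightarrow> ('n \<Rightarrow> 'h) \<Rightarrow> bool" where
  "realization A \<alpha> \<alpha>v \<longleftrightarrow>
     DIM('h) = 2 * CARD('n) - rank A \<and>
     inj \<alpha> \<and> independent (range \<alpha>) \<and>
     inj \<alpha>v \<and> independent (range \<alpha>v) \<and>
     (\<forall>i j. blinfun_apply (\<alpha> j) (\<alpha>v i) = A $ i $ j)"


subsection \<open>Weyl group and fundamental chamber\<close>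

definition simple_reflection ::
  "('n \<Rightarrow> ('h::euclidean_space \<Rightarrow>\<^sub>L real)) \<Rightarrow> ('n \<Rightarrow> 'h) \<Rightarrow> 'n
     \<Rightarrow> ('h \<Rightarrow>\<^sub>L real) \<Rightarrow> ('h \<Rightarrow>\<^sub>L real)" where
  "simple_reflection \<alpha> \<alpha>v i \<eta> = \<eta> - blinfun_apply \<eta> (\<alpha>v i) *\<^sub>R \<alpha> i"

definition general_linear_group :: "('v::real_vector \<Rightarrow> 'v) monoid" where
  "general_linear_group = \<lparr>carrier = {f. linear f \<and> bij f}, mult = (\<circ>), one = id\<rparr>"

definition weyl_group ::
  "('n \<Rightarrow> ('h::euclidean_space \<Rightarrow>\<^sub>L real)) \<Rightarrow> ('n \<Rightarrow> 'h)
     \<Rightarrow> (('h \<Rightarrow>\<^sub>L real) \<Rightarrow> ('h \<Rightarrow>\<^sub>L real)) set" where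
  "weyl_group \<alpha> \<alpha>v = generate general_linear_group (range (simple_reflection \<alpha> \<alpha>v))"

definition weyl_orbit ::
  "('n \<Rightarrow> ('h::euclidean_space \<Rightarrow>\<^sub>L real)) \<Rightarrow> ('n \<Rightarrow> 'h)
     \<Rightarrow> ('h \<Rightarrow>\<^sub>L real) \<Rightarrow> ('h \<Rightarrow>\<^sub>L real) set" where
  "weyl_orbit \<alpha> \<alpha>v \<mu> = (\<lambda>w. w \<mu>) ` weyl_group \<alpha> \<alpha>v"

definition fundamental_chamber :: "('n \<Rightarrow> 'h::euclidean_space) \<Rightarrow> ('h \<Rightarrow>\<^sub>L real) set" where
  "fundamental_chamber \<alpha>v = {\<eta>. \<forall>i. blinfun_apply \<eta> (\<alpha>v i) \<ge> 0}"


subsection \<open>Finite, affine and indefinite type (Kac)\<close>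

definition indecomposable :: "real^'n^'n \<Rightarrow> 'n set \<Rightarrow> bool" where
  "indecomposable A I \<longleftrightarrow> I \<noteq> {} \<and>
     \<not> (\<exists>I1 I2. I1 \<noteq> {} \<and> I2 \<noteq> {} \<and> I1 \<inter> I2 = {} \<and> I1 \<union> I2 = I \<and>
         (\<forall>i\<in>I1. \<forall>j\<in>I2. A $ i $ j = 0 \<and> A $ j $ i = 0))"

text \<open>
  The principal submatrix \<open>A\<^sub>I\<close> extended by the identity matrix outside \<open>I\<close>.
  It has the same determinant and the same corank as \<open>A\<^sub>I\<close>.
\<close>

definition principal_ext :: "real^'n^'n \<Rightarrow> 'n set \<Rightarrow> real^'n^'n" where
  "principal_ext A I = (\<chi> i j. if i \<in> I \<and> j \<in> I then A $ i $ j else if i = j then 1 else 0)"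

text \<open>
  \<open>submatrix_mult A I v\<close>, restricted to \<open>I\<close>, is the product of \<open>A\<^sub>I\<close> with
  the restriction of \<open>v\<close> to \<open>I\<close>. Below, \<open>v > 0\<close> means that all entries are
  positive, as in Kac's trichotomy for indecomposable matrices.
\<close>

definition submatrix_mult :: "real^'n^'n \<Rightarrow> 'n set \<Rightarrow> ('n \<Rightarrow> real) \<Rightarrow> 'n \<Rightarrow> real" where
  "submatrix_mult A I v i = (\<Sum>j\<in>I. A $ i $ j * v j)"

definition finite_type :: "real^'n^'n \<Rightarrow> 'n set \<Rightarrow> bool" where
  "finite_type A I \<longleftrightarrow> indecomposable A I \<and>
     det (principal_ext A I) \<noteq> 0 \<and>
     (\<exists>u. (\<forall>i\<in>I. u i > 0) \<and> (\<forall>i\<in>I. submatrix_mult A I u i > 0)) \<and>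
     (\<forall>v. (\<forall>i\<in>I. submatrix_mult A I v i \<ge> 0) \<longrightarrow> (\<forall>i\<in>I. v i > 0) \<or> (\<forall>i\<in>I. v i = 0))"

definition affine_type :: "real^'n^'n \<Rightarrow> 'n set \<Rightarrow> bool" where
  "affine_type A I \<longleftrightarrow> indecomposable A I \<and>
     CARD('n) - rank (principal_ext A I) = 1 \<and>
     (\<exists>u. (\<forall>i\<in>I. u i > 0) \<and> (\<forall>i\<in>I. submatrix_mult A I u i = 0)) \<and>
     (\<forall>v. (\<forall>i\<in>I. submatrix_mult A I v i \<ge> 0) \<longrightarrow> (\<forall>i\<in>I. submatrix_mult A I v i = 0))"

definition indefinite_type :: "real^'n^'n \<Rightarrow> 'n set \<Rightarrow> bool" where
  "indefinite_type A I \<longleftrightarrow> indecomposable A I \<and>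
     (\<exists>u. (\<forall>i\<in>I. u i > 0) \<and> (\<forall>i\<in>I. submatrix_mult A I u i < 0)) \<and>
     (\<forall>v. (\<forall>i\<in>I. submatrix_mult A I v i \<ge> 0) \<and> (\<forall>i\<in>I. v i \<ge> 0) \<longrightarrow> (\<forall>i\<in>I. v i = 0))"

definition strongly_hyperbolic_type :: "real^'n^'n \<Rightarrow> bool" where
  "strongly_hyperbolic_type A \<longleftrightarrow> indefinite_type A UNIV \<and>
     (\<forall>I. I \<noteq> {} \<and> I \<subset> UNIV \<and> indecomposable A I \<longrightarrow> finite_type A I)"


subsection \<open>Dynkin diagram and \<open>\<mu>\<close>-connected subsets\<close>

definition dynkin_edges :: "real^'n^'n \<Rightarrow> 'n set \<Rightarrow> ('n \<times> 'n) set" where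
  "dynkin_edges A I = {(i, j). i \<in> I \<and> j \<in> I \<and> i \<noteq> j \<and> A $ j $ i \<noteq> 0}"

definition dynkin_components :: "real^'n^'n \<Rightarrow> 'n set \<Rightarrow> 'n set set" where
  "dynkin_components A I = I // (dynkin_edges A I)\<^sup>*"

definition finite_part :: "real^'n^'n \<Rightarrow> 'n set \<Rightarrow> 'n set" where
  "finite_part A K = \<Union>{C \<in> dynkin_components A K. finite_type A C}"

definition stabilizer_roots :: "('n \<Rightarrow> 'h::euclidean_space) \<Rightarrow> ('h \<Rightarrow>\<^sub>L real) \<Rightarrow> 'n set" where
  "stabilizer_roots \<alpha>v \<mu> = {i. blinfun_apply \<mu> (\<alpha>v i) = 0}"

text \<open>The two definitions below depend on \<open>\<mu>\<close> only through \<open>J0 = stabilizer_roots \<alpha>v \<mu>\<close>.\<close>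

definition mu_connected :: "real^'n^'n \<Rightarrow> 'n set \<Rightarrow> 'n set \<Rightarrow> bool" where
  "mu_connected A J0 I \<longleftrightarrow> (\<forall>C\<in>dynkin_components A I. \<not> C \<subseteq> J0)"

definition biggest_mu_connected :: "real^'n^'n \<Rightarrow> 'n set \<Rightarrow> 'n set" where
  "biggest_mu_connected A J0 = (GREATEST I. mu_connected A J0 I)"

lemma biggest_mu_connected:
  assumes "gen_cartan_matrix A"
  shows "biggest_mu_connected A J0 = \<Union>{C \<in> dynkin_components A UNIV. \<not> C \<subseteq> J0}"
    and "mu_connected A J0 (biggest_mu_connected A J0)"
    and "mu_connected A J0 I \<Longrightarrow> I \<subseteq> biggest_mu_connected A J0"
proof -
  define U where "U = \<Union>{C \<in> dynkin_components A UNIV. \<not> C \<subseteq> J0}"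
  let ?E = "dynkin_edges A UNIV"
  have "sym ?E"
    using assms unfolding sym_def dynkin_edges_def gen_cartan_matrix_def by auto
  then have s: "sym (?E\<^sup>*)"
    by (rule sym_rtrancl)
  have inU: "x \<in> U \<longleftrightarrow> \<not> ?E\<^sup>* `` {x} \<subseteq> J0" for x
  proof
    assume "x \<in> U"
    then obtain z where z: "(z, x) \<in> ?E\<^sup>*" "\<not> ?E\<^sup>* `` {z} \<subseteq> J0"
      unfolding U_def dynkin_components_def quotient_def by auto
    have "?E\<^sup>* `` {z} \<subseteq> ?E\<^sup>* `` {x}"
      using symD[OF s z(1)] by (auto intro: rtrancl_trans)
    then show "\<not> ?E\<^sup>* `` {x} \<subseteq> J0" using z(2) by blast
  next
    assume "\<not> ?E\<^sup>* `` {x} \<subseteq> J0"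
    then show "x \<in> U"
      unfolding U_def dynkin_components_def quotient_def by blast
  qed
  have stay: "(x, y) \<in> (dynkin_edges A U)\<^sup>* \<and> y \<in> U" if "(x, y) \<in> ?E\<^sup>*" "x \<in> U" for x y
    using that
  proof (induction rule: rtrancl_induct)
    case (step y z)
    have "z \<in> U"
    proof -
      have "?E\<^sup>* `` {y} \<subseteq> ?E\<^sup>* `` {z}"
        using symD[OF \<open>sym ?E\<close> step(2)] by (auto intro: converse_rtrancl_into_rtrancl)
      then show ?thesis using step inU by blast
    qed
    moreover from this have "(y, z) \<in> dynkin_edges A U"
      using step unfolding dynkin_edges_def by auto
    ultimately show ?case using step by (auto intro: rtrancl_into_rtrancl)
  qed auto
  have conn: "mu_connected A J0 U"
    unfolding mu_connected_def
  proof
    fix C assume "C \<in> dynkin_components A U"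
    then obtain x where x: "x \<in> U" "C = (dynkin_edges A U)\<^sup>* `` {x}"
      unfolding dynkin_components_def quotient_def by auto
    have "?E\<^sup>* `` {x} \<subseteq> C" using x stay by auto
    then show "\<not> C \<subseteq> J0" using x(1) inU by blast
  qed
  have great: "I \<subseteq> U" if "mu_connected A J0 I" for I
  proof
    fix x assume "x \<in> I"
    then have "\<not> (dynkin_edges A I)\<^sup>* `` {x} \<subseteq> J0"
      using that unfolding mu_connected_def dynkin_components_def quotient_def by auto
    moreover have "(dynkin_edges A I)\<^sup>* \<subseteq> ?E\<^sup>*"
      by (rule rtrancl_mono) (auto simp: dynkin_edges_def)
    ultimately show "x \<in> U" using inU by blast
  qed
  have eq: "biggest_mu_connected A J0 = U"
    unfolding biggest_mu_connected_def by (rule Greatest_equality) (use conn great in auto)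
  show "biggest_mu_connected A J0 = \<Union>{C \<in> dynkin_components A UNIV. \<not> C \<subseteq> J0}"
    using eq unfolding U_def .
  show "mu_connected A J0 (biggest_mu_connected A J0)" using eq conn by simp
  show "mu_connected A J0 I \<Longrightarrow> I \<subseteq> biggest_mu_connected A J0" using eq great by simp
qed

end

theory Submission
  imports Defs
begin

text \<open>
  The hull meets the fundamental chamber exactly in the dominant points \<open>\<mu> - \<Sum> c\<^sub>i \<alpha>\<^sub>i\<close>
  with \<open>c \<ge> 0\<close> of \<open>\<mu>\<close>-connected support. That orbit points have this form follows from
  Tits' lemma on the signs of real coroots, applied along reduced words. Conversely, from
  \<open>\<mu>\<close> one can move inside the hull to a nearby point that is strictly dominant on the support,
  and then in uniform steps along a segment to every \<open>\<lambda>\<close> that is strictly dominant there. If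
  \<open>\<lambda>\<close> vanishes on some nodes \<open>J\<close> of the support, then \<open>\<mu>\<close>-connectedness forces
  \<open>J\<close> to be of finite type, and \<open>\<lambda>\<close> is a convex combination of the \<open>W\<^sub>J\<close>-orbit of
  a strictly dominant point.

  Closedness thus fails only if a limit can lose \<open>\<mu>\<close>-connectedness, which requires a component
  \<open>D \<subseteq> \<Pi>\<^sup>* \<inter> J\<^sub>0\<close> and \<open>u > 0\<close> on \<open>D\<close> with
  \<open>A\<^sub>D u \<le> 0\<close>, that is, a component of non-finite type.
\<close>


section \<open>Generalized Cartan matrices and their types\<close>

text \<open>Every argument about types rests on one sign principle: in a row where a nonnegative
  vector vanishes, a generalized Cartan matrix contributes only nonpositive terms. Hence zeros of
  such a vector spread to neighbours unless that row of the product is negative. The Weyl group is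
  never treated as a Coxeter group. Length is minimal length among words with equal action, and the
  sign statement for coroots is reduced to explicit rank two computations. Nor is W_J enumerated:
  its fixed point is reached by separating it from a convex stable set and descending on an integral
  functional. The converse inclusion is proved for an arbitrary convex reflection-stable set
  \<open>H\<close> containing \<mu>. The obstacle is that \<mu> may vanish on much of the support,
  and a root can be subtracted only where the value is positive. Subtracting a little of \<alpha>_j
  raises the values at the neighbours of j, and \<mu>-connectedness is what lets positivity spread
  to the whole support.\<close>

lemma gcm_diag: "gen_cartan_matrix A \<Longrightarrow> A $ i $ i = 2"
  by (simp add: gen_cartan_matrix_def)

lemma gcm_offdiag: "gen_cartan_matrix A \<Longrightarrow> i \<noteq> j \<Longrightarrow> A $ i $ j \<le> 0"
  by (simp add: gen_cartan_matrix_def)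

lemma gcm_sym_zero: "gen_cartan_matrix A \<Longrightarrow> A $ i $ j = 0 \<longleftrightarrow> A $ j $ i = 0"
  unfolding gen_cartan_matrix_def by metis

lemma gcm_Ints: "gen_cartan_matrix A \<Longrightarrow> A $ i $ j \<in> \<int>"
  by (simp add: gen_cartan_matrix_def)

section \<open>Products with principal submatrices and the sign principle\<close>

lemma submatrix_mult_lincomb:
  "submatrix_mult A I (\<lambda>j. a * u j + b * v j) i
     = a * submatrix_mult A I u i + b * submatrix_mult A I v i"
  unfolding submatrix_mult_def by (simp add: sum_distrib_left sum.distrib[symmetric] algebra_simps)

lemma submatrix_mult_diff:
  "submatrix_mult A I (\<lambda>j. u j - b * v j) i
     = submatrix_mult A I u i - b * submatrix_mult A I v i"
  using submatrix_mult_lincomb[of A I 1 u "-b" v i] by simp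

lemma submatrix_mult_cong:
  "(\<And>j. j \<in> I \<Longrightarrow> u j = v j) \<Longrightarrow> submatrix_mult A I u i = submatrix_mult A I v i"
  unfolding submatrix_mult_def by simp

lemma submatrix_mult_insert:
  "p \<notin> S \<Longrightarrow> submatrix_mult A (insert p S) u i = A $ i $ p * u p + submatrix_mult A S u i"
  unfolding submatrix_mult_def by simp

lemma submatrix_mult_mono_subset:
  assumes "gen_cartan_matrix A" "C \<subseteq> D" "i \<in> C" "\<And>j. j \<in> D - C \<Longrightarrow> u j \<ge> 0"
  shows "submatrix_mult A D u i \<le> submatrix_mult A C u i"
proof -
  have "submatrix_mult A D u i = submatrix_mult A C u i + (\<Sum>j\<in>D - C. A $ i $ j * u j)"
    unfolding submatrix_mult_def using assms(2) by (simp add: sum.subset_diff[of C D])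
  moreover have "(\<Sum>j\<in>D - C. A $ i $ j * u j) \<le> 0"
  proof (intro sum_nonpos mult_nonpos_nonneg)
    fix j assume "j \<in> D - C"
    then show "A $ i $ j \<le> 0" "u j \<ge> 0" using assms(3,4) by (auto intro: gcm_offdiag[OF assms(1)])
  qed
  ultimately show ?thesis by simp
qed

text \<open>The only positive entry of row \<open>i\<close> is the diagonal one, and it is either
  absent or multiplied by 0. All remaining terms are nonpositive, so a nonnegative sum makes each of
  them vanish.\<close>

lemma submatrix_mult_at_zero:
  assumes "gen_cartan_matrix A" "\<And>j. j \<in> I \<Longrightarrow> w j \<ge> 0" "i \<notin> I \<or> w i = 0"
  shows "submatrix_mult A I w i \<le> 0"
    and "submatrix_mult A I w i \<ge> 0 \<Longrightarrow> j \<in> I \<Longrightarrow> w j > 0 \<Longrightarrow> A $ i $ j = 0"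
proof -
  have le: "A $ i $ j * w j \<le> 0" if "j \<in> I" for j
    using that assms gcm_offdiag[OF assms(1), of i j]
    by (cases "i = j") (auto intro!: mult_nonpos_nonneg)
  then show "submatrix_mult A I w i \<le> 0"
    unfolding submatrix_mult_def by (intro sum_nonpos)
  assume "submatrix_mult A I w i \<ge> 0" "j \<in> I" "w j > 0"
  moreover have "(\<Sum>k\<in>I - {j}. A $ i $ k * w k) \<le> 0"
    using le by (intro sum_nonpos) auto
  ultimately have "A $ i $ j * w j \<ge> 0"
    unfolding submatrix_mult_def by (simp add: sum.remove[of I j])
  with le[OF \<open>j \<in> I\<close>] have "A $ i $ j * w j = 0" by linarith
  with \<open>w j > 0\<close> show "A $ i $ j = 0" by simp
qed

lemma indecomposable_boundary_edge:
  assumes "gen_cartan_matrix A" "indecomposable A I" "S \<subseteq> I" "S \<noteq> {}" "S \<noteq> I"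
  obtains i j where "i \<in> S" "j \<in> I - S" "A $ i $ j < 0" "A $ j $ i < 0"
proof -
  have S: "I - S \<noteq> {}" "S \<inter> (I - S) = {}" "S \<union> (I - S) = I" using assms(3,5) by blast+
  have "\<not> (\<forall>i\<in>S. \<forall>j\<in>I - S. A $ i $ j = 0 \<and> A $ j $ i = 0)"
  proof
    assume "\<forall>i\<in>S. \<forall>j\<in>I - S. A $ i $ j = 0 \<and> A $ j $ i = 0"
    then show False
      using assms(2) S assms(4) unfolding indecomposable_def by metis
  qed
  then obtain i j where ij: "i \<in> S" "j \<in> I - S" "\<not> (A $ i $ j = 0 \<and> A $ j $ i = 0)"
    by blast
  then have "i \<noteq> j" by auto
  then have "A $ i $ j \<le> 0" "A $ j $ i \<le> 0" by (simp_all add: gcm_offdiag[OF assms(1)])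
  moreover have "A $ i $ j \<noteq> 0" "A $ j $ i \<noteq> 0"
    using ij(3) gcm_sym_zero[OF assms(1), of i j] by auto
  ultimately show thesis using that[OF ij(1,2)] by linarith
qed

text \<open>A minimum principle: at a zero of \<open>w\<close> the row can be nonnegative only if
  all neighbours are zeros too, and indecomposability carries this through all of
  \<open>I\<close>.\<close>

lemma indecomposable_nonneg_zero:
  assumes "gen_cartan_matrix A" "indecomposable A I"
    and "\<And>j. j \<in> I \<Longrightarrow> w j \<ge> 0" "i \<in> I" "w i = 0"
    and "\<And>j. j \<in> I \<Longrightarrow> w j = 0 \<Longrightarrow> submatrix_mult A I w j \<ge> 0"
  shows "\<forall>j\<in>I. w j = 0"
proof (rule ccontr)
  let ?S = "{j\<in>I. w j = 0}"
  assume "\<not> ?thesis"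
  then have S: "?S \<noteq> I" "?S \<subseteq> I" "?S \<noteq> {}" using assms(4,5) by blast+
  obtain k j where kj: "k \<in> ?S" "j \<in> I - ?S" "A $ k $ j < 0"
    by (rule indecomposable_boundary_edge[OF assms(1,2) S(2,3,1)])
  then have k: "k \<in> I" "w k = 0" and j: "j \<in> I" "w j \<noteq> 0" by auto
  then have "w j > 0" using assms(3)[of j] by linarith
  moreover have "i \<notin> I \<or> w i = 0" if "i = k" for i using k(2) that by simp
  ultimately have "A $ k $ j = 0"
    by (intro submatrix_mult_at_zero(2)[of A I w k j, OF assms(1,3) _ assms(6)[OF k] j(1)]) simp_all
  with kj(3) show False by simp
qed

text \<open>The ratio test of linear programming: \<open>t\<close> is the largest multiple of
  \<open>v\<close> that can be subtracted from \<open>c\<close> within the nonnegative vectors. The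
  predicate \<open>P\<close> hands a property of all ratios, such as positivity, on to
  \<open>t\<close>.\<close>

lemma ratio_min:
  fixes c v :: "'a \<Rightarrow> real"
  assumes "finite J" "\<And>j. j \<in> J \<Longrightarrow> v j \<ge> 0" "k \<in> J" "v k > 0" "\<And>j. j \<in> J \<Longrightarrow> v j > 0 \<Longrightarrow> P (c j / v j)"
    "\<And>j. j \<in> J \<Longrightarrow> c j \<ge> 0"
  obtains t i where "i \<in> J" "v i > 0" "P t" "c i - t * v i = 0" "\<And>j. j \<in> J \<Longrightarrow> c j - t * v j \<ge> 0"
proof -
  let ?S = "(\<lambda>j. c j / v j) ` {j\<in>J. v j > 0}"
  have fin: "finite ?S" "?S \<noteq> {}" using assms by auto
  then obtain i where i: "i \<in> J" "v i > 0" "c i / v i = Min ?S"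
    using Min_in[OF fin] by force
  show thesis
  proof (rule that[of i "Min ?S"])
    show "c i - Min ?S * v i = 0" using i(2) by (simp flip: i(3))
    show "P (Min ?S)" using assms(5)[OF i(1,2)] i(3) by simp
    show "c j - Min ?S * v j \<ge> 0" if "j \<in> J" for j
    proof (cases "v j > 0")
      case True
      then have "Min ?S \<le> c j / v j" using that fin by (intro Min_le) auto
      then show ?thesis using True by (simp add: field_simps)
    next
      case False
      then have "v j = 0" using assms(2)[OF that] by simp
      then show ?thesis using assms(6)[OF that] by simp
    qed
  qed (use i in auto)
qed

text \<open>If the least ratio \<open>t\<close> of \<open>v\<close> to \<open>u\<close> were
  negative, \<open>v - t * u\<close> would be nonnegative with a zero at \<open>k\<close>, while row
  \<open>k\<close> of its product would be positive.\<close>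

lemma nonneg_of_submatrix_mult_nonneg:
  assumes "gen_cartan_matrix A"
    and "\<And>i. i \<in> I \<Longrightarrow> u i > 0" "\<And>i. i \<in> I \<Longrightarrow> submatrix_mult A I u i > 0"
    and "\<And>i. i \<in> I \<Longrightarrow> submatrix_mult A I v i \<ge> 0" "i \<in> I"
  shows "v i \<ge> (0::real)"
proof (rule ccontr)
  assume neg: "\<not> v i \<ge> 0"
  let ?S = "(\<lambda>j. v j / u j) ` I"
  have fin: "finite ?S" "?S \<noteq> {}" using assms(5) by auto
  then obtain k where k: "k \<in> I" "v k / u k = Min ?S"
    using Min_in[OF fin] by force
  define t where "t = Min ?S"
  have "t \<le> v i / u i" unfolding t_def using assms(5) fin by (intro Min_le) auto
  then have "t < 0" using neg assms(2)[OF assms(5)]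
    by (meson divide_neg_pos le_less_trans not_le)
  define w where "w j = v j - t * u j" for j
  have w0: "w j \<ge> 0" if "j \<in> I" for j
  proof -
    have "t \<le> v j / u j" unfolding t_def using that fin by (intro Min_le) auto
    then show ?thesis using assms(2)[OF that] unfolding w_def by (simp add: field_simps)
  qed
  have wk: "w k = 0" using assms(2)[OF k(1)] unfolding w_def t_def by (simp flip: k(2))
  have "submatrix_mult A I w k \<le> 0"
    by (rule submatrix_mult_at_zero(1)[OF assms(1) w0]) (simp_all add: wk)
  moreover have "submatrix_mult A I w k = submatrix_mult A I v k - t * submatrix_mult A I u k"
    unfolding w_def by (rule submatrix_mult_diff)
  moreover have "t * submatrix_mult A I u k < 0"
    using \<open>t < 0\<close> assms(3)[OF k(1)] by (simp add: mult_neg_pos)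
  ultimately show False using assms(4)[OF k(1)] by linarith
qed

section \<open>Invertibility and criteria for finite type\<close>

lemma principal_ext_mult:
  "(principal_ext A I *v w) $ i = (if i \<in> I then submatrix_mult A I (\<lambda>j. w $ j) i else w $ i)"
proof -
  have "(principal_ext A I *v w) $ i
      = (\<Sum>j\<in>UNIV. (if i \<in> I \<and> j \<in> I then A $ i $ j else if i = j then 1 else 0) * w $ j)"
    unfolding principal_ext_def matrix_vector_mult_def by simp
  also have "\<dots> = (if i \<in> I then (\<Sum>j\<in>UNIV. if j \<in> I then A $ i $ j * w $ j else 0) else w $ i)"
  proof (cases "i \<in> I")
    case False
    then show ?thesis by (simp add: if_distrib[of "\<lambda>x. x * _"] cong: if_cong)
  qed (auto intro!: sum.cong)
  finally show ?thesis
    unfolding submatrix_mult_def by (simp add: sum.If_cases)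
qed

text \<open>A kernel vector and its negative both have nonnegative image, so both are nonnegative on
  \<open>I\<close>.\<close>

lemma det_principal_ext_nonzero:
  assumes "gen_cartan_matrix A"
    and "\<And>i. i \<in> I \<Longrightarrow> u i > 0" "\<And>i. i \<in> I \<Longrightarrow> submatrix_mult A I u i > 0"
  shows "det (principal_ext A I) \<noteq> 0"
proof -
  have "w = 0" if w: "principal_ext A I *v w = 0" for w
  proof -
    have 1: "w $ i = 0" if "i \<notin> I" for i
      using principal_ext_mult[of A I w i] w that by simp
    have 2: "submatrix_mult A I (\<lambda>j. w $ j) i = 0" if "i \<in> I" for i
      using principal_ext_mult[of A I w i] w that by simp
    then have "submatrix_mult A I (\<lambda>j. - w $ j) i = 0" if "i \<in> I" for i
      using submatrix_mult_lincomb[of A I "-1" "\<lambda>j. w $ j" 0 "\<lambda>j. 0" i] that by simp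
    then have "w $ i \<ge> 0 \<and> - w $ i \<ge> 0" if "i \<in> I" for i
      using nonneg_of_submatrix_mult_nonneg[OF assms, of "\<lambda>j. w $ j" i]
        nonneg_of_submatrix_mult_nonneg[OF assms, of "\<lambda>j. - w $ j" i] 2 that by auto
    with 1 have "w $ i = 0" for i by (cases "i \<in> I") force+
    then show ?thesis by (simp add: vec_eq_iff)
  qed
  then have "\<exists>B. B ** principal_ext A I = mat 1"
    by (simp add: matrix_left_invertible_ker)
  then have "invertible (principal_ext A I)"
    using matrix_left_right_inverse unfolding invertible_def by blast
  then show ?thesis by (simp add: invertible_det_nz)
qed

text \<open>A single positive vector with positive image yields all of Kac's conditions; the
  dichotomy between positive and zero is the minimum principle.\<close>

lemma finite_typeI:
  assumes "gen_cartan_matrix A" "indecomposable A I"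
    and "\<And>i. i \<in> I \<Longrightarrow> u i > 0" "\<And>i. i \<in> I \<Longrightarrow> submatrix_mult A I u i > 0"
  shows "finite_type A I"
  unfolding finite_type_def
proof (intro conjI allI impI)
  show "det (principal_ext A I) \<noteq> 0" using det_principal_ext_nonzero[OF assms(1,3,4)] .
  show "\<exists>u. (\<forall>i\<in>I. u i > 0) \<and> (\<forall>i\<in>I. submatrix_mult A I u i > 0)" using assms by blast
  fix v :: "'a \<Rightarrow> real" assume v: "\<forall>i\<in>I. submatrix_mult A I v i \<ge> 0"
  have nn: "v i \<ge> 0" if "i \<in> I" for i
    by (rule nonneg_of_submatrix_mult_nonneg[OF assms(1,3,4) _ that]) (use v in auto)
  have "\<forall>j\<in>I. v j = 0" if "i \<in> I" "v i = 0" for i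
    by (rule indecomposable_nonneg_zero[of A I v i, OF assms(1,2) nn that]) (use v in auto)
  moreover have "v i > 0" if "i \<in> I" "v i \<noteq> 0" for i using nn[OF that(1)] that(2) by linarith
  ultimately show "(\<forall>i\<in>I. v i > 0) \<or> (\<forall>i\<in>I. v i = 0)" by blast
qed (fact assms(2))

text \<open>Induction on \<open>I\<close>: if \<open>A\<^sub>S\<close> is of the second kind, it has a nonnegative inverse, so
  \<open>e\<^sub>p\<close> extends to \<open>v \<ge> 0\<close> with \<open>A v = 0\<close> on \<open>S\<close>, and the sign of
  \<open>(A v)\<^sub>p\<close> decides the case \<open>insert p S\<close>.\<close>

lemma gcm_alternative:
  fixes A :: "real^'n^'n"
  assumes A: "gen_cartan_matrix A"
  shows "(\<exists>u. (\<forall>i\<in>I. u i \<ge> 0) \<and> (\<exists>i\<in>I. u i > 0) \<and> (\<forall>i\<in>I. submatrix_mult A I u i \<le> 0)) \<or>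
         (\<exists>u. (\<forall>i\<in>I. u i > 0) \<and> (\<forall>i\<in>I. submatrix_mult A I u i > 0))"
proof -
  have "finite I" by simp
  then show ?thesis
  proof (induction I rule: finite_induct)
    case empty
    then show ?case by simp
  next
    case (insert p S)
    note sub = submatrix_mult_insert[OF insert(2)]
    show ?case
    proof (cases "\<exists>u. (\<forall>i\<in>S. u i \<ge> 0) \<and> (\<exists>i\<in>S. u i > 0) \<and> (\<forall>i\<in>S. submatrix_mult A S u i \<le> 0)")
      case True
      then obtain u where u: "\<forall>i\<in>S. u i \<ge> 0" "\<exists>i\<in>S. u i > 0" "\<forall>i\<in>S. submatrix_mult A S u i \<le> 0"
        by blast
      define u' where "u' i = (if i = p then 0 else u i)" for i
      have eq: "submatrix_mult A (insert p S) u' i = submatrix_mult A S u i" for i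
        unfolding sub using insert(2) by (simp add: u'_def) (rule submatrix_mult_cong, auto simp: u'_def)
      have "submatrix_mult A S u p \<le> 0"
        by (rule submatrix_mult_at_zero(1)[OF A]) (use u(1) insert(2) in auto)
      then have "(\<forall>i\<in>insert p S. u' i \<ge> 0) \<and> (\<exists>i\<in>insert p S. u' i > 0)
          \<and> (\<forall>i\<in>insert p S. submatrix_mult A (insert p S) u' i \<le> 0)"
        using u insert(2) unfolding eq by (auto simp: u'_def)
      then show ?thesis by blast
    next
      case False
      then obtain u where u': "\<forall>i\<in>S. u i > 0" "\<forall>i\<in>S. submatrix_mult A S u i > 0"
        using insert.IH by blast
      then have u: "\<And>i. i \<in> S \<Longrightarrow> u i > 0" "\<And>i. i \<in> S \<Longrightarrow> submatrix_mult A S u i > 0"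
        by blast+
      have "invertible (principal_ext A S)"
        using det_principal_ext_nonzero[OF A u] by (simp add: invertible_det_nz)
      then have "surj ((*v) (principal_ext A S))"
        unfolding invertible_def matrix_right_invertible_surjective[symmetric] by blast
      then obtain w where w: "principal_ext A S *v w = (\<chi> i. if i \<in> S then - A $ i $ p else 0)"
        unfolding surj_def by metis
      define v where "v i = (if i = p then 1 else w $ i)" for i
      have "submatrix_mult A S v i = submatrix_mult A S (\<lambda>j. w $ j) i" for i
        using insert(2) by (intro submatrix_mult_cong) (auto simp: v_def)
      then have Sv: "submatrix_mult A S v i = - A $ i $ p" if "i \<in> S" for i
        using principal_ext_mult[of A S w i] w that by simp
      have vS: "v i \<ge> 0" if "i \<in> S" for i
      proof (rule nonneg_of_submatrix_mult_nonneg[OF A u _ that])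
        fix k assume "k \<in> S"
        then have "k \<noteq> p" using insert(2) by blast
        then show "submatrix_mult A S v k \<ge> 0"
          using Sv[OF \<open>k \<in> S\<close>] gcm_offdiag[OF A, of k p] by simp
      qed
      have "v p = 1" by (simp add: v_def)
      then have vnn: "v i \<ge> 0" if "i \<in> insert p S" for i using that vS[of i] by (cases "i = p") auto
      have v0: "submatrix_mult A (insert p S) v i = 0" if "i \<in> S" for i
        unfolding sub using Sv[OF that] by (simp add: v_def)
      define s where "s = submatrix_mult A (insert p S) v p"
      show ?thesis
      proof (cases "s \<le> 0")
        case True
        have "(\<forall>i\<in>insert p S. v i \<ge> 0) \<and> (\<exists>i\<in>insert p S. v i > 0)
          \<and> (\<forall>i\<in>insert p S. submatrix_mult A (insert p S) v i \<le> 0)"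
          using vnn v0 True \<open>v p = 1\<close> by (auto simp: s_def)
        then show ?thesis by blast
      next
        case False
        define z where "z i = (if i = p then 0 else u i)" for i
        have z: "submatrix_mult A (insert p S) z i = submatrix_mult A S u i" for i
          unfolding sub using insert(2) by (simp add: z_def) (rule submatrix_mult_cong, auto simp: z_def)
        \<comment> \<open>Adding \<open>d * z\<close> makes the rows in \<open>S\<close> positive
          but may lower row \<open>p\<close>, by at most \<open>s / 2\<close> for this
          \<open>d\<close>. The \<open>+ 1\<close> only avoids division by zero.\<close>
        define d where "d = s / (2 * (\<bar>submatrix_mult A S u p\<bar> + 1))"
        have d: "d > 0" "d * \<bar>submatrix_mult A S u p\<bar> < s"
        proof -
          show "d > 0" using False unfolding d_def by simp
          have "d * \<bar>submatrix_mult A S u p\<bar> \<le> d * (\<bar>submatrix_mult A S u p\<bar> + 1)"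
            using \<open>d > 0\<close> by (intro mult_left_mono) auto
          also have "\<dots> = s / 2" unfolding d_def by (simp add: field_simps add_nonneg_eq_0_iff)
          finally show "d * \<bar>submatrix_mult A S u p\<bar> < s" using False by linarith
        qed
        define y where "y i = 1 * v i + d * z i" for i
        have y: "submatrix_mult A (insert p S) y i
            = submatrix_mult A (insert p S) v i + d * submatrix_mult A S u i" for i
          unfolding y_def submatrix_mult_lincomb z by simp
        have "y i > 0" if "i \<in> insert p S" for i
          using that vnn[OF that] u(1) d(1) \<open>v p = 1\<close> unfolding y_def z_def
          by (cases "i = p") (auto intro!: add_nonneg_pos)
        moreover have "submatrix_mult A (insert p S) y i > 0" if "i \<in> insert p S" for i
        proof (cases "i = p")
          case True
          have "d * submatrix_mult A S u p \<ge> - (d * \<bar>submatrix_mult A S u p\<bar>)"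
            using abs_ge_minus_self[of "d * submatrix_mult A S u p"] d(1) by (simp add: abs_mult)
          then show ?thesis using d(2) unfolding y True s_def[symmetric] by linarith
        next
          case False
          then show ?thesis using that v0 u(2) d(1) unfolding y by auto
        qed
        ultimately show ?thesis by blast
      qed
    qed
  qed
qed

text \<open>A nonnegative subsolution of maximal support has full support, as otherwise a small multiple
  of a basis vector at an adjacent node could be added.\<close>

lemma not_finite_type_subsolution:
  assumes A: "gen_cartan_matrix A" and I: "indecomposable A I" and nf: "\<not> finite_type A I"
  shows "\<exists>u. (\<forall>i\<in>I. u i > 0) \<and> (\<forall>i\<in>I. submatrix_mult A I u i \<le> 0)"
proof -
  define P where "P u \<longleftrightarrow> (\<forall>i\<in>I. u i \<ge> 0) \<and> (\<exists>i\<in>I. u i > 0) \<and>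
    (\<forall>i\<in>I. submatrix_mult A I u i \<le> 0)" for u :: "'a \<Rightarrow> real"
  have "\<exists>u. P u"
  proof (rule ccontr)
    assume "\<not> ?thesis"
    then obtain u where "\<forall>i\<in>I. u i > 0" "\<forall>i\<in>I. submatrix_mult A I u i > 0"
      using gcm_alternative[OF A, of I] unfolding P_def by blast
    then have "finite_type A I" by (intro finite_typeI[OF A I, of u]) blast+
    then show False using nf by blast
  qed
  then obtain u where u: "P u" and max: "\<And>v. P v \<Longrightarrow> card {i\<in>I. v i > 0} \<le> card {i\<in>I. u i > 0}"
  proof -
    obtain v0 where "P v0" using \<open>\<exists>u. P u\<close> by blast
    have "card {i\<in>I. v i > 0} < Suc (card I)" for v :: "'a \<Rightarrow> real"
      by (simp add: card_mono less_Suc_eq_le)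
    then show thesis
      using ex_has_greatest_nat[of P v0 "\<lambda>v. card {i\<in>I. v i > 0}" "Suc (card I)"] \<open>P v0\<close> that
      by blast
  qed
  have "u i > 0" if "i \<in> I" for i
  proof (rule ccontr)
    assume "\<not> u i > 0"
    then have S: "{i\<in>I. u i > 0} \<subseteq> I" "{i\<in>I. u i > 0} \<noteq> {}" "{i\<in>I. u i > 0} \<noteq> I"
      using that u unfolding P_def by blast+
    obtain k p where "k \<in> {i\<in>I. u i > 0}" "p \<in> I - {i\<in>I. u i > 0}" "A $ p $ k < 0"
      by (rule indecomposable_boundary_edge[OF A I S])
    then have kp: "k \<in> I" "u k > 0" "p \<in> I" "\<not> u p > 0" "A $ p $ k < 0" by auto
    have up: "u p = 0" using u kp unfolding P_def by force
    have neg: "submatrix_mult A I u p < 0"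
      using submatrix_mult_at_zero(1)[OF A, of I u p] submatrix_mult_at_zero(2)[OF A, of I u p k] u kp up unfolding P_def by force
    \<comment> \<open>Since the diagonal entry is 2, adding \<open>e\<close> at \<open>p\<close>
      brings row \<open>p\<close> exactly to 0; every other row can only decrease.\<close>
    define e where "e = - submatrix_mult A I u p / 2"
    define v where "v j = 1 * u j + e * (if j = p then 1 else 0)" for j
    have v: "submatrix_mult A I v j = submatrix_mult A I u j + e * A $ j $ p" for j
    proof -
      have "submatrix_mult A I (\<lambda>j. if j = p then 1 else 0) j = A $ j $ p"
        unfolding submatrix_mult_def using kp(3) by (simp add: if_distrib cong: if_cong)
      then show ?thesis unfolding v_def submatrix_mult_lincomb by simp
    qed
    have "submatrix_mult A I v j \<le> 0" if "j \<in> I" for j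
    proof (cases "j = p")
      case True
      then show ?thesis unfolding v by (simp add: gcm_diag[OF A] e_def)
    next
      case False
      then have "e * A $ j $ p \<le> 0"
        using gcm_offdiag[OF A] neg by (intro mult_nonneg_nonpos) (auto simp: e_def)
      then show ?thesis using u that unfolding v P_def by force
    qed
    moreover have "v j \<ge> u j" for j using neg unfolding v_def e_def by simp
    moreover have vp: "v p > 0" using up neg unfolding v_def e_def by simp
    ultimately have "P v" using u kp(3) unfolding P_def by (meson order_trans)
    moreover have "{i\<in>I. u i > 0} \<subset> {i\<in>I. v i > 0}"
      using \<open>\<And>j. v j \<ge> u j\<close> vp kp by (auto intro: less_le_trans)
    ultimately show False using max[of v] psubset_card_mono[of "{i\<in>I. v i > 0}" "{i\<in>I. u i > 0}"]
      by auto
  qed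
  then show ?thesis using u unfolding P_def by blast
qed

text \<open>Otherwise subtract from \<open>c\<close> the largest possible multiple of a positive
  subsolution. The difference has a zero and nonnegative rows, so it vanishes identically, against
  the strict row \<open>k\<close>.\<close>

lemma finite_type_if_supersolution:
  assumes A: "gen_cartan_matrix A" and I: "indecomposable A I"
    and c: "\<And>i. i \<in> I \<Longrightarrow> c i > 0" "\<And>i. i \<in> I \<Longrightarrow> submatrix_mult A I c i \<ge> 0"
    and k: "k \<in> I" "submatrix_mult A I c k > 0"
  shows "finite_type A I"
proof (rule ccontr)
  assume "\<not> finite_type A I"
  then obtain v where v': "\<forall>i\<in>I. v i > 0" "\<forall>i\<in>I. submatrix_mult A I v i \<le> 0"
    using not_finite_type_subsolution[OF A I] by blast
  then have v: "\<And>i. i \<in> I \<Longrightarrow> v i > 0" "\<And>i. i \<in> I \<Longrightarrow> submatrix_mult A I v i \<le> 0"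
    by simp_all
  obtain t i where ti: "i \<in> I" "t > 0" "c i - t * v i = 0" "\<And>j. j \<in> I \<Longrightarrow> c j - t * v j \<ge> 0"
    by (rule ratio_min[of I v k "\<lambda>t. t > 0" c]) (use v c k(1) in \<open>auto intro: less_imp_le\<close>)
  have ge: "submatrix_mult A I (\<lambda>j. c j - t * v j) j \<ge> submatrix_mult A I c j" if "j \<in> I" for j
    unfolding submatrix_mult_diff using v(2)[OF that] ti(2) by (simp add: mult_nonneg_nonpos)
  have "\<forall>j\<in>I. c j - t * v j = 0"
    using ti ge c(2) by (intro indecomposable_nonneg_zero[OF A I, of _ i]) (auto intro: order_trans)
  then have "submatrix_mult A I (\<lambda>j. c j - t * v j) k = 0" unfolding submatrix_mult_def by simp
  then show False using ge[OF k(1)] k(2) by simp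
qed

lemma finite_type_subset:
  assumes A: "gen_cartan_matrix A" and "finite_type A D" "C \<subseteq> D" "indecomposable A C"
  shows "finite_type A C"
proof -
  obtain u where u: "\<forall>i\<in>D. u i > 0" "\<forall>i\<in>D. submatrix_mult A D u i > 0"
    using assms(2) unfolding finite_type_def by blast
  have "submatrix_mult A C u i > 0" if "i \<in> C" for i
  proof -
    have "submatrix_mult A D u i \<le> submatrix_mult A C u i"
      using u by (intro submatrix_mult_mono_subset[OF A assms(3) that]) (simp add: less_imp_le)
    then show ?thesis using u assms(3) that by force
  qed
  then show ?thesis using u assms by (intro finite_typeI[OF A, of C u]) auto
qed

text \<open>Restricting the null vector \<open>u\<close> of \<open>D\<close> to \<open>C\<close>
  drops nonpositive terms, and drops a negative one in a row \<open>k\<close> with an edge leaving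
  \<open>C\<close>. So \<open>u\<close> is a supersolution on \<open>C\<close>, strict at
  \<open>k\<close>.\<close>

lemma finite_type_proper_subset_affine:
  assumes A: "gen_cartan_matrix A" and "affine_type A D" "C \<subset> D" "indecomposable A C"
  shows "finite_type A C"
proof -
  obtain u where u': "\<forall>i\<in>D. u i > 0" "\<forall>i\<in>D. submatrix_mult A D u i = 0"
    and D: "indecomposable A D"
    using assms(2) unfolding affine_type_def by blast
  then have u: "u i > 0" "submatrix_mult A D u i = 0" if "i \<in> D" for i using that by blast+
  have "C \<noteq> {}" using assms(4) unfolding indecomposable_def by blast
  with assms(3) have "C \<subseteq> D" "C \<noteq> D" by blast+
  obtain k j where kj: "k \<in> C" "j \<in> D - C" "A $ k $ j < 0"
    by (rule indecomposable_boundary_edge[OF A D \<open>C \<subseteq> D\<close> \<open>C \<noteq> {}\<close> \<open>C \<noteq> D\<close>])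
  have ge: "submatrix_mult A C u i \<ge> 0" if "i \<in> C" for i
  proof -
    have "submatrix_mult A D u i \<le> submatrix_mult A C u i"
      using u assms(3) that by (intro submatrix_mult_mono_subset[OF A]) (auto simp: less_imp_le)
    then show ?thesis using u assms(3) that by force
  qed
  have "submatrix_mult A C u k \<noteq> 0"
  proof
    assume eq: "submatrix_mult A C u k = 0"
    have "C \<subseteq> D" using assms(3) by blast
    have "submatrix_mult A D u k = submatrix_mult A C u k + submatrix_mult A (D - C) u k"
      unfolding submatrix_mult_def using \<open>C \<subseteq> D\<close> by (simp add: sum.subset_diff[of C D])
    then have "submatrix_mult A (D - C) u k \<ge> 0" using eq u(2) kj(1) \<open>C \<subseteq> D\<close> by auto
    then have "A $ k $ j = 0"
      using submatrix_mult_at_zero(2)[OF A, of "D - C" u k j] u(1) kj by (simp add: less_imp_le)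
    then show False using kj(3) by simp
  qed
  then show ?thesis
    using ge[OF kj(1)] ge u assms(3) by (intro finite_type_if_supersolution[OF A assms(4), of u k] kj) auto
qed

section \<open>Dynkin components\<close>

lemma sym_dynkin_edges: "gen_cartan_matrix A \<Longrightarrow> sym (dynkin_edges A I)"
  unfolding sym_def dynkin_edges_def by (auto simp: gcm_sym_zero)

lemma sym_dynkin_edges_rtrancl: "gen_cartan_matrix A \<Longrightarrow> sym ((dynkin_edges A I)\<^sup>*)"
  by (intro sym_rtrancl sym_dynkin_edges)

lemma dynkin_edges_mono: "I \<subseteq> I' \<Longrightarrow> dynkin_edges A I \<subseteq> dynkin_edges A I'"
  unfolding dynkin_edges_def by auto

lemma dynkin_rtrancl_closed:
  "(x, y) \<in> (dynkin_edges A I)\<^sup>* \<Longrightarrow> x \<in> I \<Longrightarrow> y \<in> I"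
  by (induction rule: rtrancl_induct) (auto simp: dynkin_edges_def)

lemma dynkin_components_iff:
  "C \<in> dynkin_components A I \<longleftrightarrow> (\<exists>x\<in>I. C = (dynkin_edges A I)\<^sup>* `` {x})"
  unfolding dynkin_components_def quotient_def by auto

lemma dynkin_component_eq:
  assumes "gen_cartan_matrix A" "C \<in> dynkin_components A I" "x \<in> C"
  shows "C = (dynkin_edges A I)\<^sup>* `` {x}"
proof -
  obtain z where z: "C = (dynkin_edges A I)\<^sup>* `` {z}"
    using assms(2) unfolding dynkin_components_iff by blast
  then have "(z, x) \<in> (dynkin_edges A I)\<^sup>*" "(x, z) \<in> (dynkin_edges A I)\<^sup>*"
    using assms(3) symD[OF sym_dynkin_edges_rtrancl[OF assms(1)]] by auto
  then show ?thesis unfolding z by (auto intro: rtrancl_trans)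
qed

lemma dynkin_component_subset: "C \<in> dynkin_components A I \<Longrightarrow> C \<subseteq> I"
  unfolding dynkin_components_iff using dynkin_rtrancl_closed by fastforce

lemma dynkin_component_isolated:
  assumes "gen_cartan_matrix A" "C \<in> dynkin_components A I" "i \<in> C" "j \<in> I - C"
  shows "A $ i $ j = 0"
proof (rule ccontr)
  assume "A $ i $ j \<noteq> 0"
  then have "(i, j) \<in> dynkin_edges A I"
    using assms dynkin_component_subset[OF assms(2)] gcm_sym_zero[OF assms(1)]
    unfolding dynkin_edges_def by auto
  then have "j \<in> C" unfolding dynkin_component_eq[OF assms(1-3)] by auto
  then show False using assms(4) by blast
qed

lemma indecomposable_dynkin_component:
  assumes A: "gen_cartan_matrix A" and C: "C \<in> dynkin_components A I"
  shows "indecomposable A C"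
  unfolding indecomposable_def
proof (intro conjI notI)
  assume "C = {}" then show False using C unfolding dynkin_components_iff by auto
next
  assume "\<exists>I1 I2. I1 \<noteq> {} \<and> I2 \<noteq> {} \<and> I1 \<inter> I2 = {} \<and> I1 \<union> I2 = C \<and>
         (\<forall>i\<in>I1. \<forall>j\<in>I2. A $ i $ j = 0 \<and> A $ j $ i = 0)"
  then obtain I1 I2 where I: "I1 \<noteq> {}" "I2 \<noteq> {}" "I1 \<inter> I2 = {}" "I1 \<union> I2 = C"
    "\<forall>i\<in>I1. \<forall>j\<in>I2. A $ i $ j = 0 \<and> A $ j $ i = 0" by blast
  then obtain x y where xy: "x \<in> I1" "y \<in> I2" by blast
  then have "(x, y) \<in> (dynkin_edges A I)\<^sup>*"
    using dynkin_component_eq[OF A C, of x] I(4) by blast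
  then have "y \<in> I1"
  proof (induction rule: rtrancl_induct)
    case (step y z)
    have "(x, z) \<in> (dynkin_edges A I)\<^sup>*" using step(1,2) by (rule rtrancl_into_rtrancl)
    then have "z \<in> C" using dynkin_component_eq[OF A C, of x] I(4) xy(1) by blast
    then show ?case using step I(4,5) unfolding dynkin_edges_def by auto
  qed (fact xy)
  then show False using xy I(3) by blast
qed

text \<open>Components merge when the set grows, whereas paths persist. The path form is therefore
  the one suited to unions and inductions.\<close>

lemma mu_connected_iff:
  "mu_connected A J0 I \<longleftrightarrow> (\<forall>i\<in>I. \<exists>j\<in>I - J0. (i, j) \<in> (dynkin_edges A I)\<^sup>*)"
proof
  assume L: "mu_connected A J0 I"
  show "\<forall>i\<in>I. \<exists>j\<in>I - J0. (i, j) \<in> (dynkin_edges A I)\<^sup>*"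
  proof
    fix i assume "i \<in> I"
    then have "(dynkin_edges A I)\<^sup>* `` {i} \<in> dynkin_components A I"
      unfolding dynkin_components_iff by (rule bexI[rotated]) simp
    then have "\<not> (dynkin_edges A I)\<^sup>* `` {i} \<subseteq> J0"
      using L unfolding mu_connected_def by simp
    then show "\<exists>j\<in>I - J0. (i, j) \<in> (dynkin_edges A I)\<^sup>*"
      using dynkin_rtrancl_closed[of i _ A I] \<open>i \<in> I\<close> by blast
  qed
next
  assume R: "\<forall>i\<in>I. \<exists>j\<in>I - J0. (i, j) \<in> (dynkin_edges A I)\<^sup>*"
  show "mu_connected A J0 I"
    unfolding mu_connected_def
  proof
    fix C assume "C \<in> dynkin_components A I"
    then obtain x where "x \<in> I" "C = (dynkin_edges A I)\<^sup>* `` {x}"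
      unfolding dynkin_components_iff by (elim bexE)
    then show "\<not> C \<subseteq> J0" using R by blast
  qed
qed

lemma mu_connected_Un:
  assumes "mu_connected A J0 I" "mu_connected A J0 I'"
  shows "mu_connected A J0 (I \<union> I')"
proof -
  have "(dynkin_edges A I)\<^sup>* \<subseteq> (dynkin_edges A (I \<union> I'))\<^sup>*"
    "(dynkin_edges A I')\<^sup>* \<subseteq> (dynkin_edges A (I \<union> I'))\<^sup>*"
    by (intro rtrancl_mono dynkin_edges_mono; simp)+
  then show ?thesis using assms unfolding mu_connected_iff by blast
qed

text \<open>A path from \<open>Z\<close> to a node outside \<open>J0\<close> has to leave
  \<open>Z\<close>.\<close>

lemma mu_connected_boundary_edge:
  assumes A: "gen_cartan_matrix A" and "mu_connected A J0 I" "Z \<subseteq> I" "Z \<subseteq> J0" "Z \<noteq> {}"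
  obtains i j where "i \<in> Z" "j \<in> I - Z" "A $ i $ j \<noteq> 0" "i \<noteq> j"
proof -
  obtain z where z: "z \<in> Z" using assms(5) by blast
  then obtain y where y: "y \<in> I - J0" "(z, y) \<in> (dynkin_edges A I)\<^sup>*"
    using assms(2,3) unfolding mu_connected_iff by blast
  have "y \<in> Z \<or> (\<exists>i j. i \<in> Z \<and> j \<in> I - Z \<and> A $ i $ j \<noteq> 0 \<and> i \<noteq> j)"
    using y(2)
  proof (induction rule: rtrancl_induct)
    case (step u v)
    then show ?case using gcm_sym_zero[OF A] unfolding dynkin_edges_def by blast
  qed (use z in blast)
  then show thesis using y(1) assms(4) that by blast
qed

text \<open>Components are disjoint: a node covered by a component of finite type has that component
  as its own.\<close>

lemma finite_part_eq_iff:
  assumes "gen_cartan_matrix A"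
  shows "finite_part A K = K \<longleftrightarrow> (\<forall>C\<in>dynkin_components A K. finite_type A C)"
proof
  assume L: "finite_part A K = K"
  show "\<forall>C\<in>dynkin_components A K. finite_type A C"
  proof
    fix C assume C: "C \<in> dynkin_components A K"
    then obtain x where x: "x \<in> K" "C = (dynkin_edges A K)\<^sup>* `` {x}"
      unfolding dynkin_components_iff by (elim bexE)
    then obtain C' where C': "C' \<in> dynkin_components A K" "finite_type A C'" "x \<in> C'"
      using L unfolding finite_part_def by blast
    then show "finite_type A C" using dynkin_component_eq[OF assms, of C' K x] x by simp
  qed
next
  assume "\<forall>C\<in>dynkin_components A K. finite_type A C"
  then have "finite_part A K = \<Union>(dynkin_components A K)" unfolding finite_part_def by blast
  also have "\<dots> = K"
  proof
    show "\<Union>(dynkin_components A K) \<subseteq> K" using dynkin_component_subset by (rule Union_least)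
    show "K \<subseteq> \<Union>(dynkin_components A K)"
    proof
      fix x assume "x \<in> K"
      then have "(dynkin_edges A K)\<^sup>* `` {x} \<in> dynkin_components A K"
        unfolding dynkin_components_iff by (rule bexI[rotated]) simp
      then show "x \<in> \<Union>(dynkin_components A K)" by (rule UnionI) simp
    qed
  qed
  finally show "finite_part A K = K" .
qed

section \<open>Signs of real coroots\<close>

locale gcm_realization =
  fixes A :: "real^'n^'n"
    and \<alpha> :: "'n \<Rightarrow> ('h::euclidean_space \<Rightarrow>\<^sub>L real)"
    and \<alpha>v :: "'n \<Rightarrow> 'h"
  assumes gcm: "gen_cartan_matrix A"
    and pairing: "blinfun_apply (\<alpha> j) (\<alpha>v i) = A $ i $ j"
begin

definition coreflection :: "'n \<Rightarrow> 'h \<Rightarrow> 'h" where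
  "coreflection i x = x - \<alpha> i x *\<^sub>R \<alpha>v i"

text \<open>Words stand for elements of the group generated by the reflections of the coroot side;
  the last letter acts first.\<close>

definition act :: "'n list \<Rightarrow> 'h \<Rightarrow> 'h" where
  "act xs = foldr coreflection xs"

definition coroot_cone :: "'h set" where
  "coroot_cone = {x. \<exists>c. (\<forall>i. c i \<ge> 0) \<and> x = (\<Sum>i\<in>UNIV. c i *\<^sub>R \<alpha>v i)}"

text \<open>The word attains the Coxeter length of the transformation that it induces.\<close>

definition reduced :: "'n list \<Rightarrow> bool" where
  "reduced ys \<longleftrightarrow> (\<forall>zs. act zs = act ys \<longrightarrow> length ys \<le> length zs)"

lemma act_Nil [simp]: "act [] x = x"
  and act_Cons [simp]: "act (i # xs) x = coreflection i (act xs x)"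
  and act_append [simp]: "act (xs @ ys) x = act xs (act ys x)"
  by (simp_all add: act_def)

lemma coreflection_coreflection [simp]: "coreflection i (coreflection i x) = x"
  by (simp add: coreflection_def blinfun.diff_right blinfun.scaleR_right pairing gcm_diag[OF gcm] algebra_simps)

lemma linear_coreflection: "linear (coreflection i)"
  by (rule linearI) (simp_all add: coreflection_def blinfun.add_right blinfun.scaleR_right algebra_simps)

lemma linear_act: "linear (act xs)"
proof (induction xs)
  case Nil
  then show ?case by (rule linearI) simp_all
next
  case (Cons i xs)
  have "act (i # xs) = coreflection i \<circ> act xs" by auto
  then show ?case using linear_compose[OF Cons linear_coreflection] by metis
qed

lemma coroot_cone_comb:
  assumes "x \<in> coroot_cone" "y \<in> coroot_cone" "a \<ge> 0" "b \<ge> 0"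
  shows "a *\<^sub>R x + b *\<^sub>R y \<in> coroot_cone"
proof -
  obtain c d where "\<forall>i. c i \<ge> 0" "x = (\<Sum>i\<in>UNIV. c i *\<^sub>R \<alpha>v i)"
    "\<forall>i. d i \<ge> 0" "y = (\<Sum>i\<in>UNIV. d i *\<^sub>R \<alpha>v i)"
    using assms(1,2) unfolding coroot_cone_def by blast
  then have "\<forall>i. a * c i + b * d i \<ge> 0"
    "a *\<^sub>R x + b *\<^sub>R y = (\<Sum>i\<in>UNIV. (a * c i + b * d i) *\<^sub>R \<alpha>v i)"
    using assms(3,4) by (simp_all add: scaleR_sum_right sum.distrib algebra_simps)
  then show ?thesis unfolding coroot_cone_def by (intro CollectI exI[of _ "\<lambda>i. a * c i + b * d i"]) simp
qed

lemma coroot_in_cone: "\<alpha>v i \<in> coroot_cone"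
proof -
  have "\<alpha>v i = (\<Sum>j\<in>UNIV. (if j = i then 1 else 0) *\<^sub>R \<alpha>v j)"
    by (simp add: if_distrib[of "\<lambda>x. x *\<^sub>R _"] cong: if_cong)
  then show ?thesis
    unfolding coroot_cone_def by (intro CollectI exI[of _ "\<lambda>j. if j = i then 1 else 0"]) simp
qed

end

text \<open>The word \<open>... a b a\<close> of length \<open>k\<close>, built from the right
  because the last letter acts first and the induction below peels off that letter.\<close>

fun alt_word :: "'a \<Rightarrow> 'a \<Rightarrow> nat \<Rightarrow> 'a list" where
  "alt_word a b 0 = []"
| "alt_word a b (Suc k) = alt_word b a k @ [a]"

lemma length_alt_word [simp]: "length (alt_word a b k) = k"
  by (induction k arbitrary: a b) auto

lemma alt_word_suffix:
  "m \<le> k \<Longrightarrow> \<exists>w. length w = k - m \<and> alt_word a b k = w @ alt_word a b m"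
proof (induction k arbitrary: m a b)
  case (Suc k)
  show ?case
  proof (cases m)
    case 0
    then show ?thesis by (intro exI[of _ "alt_word a b (Suc k)"]) simp
  next
    case (Suc m')
    then obtain w where "length w = k - m'" "alt_word b a k = w @ alt_word b a m'"
      using Suc.IH[of m' b a] Suc.prems by auto
    then show ?thesis using Suc by auto
  qed
qed simp

lemma alt_word_unique:
  "set us \<subseteq> {a, b} \<Longrightarrow> distinct_adj us \<Longrightarrow> us \<noteq> [] \<Longrightarrow> last us = a \<Longrightarrow>
    us = alt_word a b (length us)"
proof (induction us arbitrary: a b rule: rev_induct)
  case (snoc x us)
  show ?case
  proof (cases "us = []")
    case True
    then show ?thesis using snoc.prems by simp
  next
    case False
    then have "last us \<noteq> x" "distinct_adj us"
      using snoc.prems(2) by (simp_all add: distinct_adj_append_iff)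
    moreover have "last us \<in> {a, b}" "x = a"
      using snoc.prems last_in_set[OF False] by auto
    ultimately have us: "us = alt_word b a (length us)"
      using snoc.prems(1) False by (intro snoc.IH) auto
    have "alt_word a b (length (us @ [x])) = alt_word b a (length us) @ [a]" by simp
    also have "\<dots> = us @ [x]" by (simp only: us[symmetric] \<open>x = a\<close>)
    finally show ?thesis by (rule sym)
  qed
qed simp

lemma not_distinct_adj_split:
  "\<not> distinct_adj xs \<Longrightarrow> \<exists>as x bs. xs = as @ [x, x] @ bs"
proof (induction xs rule: induct_list012)
  case (3 x y zs)
  show ?case
  proof (cases "x = y")
    case True
    then show ?thesis by (intro exI[of _ "[]"]) auto
  next
    case False
    then have "\<not> distinct_adj (y # zs)" using 3 by simp
    then obtain as z bs where "y # zs = as @ [z, z] @ bs" using 3 by blast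
    then have "x # y # zs = (x # as) @ [z, z] @ bs" by simp
    then show ?thesis by blast
  qed
qed auto

section \<open>Rank two subsystems and Tits' sign lemma\<close>

context gcm_realization
begin

lemma coreflection_rank2:
  "coreflection j (x *\<^sub>R \<alpha>v i + y *\<^sub>R \<alpha>v j) = (- A $ i $ j * x - y) *\<^sub>R \<alpha>v j + x *\<^sub>R \<alpha>v i"
proof -
  have "- A $ i $ j * x - y = y - (x * A $ i $ j + y * 2)" by simp
  then show ?thesis
    unfolding coreflection_def
    by (simp only: scaleR_left_diff_distrib)
      (simp add: blinfun.add_right blinfun.scaleR_right pairing gcm_diag[OF gcm])
qed

text \<open>One reflection changes one coordinate and exchanges the roles of \<open>i\<close> and
  \<open>j\<close>, so the orbit of a vector under an alternating word becomes a recursion on two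
  reals.\<close>

definition rank2_vec :: "'n \<Rightarrow> 'n \<Rightarrow> nat \<Rightarrow> real \<Rightarrow> real \<Rightarrow> 'h" where
  "rank2_vec i j k x y = act (alt_word j i k) (x *\<^sub>R \<alpha>v i + y *\<^sub>R \<alpha>v j)"

lemma rank2_vec_0: "rank2_vec i j 0 x y = x *\<^sub>R \<alpha>v i + y *\<^sub>R \<alpha>v j"
  and rank2_vec_Suc: "rank2_vec i j (Suc k) x y = rank2_vec j i k (- A $ i $ j * x - y) x"
  by (simp_all add: rank2_vec_def coreflection_rank2)

definition rank2_pos :: "'n \<Rightarrow> 'n \<Rightarrow> nat \<Rightarrow> real \<Rightarrow> real \<Rightarrow> bool" where
  "rank2_pos i j k x y \<longleftrightarrow>
    (\<exists>u v. u \<ge> 0 \<and> v \<ge> 0 \<and> rank2_vec i j k x y = u *\<^sub>R \<alpha>v i + v *\<^sub>R \<alpha>v j)"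

lemma rank2_pos_0: "x \<ge> 0 \<Longrightarrow> y \<ge> 0 \<Longrightarrow> rank2_pos i j 0 x y"
  unfolding rank2_pos_def rank2_vec_0 by blast

lemma rank2_pos_Suc: "rank2_pos i j (Suc k) x y \<longleftrightarrow> rank2_pos j i k (- A $ i $ j * x - y) x"
  unfolding rank2_pos_def rank2_vec_Suc by (metis add.commute)

text \<open>A braid relation must hold on the whole space, not only on the plane of the two coroots.
  An arbitrary vector \<open>z\<close> changes only within its translate of that plane, so tracking
  two coordinates still suffices.\<close>

definition rank2_affine :: "'h \<Rightarrow> 'n \<Rightarrow> 'n \<Rightarrow> nat \<Rightarrow> real \<Rightarrow> real \<Rightarrow> 'h" where
  "rank2_affine z i j k x y = act (alt_word j i k) (z + x *\<^sub>R \<alpha>v i + y *\<^sub>R \<alpha>v j)"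

lemma rank2_affine_0: "rank2_affine z i j 0 x y = z + x *\<^sub>R \<alpha>v i + y *\<^sub>R \<alpha>v j"
  and rank2_affine_Suc:
    "rank2_affine z i j (Suc k) x y = rank2_affine z j i k (- \<alpha> j z - A $ i $ j * x - y) x"
proof -
  have "coreflection j (z + x *\<^sub>R \<alpha>v i + y *\<^sub>R \<alpha>v j)
      = z + (- \<alpha> j z - A $ i $ j * x - y) *\<^sub>R \<alpha>v j + x *\<^sub>R \<alpha>v i"
  proof -
    have "- \<alpha> j z - A $ i $ j * x - y = y - (\<alpha> j z + x * A $ i $ j + y * 2)" by simp
    then show ?thesis
      unfolding coreflection_def
      by (simp only: scaleR_left_diff_distrib)
        (simp add: blinfun.add_right blinfun.scaleR_right pairing gcm_diag[OF gcm])
  qed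
  then show "rank2_affine z i j (Suc k) x y = rank2_affine z j i k (- \<alpha> j z - A $ i $ j * x - y) x"
    by (simp add: rank2_affine_def)
qed (simp add: rank2_affine_def)

lemma rank2_braidI:
  assumes "\<And>z. rank2_affine z i j m 0 0 = rank2_affine z j i m 0 0"
  shows "act (alt_word j i m) = act (alt_word i j m)"
  using assms by (auto simp: rank2_affine_def)

text \<open>If \<open>a\<^sub>i\<^sub>j a\<^sub>j\<^sub>i \<ge> 4\<close>, the ratio of the two coordinates stays on the
  nonnegative side of a fixed line, so alternating words of any length act positively.\<close>

lemma rank2_infinite:
  assumes "A $ i $ j * A $ j $ i \<ge> 4" "i \<noteq> j" "y \<ge> 0" "2 * x \<ge> - A $ j $ i * y"
  shows "rank2_pos i j k x y"
  using assms
proof (induction k arbitrary: i j x y)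
  case 0
  have "- A $ j $ i * y \<ge> 0" using 0 gcm_offdiag[OF gcm, of j i] by (intro mult_nonneg_nonneg) auto
  then have "x \<ge> 0" using 0(4) by linarith
  then show ?case using 0(3) by (rule rank2_pos_0)
next
  case (Suc k)
  have le: "- A $ i $ j \<ge> 0" "- A $ j $ i \<ge> 0"
    using Suc.prems(2) gcm_offdiag[OF gcm, of i j] gcm_offdiag[OF gcm, of j i] by auto
  have x: "x \<ge> 0" using Suc.prems(3,4) mult_nonneg_nonneg[OF le(2) Suc.prems(3)] by linarith
  have "- A $ i $ j * (2 * x) \<ge> - A $ i $ j * (- A $ j $ i * y)"
    by (rule mult_left_mono[OF Suc.prems(4) le(1)])
  moreover have "A $ i $ j * A $ j $ i * y \<ge> 4 * y"
    by (rule mult_right_mono[OF Suc.prems(1,3)])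
  \<comment> \<open>This is the assumed inequality with the roles of \<open>i\<close> and
    \<open>j\<close> exchanged, for the coordinates after one reflection.\<close>
  ultimately have "2 * (- A $ i $ j * x - y) \<ge> - A $ i $ j * x" by (simp add: algebra_simps)
  then show ?case
    unfolding rank2_pos_Suc using Suc.prems x by (intro Suc.IH) (auto simp: mult.commute)
qed

lemma small_entries:
  assumes "i \<noteq> j" "A $ i $ j * A $ j $ i < 4"
  shows "A $ i $ j = 0 \<and> A $ j $ i = 0 \<or> A $ i $ j = -1 \<and> A $ j $ i = -1 \<or>
    A $ i $ j = -1 \<and> A $ j $ i = -2 \<or> A $ i $ j = -2 \<and> A $ j $ i = -1 \<or>
    A $ i $ j = -1 \<and> A $ j $ i = -3 \<or> A $ i $ j = -3 \<and> A $ j $ i = -1"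
proof -
  obtain a b :: int where ab: "A $ i $ j = of_int a" "A $ j $ i = of_int b"
    using gcm_Ints[OF gcm] by (metis Ints_cases)
  have le: "a \<le> 0" "b \<le> 0"
    using gcm_offdiag[OF gcm, of i j] gcm_offdiag[OF gcm, of j i] assms(1) ab by auto
  have z: "a = 0 \<longleftrightarrow> b = 0" using gcm_sym_zero[OF gcm, of i j] ab by simp
  have "real_of_int (a * b) < of_int 4" using assms(2) ab by simp
  then have lt: "a * b < 4" by (simp only: of_int_less_iff)
  have "a > -4 \<and> b > -4" if "a \<noteq> 0"
  proof -
    have "a \<le> -1" "b \<le> -1" using that z le by auto
    then have "0 \<le> a * (b + 1)" "0 \<le> (a + 1) * b" by (simp_all add: mult_nonpos_nonpos)
    then have "- a \<le> a * b" "- b \<le> a * b" by (simp_all add: distrib_left distrib_right)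
    then show ?thesis using lt by linarith
  qed
  then have "a = -3 \<or> a = -2 \<or> a = -1 \<or> a = 0" "b = -3 \<or> b = -2 \<or> b = -1 \<or> b = 0"
    using z le by (cases "a = 0"; force)+
  then show ?thesis using lt z ab by (elim disjE) simp_all
qed

text \<open>For \<open>A $ i $ j * A $ j $ i\<close> equal to 0, 1, 2, 3 the braid relation has
  length 2, 3, 4, 6, the order of the product of the two reflections in the dihedral group.
  Positivity is claimed only below that length: at \<open>k = m\<close> the image of the coroot
  turns negative.\<close>

lemma rank2_finite:
  assumes "i \<noteq> j" "A $ i $ j * A $ j $ i < 4"
  shows "\<exists>m>0. act (alt_word j i m) = act (alt_word i j m) \<and> (\<forall>k<m. rank2_pos i j k 1 0)"
proof -
  from small_entries[OF assms] consider
    "A $ i $ j = 0" "A $ j $ i = 0" | "A $ i $ j = -1" "A $ j $ i = -1" |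
    "A $ i $ j = -1" "A $ j $ i = -2" | "A $ i $ j = -2" "A $ j $ i = -1" |
    "A $ i $ j = -1" "A $ j $ i = -3" | "A $ i $ j = -3" "A $ j $ i = -1" by blast
  then show ?thesis
  proof cases
    case 1
    have "act (alt_word j i 2) = act (alt_word i j 2)"
      by (rule rank2_braidI)
        (simp add: numeral_eq_Suc rank2_affine_0 rank2_affine_Suc 1 algebra_simps)
    moreover have "\<forall>k<2. rank2_pos i j k 1 0"
      by (simp add: numeral_eq_Suc All_less_Suc rank2_pos_0 rank2_pos_Suc 1)
    ultimately show ?thesis by (intro exI[of _ 2]) simp
  next
    case 2
    have "act (alt_word j i 3) = act (alt_word i j 3)"
      by (rule rank2_braidI)
        (simp add: numeral_eq_Suc rank2_affine_0 rank2_affine_Suc 2 algebra_simps)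
    moreover have "\<forall>k<3. rank2_pos i j k 1 0"
      by (simp add: numeral_eq_Suc All_less_Suc rank2_pos_0 rank2_pos_Suc 2)
    ultimately show ?thesis by (intro exI[of _ 3]) simp
  next
    case 3
    have "act (alt_word j i 4) = act (alt_word i j 4)"
      by (rule rank2_braidI)
        (simp add: numeral_eq_Suc rank2_affine_0 rank2_affine_Suc 3 algebra_simps)
    moreover have "\<forall>k<4. rank2_pos i j k 1 0"
      by (simp add: numeral_eq_Suc All_less_Suc rank2_pos_0 rank2_pos_Suc 3)
    ultimately show ?thesis by (intro exI[of _ 4]) simp
  next
    case 4
    have "act (alt_word j i 4) = act (alt_word i j 4)"
      by (rule rank2_braidI)
        (simp add: numeral_eq_Suc rank2_affine_0 rank2_affine_Suc 4 algebra_simps)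
    moreover have "\<forall>k<4. rank2_pos i j k 1 0"
      by (simp add: numeral_eq_Suc All_less_Suc rank2_pos_0 rank2_pos_Suc 4)
    ultimately show ?thesis by (intro exI[of _ 4]) simp
  next
    case 5
    have "act (alt_word j i 6) = act (alt_word i j 6)"
      by (rule rank2_braidI)
        (simp add: numeral_eq_Suc rank2_affine_0 rank2_affine_Suc 5 algebra_simps)
    moreover have "\<forall>k<6. rank2_pos i j k 1 0"
      by (simp add: numeral_eq_Suc All_less_Suc rank2_pos_0 rank2_pos_Suc 5)
    ultimately show ?thesis by (intro exI[of _ 6]) simp
  next
    case 6
    have "act (alt_word j i 6) = act (alt_word i j 6)"
      by (rule rank2_braidI)
        (simp add: numeral_eq_Suc rank2_affine_0 rank2_affine_Suc 6 algebra_simps)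
    moreover have "\<forall>k<6. rank2_pos i j k 1 0"
      by (simp add: numeral_eq_Suc All_less_Suc rank2_pos_0 rank2_pos_Suc 6)
    ultimately show ?thesis by (intro exI[of _ 6]) simp
  qed
qed

text \<open>The second alternative is the one that minimality of length excludes: a braid relation
  lets the word end in the other letter.\<close>

lemma rank2_alternating:
  assumes "i \<noteq> j"
  shows "(\<exists>x y. x \<ge> 0 \<and> y \<ge> 0 \<and> act (alt_word j i k) (\<alpha>v i) = x *\<^sub>R \<alpha>v i + y *\<^sub>R \<alpha>v j) \<or>
    (\<exists>m. 0 < m \<and> m \<le> k \<and> act (alt_word j i m) = act (alt_word i j m))"
proof -
  have "rank2_pos i j k 1 0 \<or> (\<exists>m. 0 < m \<and> m \<le> k \<and> act (alt_word j i m) = act (alt_word i j m))"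
  proof (cases "A $ i $ j * A $ j $ i \<ge> 4")
    case True
    then show ?thesis using rank2_infinite[OF True assms, of 0 1 k] by simp
  next
    case False
    then obtain m where "m > 0" "act (alt_word j i m) = act (alt_word i j m)"
      "\<forall>k<m. rank2_pos i j k 1 0"
      using rank2_finite[OF assms] by auto
    then show ?thesis by (metis not_le)
  qed
  then show ?thesis by (simp add: rank2_pos_def rank2_vec_def)
qed

text \<open>Tits' argument: split off from the reduced word a right factor in the two letters \<open>i\<close>
  and \<open>j\<close> that is as long as possible. The remaining left factor satisfies the induction
  hypothesis at both letters, and the right factor is an alternating word.\<close>

lemma reduced_positive:
  assumes "reduced ys" "\<And>zs. act zs = act (ys @ [i]) \<Longrightarrow> length ys \<le> length zs"
  shows "act ys (\<alpha>v i) \<in> coroot_cone"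
  using assms
proof (induction "length ys" arbitrary: ys i rule: less_induct)
  case less
  have red: "length ys \<le> length zs" if "act zs = act ys" for zs
    using less.prems(1) that unfolding reduced_def by blast
  show ?case
  proof (cases ys rule: rev_cases)
    case Nil
    then show ?thesis by (simp add: coroot_in_cone)
  next
    case (snoc ws j)
    have ij: "i \<noteq> j"
    proof
      assume "i = j"
      then have "act ws = act (ys @ [i])" using snoc by (intro ext) simp
      then show False using less.prems(2)[of ws] snoc by simp
    qed
    \<comment> \<open>\<open>vs @ us\<close> need not be \<open>ys\<close> letter by letter; it is
      any word of the same length with the same action.\<close>
    define P where "P = (\<lambda>(vs, us). act (vs @ us) = act ys \<and> length vs + length us = length ys
      \<and> set us \<subseteq> {i, j})"
    have "P (ws, [j])" using snoc by (simp add: P_def)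
    moreover have "\<forall>q. P q \<longrightarrow> length (snd q) < Suc (length ys)" by (auto simp: P_def)
    ultimately have "\<exists>q. P q \<and> (\<forall>q'. P q' \<longrightarrow> length (snd q') \<le> length (snd q))"
      by (rule ex_has_greatest_nat)
    then obtain vs us where q: "P (vs, us)"
      and max': "\<forall>q'. P q' \<longrightarrow> length (snd q') \<le> length us"
      by (metis prod.collapse snd_conv)
    have max: "length us' \<le> length us" if "P (vs', us')" for vs' us'
      using max' that by (metis snd_conv)
    have vus: "act (vs @ us) = act ys" "length vs + length us = length ys" "set us \<subseteq> {i, j}"
      using q by (simp_all add: P_def)
    have vu: "act vs (act us x) = act ys x" for x
      using fun_cong[OF vus(1), of x] unfolding act_append .
    have "us \<noteq> []"
    proof
      assume "us = []"
      then show False using max[OF \<open>P (ws, [j])\<close>] by simp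
    qed
    have vpos: "act vs (\<alpha>v l) \<in> coroot_cone" if l: "l \<in> {i, j}" for l
    proof (rule less.hyps)
      show "length vs < length ys" using vus(2) \<open>us \<noteq> []\<close> by (cases us) auto
      show "reduced vs" unfolding reduced_def
      proof (intro allI impI)
        fix zs assume "act zs = act vs"
        then have "act (zs @ us) = act ys" using vu by (intro ext) simp
        then show "length vs \<le> length zs" using red[of "zs @ us"] vus(2) by simp
      qed
      show "length vs \<le> length zs" if zs: "act zs = act (vs @ [l])" for zs
      proof (rule ccontr)
        assume short: "\<not> length vs \<le> length zs"
        have eq: "act (zs @ l # us) = act ys" using vu zs by (intro ext) simp
        \<comment> \<open>Minimality of \<open>ys\<close> leaves room for \<open>zs\<close> to be
          shorter than \<open>vs\<close> by exactly one letter. Then \<open>l\<close> could move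
          into the right factor, against its maximality.\<close>
        then have "length zs + length (l # us) = length ys"
          using red[OF eq] short vus(2) by simp
        then have "P (zs, l # us)" using eq vus(3) l unfolding P_def by auto
        from max[OF this] show False by simp
      qed
    qed
    have "distinct_adj us"
    proof (rule ccontr)
      assume "\<not> distinct_adj us"
      then obtain as x bs where us: "us = as @ [x, x] @ bs" using not_distinct_adj_split by blast
      have "act (vs @ as @ bs) z = act ys z" for z using vu[of z] us by simp
      then have "act (vs @ as @ bs) = act ys" by (intro ext)
      then show False using red[of "vs @ as @ bs"] vus(2) us by simp
    qed
    moreover have short: False if "act (zs @ [i]) = act ys" "length zs < length ys" for zs
    proof -
      have "act zs z = act (ys @ [i]) z" for z
        using fun_cong[OF that(1), of "coreflection i z"] by simp
      then have "act zs = act (ys @ [i])" by (intro ext)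
      then show False using less.prems(2)[of zs] that(2) by simp
    qed
    have "last us \<noteq> i"
    proof
      assume "last us = i"
      with append_butlast_last_id[OF \<open>us \<noteq> []\<close>] have "(vs @ butlast us) @ [i] = vs @ us" by simp
      moreover have "length (vs @ butlast us) < length ys"
        using vus(2) \<open>us \<noteq> []\<close> by (cases us) auto
      ultimately show False using short[of "vs @ butlast us"] vus(1) by simp
    qed
    then have "last us = j" using vus(3) last_in_set[OF \<open>us \<noteq> []\<close>] by auto
    ultimately have us: "us = alt_word j i (length us)"
      using vus(3) \<open>us \<noteq> []\<close> by (intro alt_word_unique) auto
    from rank2_alternating[OF ij, of "length us"] show ?thesis
    proof (elim disjE exE conjE)
      fix x y :: real assume "x \<ge> 0" "y \<ge> 0"
        and eq: "act (alt_word j i (length us)) (\<alpha>v i) = x *\<^sub>R \<alpha>v i + y *\<^sub>R \<alpha>v j"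
      have "act us (\<alpha>v i) = x *\<^sub>R \<alpha>v i + y *\<^sub>R \<alpha>v j" by (subst us) (fact eq)
      then have "act ys (\<alpha>v i) = x *\<^sub>R act vs (\<alpha>v i) + y *\<^sub>R act vs (\<alpha>v j)"
        using vu[of "\<alpha>v i"] by (simp add: linear_add[OF linear_act] linear_scale[OF linear_act])
      then show ?thesis using coroot_cone_comb[OF vpos vpos] \<open>x \<ge> 0\<close> \<open>y \<ge> 0\<close> by simp
    next
      \<comment> \<open>The alternating suffix is rewritten so that it ends in \<open>i\<close>.
        Cancelling this \<open>i\<close> gives a word for \<open>ys @ [i]\<close> shorter than
        \<open>ys\<close>.\<close>
      fix m assume m: "0 < m" "m \<le> length us" "act (alt_word j i m) = act (alt_word i j m)"
      obtain w where w: "length w = length us - m" "us = w @ alt_word j i m"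
        using alt_word_suffix[OF m(2)] us by metis
      obtain m' where m': "m = Suc m'" using m(1) by (cases m) auto
      have "act ((vs @ w @ alt_word j i m') @ [i]) x = act ys x" for x
        using vu[of x] fun_cong[OF m(3), of x] by (simp add: w(2) m')
      then have "act ((vs @ w @ alt_word j i m') @ [i]) = act ys" by (intro ext)
      moreover have "length (vs @ w @ alt_word j i m') < length ys"
        using w(1) m(2) m' vus(2) by simp
      ultimately show ?thesis using short by blast
    qed
  qed
qed


end


section \<open>The orbit of a dominant weight\<close>

context gcm_realization
begin

definition root_comb :: "('n \<Rightarrow> real) \<Rightarrow> ('h \<Rightarrow>\<^sub>L real)" where
  "root_comb c = (\<Sum>i\<in>UNIV. c i *\<^sub>R \<alpha> i)"

abbreviation "s \<equiv> simple_reflection \<alpha> \<alpha>v"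

lemma root_comb_coroot: "root_comb c (\<alpha>v i) = submatrix_mult A UNIV c i"
  by (simp add: root_comb_def submatrix_mult_def blinfun.sum_left blinfun.scaleR_left pairing mult.commute)

lemma root_comb_lincomb:
  "root_comb (\<lambda>i. a * c i + b * d i) = a *\<^sub>R root_comb c + b *\<^sub>R root_comb d"
  by (simp add: root_comb_def scaleR_sum_right sum.distrib scaleR_left_distrib)

lemma root_comb_add: "root_comb (\<lambda>i. c i + d i) = root_comb c + root_comb d"
  using root_comb_lincomb[of 1 c 1 d] by simp

lemma root_comb_diff: "root_comb (\<lambda>i. c i - d i) = root_comb c - root_comb d"
  using root_comb_lincomb[of 1 c "-1" d] by simp

lemma root_comb_scale: "root_comb (\<lambda>i. a * c i) = a *\<^sub>R root_comb c"
  using root_comb_lincomb[of a c 0 c] by simp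

lemma root_comb_0 [simp]: "root_comb (\<lambda>i. 0) = 0"
  by (simp add: root_comb_def)

lemma root_comb_single: "root_comb (\<lambda>j. if j = i then t else 0) = t *\<^sub>R \<alpha> i"
  by (simp add: root_comb_def if_distrib[of "\<lambda>x. x *\<^sub>R _"] cong: if_cong)

lemma reflection_apply: "blinfun_apply (s i \<eta>) x = \<eta> (coreflection i x)"
  by (simp add: simple_reflection_def coreflection_def blinfun.diff_left blinfun.scaleR_left
      blinfun.diff_right blinfun.scaleR_right)

lemma reflection_reflection [simp]: "s i (s i \<eta>) = \<eta>"
  by (rule blinfun_eqI) (simp add: reflection_apply)

lemma linear_reflection: "linear (s i)"
  by (rule linearI) (simp_all add: simple_reflection_def blinfun.add_left blinfun.scaleR_left algebra_simps)

lemma reflection_in_GL: "s i \<in> carrier general_linear_group"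
  using linear_reflection[of i] o_bij[of "s i" "s i"]
  by (auto simp: general_linear_group_def fun_eq_iff)

text \<open>\<open>generate\<close> also adjoins inverses; as each reflection is its own inverse,
  words in the reflections exhaust the group.\<close>

lemma inv_reflection: "inv\<^bsub>general_linear_group\<^esub> (s i) = s i"
  unfolding m_inv_def
proof (rule the_equality)
  show "s i \<in> carrier general_linear_group \<and>
      s i \<otimes>\<^bsub>general_linear_group\<^esub> s i = \<one>\<^bsub>general_linear_group\<^esub> \<and>
      s i \<otimes>\<^bsub>general_linear_group\<^esub> s i = \<one>\<^bsub>general_linear_group\<^esub>"
    using reflection_in_GL by (auto simp: general_linear_group_def fun_eq_iff)
next
  fix y assume "y \<in> carrier general_linear_group \<and>
      s i \<otimes>\<^bsub>general_linear_group\<^esub> y = \<one>\<^bsub>general_linear_group\<^esub> \<and>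
      y \<otimes>\<^bsub>general_linear_group\<^esub> s i = \<one>\<^bsub>general_linear_group\<^esub>"
  then have "s i (y \<eta>) = \<eta>" for \<eta> by (simp add: general_linear_group_def fun_eq_iff)
  then have "y \<eta> = s i \<eta>" for \<eta> using reflection_reflection[of i "y \<eta>"] by simp
  then show "y = s i" by (intro ext)
qed

lemma weyl_group_words: "weyl_group \<alpha> \<alpha>v = range (foldr s)"
proof
  show "weyl_group \<alpha> \<alpha>v \<subseteq> range (foldr s)"
  proof
    fix w assume "w \<in> weyl_group \<alpha> \<alpha>v"
    then show "w \<in> range (foldr s)"
      unfolding weyl_group_def
    proof (induction rule: generate.induct)
      case one
      show ?case by (rule range_eqI[of _ _ "[]"]) (simp add: general_linear_group_def)
    next
      case (incl h)
      then obtain i where "h = s i" by blast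
      then show ?case by (intro range_eqI[of _ _ "[i]"]) (simp add: fun_eq_iff)
    next
      case (inv h)
      then obtain i where "h = s i" by blast
      then have "inv\<^bsub>general_linear_group\<^esub> h = s i" using inv_reflection by simp
      then show ?case by (intro range_eqI[of _ _ "[i]"]) (simp add: fun_eq_iff)
    next
      case (eng h1 h2)
      then obtain xs ys where "h1 = foldr s xs" "h2 = foldr s ys" by blast
      then show ?case
        by (intro range_eqI[of _ _ "xs @ ys"]) (simp add: general_linear_group_def fun_eq_iff)
    qed
  qed
  have "foldr s xs \<in> generate general_linear_group (range s)" for xs
  proof (induction xs)
    case Nil
    have "foldr s [] = \<one>\<^bsub>general_linear_group\<^esub>" by (simp add: general_linear_group_def)
    then show ?case using generate.one[of general_linear_group "range s"] by (simp only:)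
  next
    case (Cons i xs)
    have "foldr s (i # xs) = s i \<otimes>\<^bsub>general_linear_group\<^esub> foldr s xs"
      by (simp add: general_linear_group_def)
    moreover have "s i \<in> generate general_linear_group (range s)"
      by (rule generate.incl) blast
    ultimately show ?case using generate.eng[OF _ Cons, of "s i"] by (simp only:)
  qed
  then show "range (foldr s) \<subseteq> weyl_group \<alpha> \<alpha>v" unfolding weyl_group_def by blast
qed

lemma weyl_orbit_words: "weyl_orbit \<alpha> \<alpha>v \<mu> = range (\<lambda>xs. foldr s xs \<mu>)"
  unfolding weyl_orbit_def weyl_group_words by blast

text \<open>Reflections of weights are the transposes of \<open>coreflection\<close>, and
  transposition reverses products.\<close>

lemma word_apply: "blinfun_apply (foldr s xs \<eta>) x = \<eta> (act (rev xs) x)"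
  by (induction xs arbitrary: x) (simp_all add: reflection_apply)

lemma mem_orbit: "\<mu> \<in> weyl_orbit \<alpha> \<alpha>v \<mu>"
  unfolding weyl_orbit_words by (rule range_eqI[of _ _ "[]"]) simp

lemma orbit_reflection: "\<eta> \<in> weyl_orbit \<alpha> \<alpha>v \<mu> \<Longrightarrow> s i \<eta> \<in> weyl_orbit \<alpha> \<alpha>v \<mu>"
proof -
  assume "\<eta> \<in> weyl_orbit \<alpha> \<alpha>v \<mu>"
  then obtain xs where "\<eta> = foldr s xs \<mu>" unfolding weyl_orbit_words by blast
  then show ?thesis unfolding weyl_orbit_words by (intro range_eqI[of _ _ "i # xs"]) simp
qed

lemma hull_orbit_reflection:
  assumes "\<eta> \<in> convex hull (weyl_orbit \<alpha> \<alpha>v \<mu>)"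
  shows "s i \<eta> \<in> convex hull (weyl_orbit \<alpha> \<alpha>v \<mu>)"
proof -
  have "s i ` (convex hull (weyl_orbit \<alpha> \<alpha>v \<mu>)) = convex hull (s i ` weyl_orbit \<alpha> \<alpha>v \<mu>)"
    by (rule convex_hull_linear_image[OF linear_reflection])
  also have "\<dots> \<subseteq> convex hull (weyl_orbit \<alpha> \<alpha>v \<mu>)"
    using orbit_reflection by (intro hull_mono) blast
  finally show ?thesis using assms by blast
qed

text \<open>Dominance is left out on purpose: the set is then convex and contains the whole hull,
  and it is compared with the hull only inside the chamber.\<close>

definition mu_connected_below :: "('h \<Rightarrow>\<^sub>L real) \<Rightarrow> ('h \<Rightarrow>\<^sub>L real) set" where
  "mu_connected_below \<mu> = {\<mu> - root_comb c | c.
     (\<forall>i. c i \<ge> 0) \<and> mu_connected A (stabilizer_roots \<alpha>v \<mu>) {i. c i > 0}}"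

text \<open>Only a new node \<open>i\<close> with \<mu>-value 0 needs an argument. The positive
  value \<open>t\<close> is then minus row \<open>i\<close> of the product with \<open>c\<close>,
  which requires a neighbour of \<open>i\<close> in the old support.\<close>

lemma mu_connected_add_root:
  assumes "\<forall>i. c i \<ge> 0" "mu_connected A (stabilizer_roots \<alpha>v \<mu>) {i. c i > 0}"
    and t: "(\<mu> - root_comb c) (\<alpha>v i) = t" "t \<ge> 0"
  shows "mu_connected A (stabilizer_roots \<alpha>v \<mu>) {j. c j + (if j = i then t else 0) > 0}"
proof (cases "t = 0 \<or> c i > 0")
  case True
  have "(c j + (if j = i then t else 0) > 0) = (c j > 0)" for j
    using True assms(1) t(2) by (auto intro: add_pos_nonneg)
  then show ?thesis using assms(2) by simp
next
  case False
  then have ci: "c i = 0" "t > 0" using assms(1) t(2) by (auto simp: less_le)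
  let ?I = "{j. c j > 0}" and ?J0 = "stabilizer_roots \<alpha>v \<mu>"
  have eq: "{j. c j + (if j = i then t else 0) > 0} = insert i ?I"
    using ci assms(1) by auto
  have old: "\<exists>k\<in>?I - ?J0. (j, k) \<in> (dynkin_edges A (insert i ?I))\<^sup>*" if "j \<in> ?I" for j
  proof -
    obtain k where "k \<in> ?I - ?J0" "(j, k) \<in> (dynkin_edges A ?I)\<^sup>*"
      using assms(2) \<open>j \<in> ?I\<close> unfolding mu_connected_iff by blast
    moreover have "(dynkin_edges A ?I)\<^sup>* \<subseteq> (dynkin_edges A (insert i ?I))\<^sup>*"
      by (rule rtrancl_mono[OF dynkin_edges_mono]) blast
    ultimately show ?thesis by blast
  qed
  have new: "\<exists>k\<in>insert i ?I - ?J0. (i, k) \<in> (dynkin_edges A (insert i ?I))\<^sup>*"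
  proof (cases "i \<in> ?J0")
    case False
    then show ?thesis by blast
  next
    case True
    then have "\<mu> (\<alpha>v i) = 0" unfolding stabilizer_roots_def by simp
    then have "submatrix_mult A UNIV c i < 0"
      using t ci(2) by (simp add: blinfun.diff_left root_comb_coroot)
    then have "\<exists>j. A $ i $ j * c j < 0"
      using sum_nonneg[of UNIV "\<lambda>j. A $ i $ j * c j"] unfolding submatrix_mult_def
      by (auto simp: not_le[symmetric])
    then obtain j where j: "A $ i $ j * c j < 0" by blast
    then have "A $ i $ j \<noteq> 0" "c j \<noteq> 0" by auto
    moreover have "i \<noteq> j" using \<open>c j \<noteq> 0\<close> ci(1) by auto
    moreover have "c j > 0" using assms(1) \<open>c j \<noteq> 0\<close> by (simp add: less_le)
    ultimately have edge: "(i, j) \<in> dynkin_edges A (insert i ?I)"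
      unfolding dynkin_edges_def using gcm_sym_zero[OF gcm, of i j] by simp
    obtain k where "k \<in> ?I - ?J0" "(j, k) \<in> (dynkin_edges A (insert i ?I))\<^sup>*"
      using old[of j] \<open>c j > 0\<close> by blast
    then show ?thesis using converse_rtrancl_into_rtrancl[OF edge] by blast
  qed
  show ?thesis unfolding eq mu_connected_iff
  proof
    fix j assume "j \<in> insert i ?I"
    then show "\<exists>k\<in>insert i ?I - ?J0. (j, k) \<in> (dynkin_edges A (insert i ?I))\<^sup>*"
    proof
      assume "j = i" then show ?thesis using new by blast
    next
      assume "j \<in> ?I" then show ?thesis using old[of j] by blast
    qed
  qed
qed

lemma dominant_nonneg_on_cone:
  assumes "\<mu> \<in> fundamental_chamber \<alpha>v" "x \<in> coroot_cone"
  shows "\<mu> x \<ge> 0"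
proof -
  obtain c where c: "\<forall>i. c i \<ge> 0" "x = (\<Sum>i\<in>UNIV. c i *\<^sub>R \<alpha>v i)"
    using assms(2) unfolding coroot_cone_def by blast
  then show ?thesis using assms(1)
    by (simp add: fundamental_chamber_def blinfun.sum_right blinfun.scaleR_right sum_nonneg)
qed

text \<open>Along a reduced word each reflection subtracts a nonnegative multiple of a simple root,
  so the support only ever grows by nodes outside \<open>J\<^sub>0\<close> or adjacent to it.\<close>

lemma word_below:
  assumes \<mu>: "\<mu> \<in> fundamental_chamber \<alpha>v"
  shows "\<exists>\<eta>\<in>mu_connected_below \<mu>. \<forall>x. blinfun_apply \<eta> x = \<mu> (act ys x)"
proof (induction "length ys" arbitrary: ys rule: less_induct)
  case less
  show ?case
  proof (cases "reduced ys")
    case False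
    then obtain zs where "act zs = act ys" "length zs < length ys"
      unfolding reduced_def by (auto simp: not_le)
    then show ?thesis using less[of zs] by simp
  next
    case red: True
    show ?thesis
    proof (cases ys rule: rev_cases)
      case Nil
      have "mu_connected A (stabilizer_roots \<alpha>v \<mu>) {i. (0::real) > 0}"
        by (simp add: mu_connected_iff)
      then have "\<mu> - root_comb (\<lambda>i. 0) \<in> mu_connected_below \<mu>"
        unfolding mu_connected_below_def by (intro CollectI exI[of _ "\<lambda>i. 0"]) simp
      then show ?thesis using Nil by (intro bexI[of _ \<mu>]) simp_all
    next
      case (snoc zs i)
      have "reduced zs" unfolding reduced_def
      proof (intro allI impI)
        fix us assume "act us = act zs"
        then have "act (us @ [i]) = act ys" unfolding snoc by (intro ext) simp
        then show "length zs \<le> length us" using red unfolding reduced_def snoc by fastforce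
      qed
      moreover have "length zs \<le> length us" if "act us = act (zs @ [i])" for us
        using red that unfolding reduced_def snoc by fastforce
      ultimately have "act zs (\<alpha>v i) \<in> coroot_cone" by (rule reduced_positive)
      then have pos: "\<mu> (act zs (\<alpha>v i)) \<ge> 0" by (rule dominant_nonneg_on_cone[OF \<mu>])
      obtain \<eta> where \<eta>: "\<eta> \<in> mu_connected_below \<mu>" "\<forall>x. blinfun_apply \<eta> x = \<mu> (act zs x)"
        using less[of zs] snoc by auto
      then obtain c where c: "\<eta> = \<mu> - root_comb c" "\<forall>i. c i \<ge> 0"
        "mu_connected A (stabilizer_roots \<alpha>v \<mu>) {i. c i > 0}"
        unfolding mu_connected_below_def by blast
      define t where "t = \<eta> (\<alpha>v i)"
      have t: "t \<ge> 0" "(\<mu> - root_comb c) (\<alpha>v i) = t" using pos \<eta>(2) c(1) by (simp_all add: t_def)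
      define d where "d j = c j + (if j = i then t else 0)" for j
      have "root_comb d = root_comb c + t *\<^sub>R \<alpha> i"
        unfolding d_def root_comb_add root_comb_single ..
      moreover have "s i \<eta> = \<eta> - t *\<^sub>R \<alpha> i" by (simp add: simple_reflection_def t_def)
      ultimately have "s i \<eta> = \<mu> - root_comb d" using c(1) by simp
      moreover have "\<forall>j. d j \<ge> 0" using c(2) t(1) by (simp add: d_def)
      moreover have "mu_connected A (stabilizer_roots \<alpha>v \<mu>) {j. d j > 0}"
        unfolding d_def by (rule mu_connected_add_root[OF c(2,3) t(2,1)])
      ultimately have "s i \<eta> \<in> mu_connected_below \<mu>" unfolding mu_connected_below_def by blast
      moreover have "\<forall>x. blinfun_apply (s i \<eta>) x = \<mu> (act ys x)"
        using \<eta>(2) by (simp add: reflection_apply snoc)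
      ultimately show ?thesis by blast
    qed
  qed
qed

text \<open>With both weights positive the support of the combination is the union of the supports,
  and \<mu>-connectedness is stable under unions.\<close>

lemma convex_mu_connected_below: "convex (mu_connected_below \<mu>)"
proof (rule convexI)
  fix x y and u v :: real
  assume x: "x \<in> mu_connected_below \<mu>" and y: "y \<in> mu_connected_below \<mu>"
    and uv: "0 \<le> u" "0 \<le> v" "u + v = 1"
  obtain c where c: "x = \<mu> - root_comb c" "\<forall>i. c i \<ge> 0"
    "mu_connected A (stabilizer_roots \<alpha>v \<mu>) {i. c i > 0}"
    using x unfolding mu_connected_below_def by blast
  obtain d where d: "y = \<mu> - root_comb d" "\<forall>i. d i \<ge> 0"
    "mu_connected A (stabilizer_roots \<alpha>v \<mu>) {i. d i > 0}"
    using y unfolding mu_connected_below_def by blast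
  define e where "e i = u * c i + v * d i" for i
  have "u *\<^sub>R x + v *\<^sub>R y = (u + v) *\<^sub>R \<mu> - root_comb e"
    unfolding e_def root_comb_lincomb c(1) d(1) by (simp add: algebra_simps)
  then have eq: "u *\<^sub>R x + v *\<^sub>R y = \<mu> - root_comb e" using uv(3) by simp
  have nn: "\<forall>i. e i \<ge> 0" using c(2) d(2) uv by (simp add: e_def)
  have "mu_connected A (stabilizer_roots \<alpha>v \<mu>) {i. e i > 0}"
  proof (cases "u = 0 \<or> v = 0")
    case True
    then have "e = c \<or> e = d" using uv(3) by (auto simp: e_def)
    then show ?thesis using c(3) d(3) by auto
  next
    case False
    then have "u > 0" "v > 0" using uv by auto
    have "e i > 0 \<longleftrightarrow> c i > 0 \<or> d i > 0" for i
    proof -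
      have "u * c i \<ge> 0" "v * d i \<ge> 0" using c(2) d(2) uv by simp_all
      moreover have "u * c i > 0 \<longleftrightarrow> c i > 0" "v * d i > 0 \<longleftrightarrow> d i > 0"
        using \<open>u > 0\<close> \<open>v > 0\<close> by (simp_all add: zero_less_mult_iff)
      ultimately show ?thesis unfolding e_def by linarith
    qed
    then have "{i. e i > 0} = {i. c i > 0} \<union> {i. d i > 0}" by blast
    then show ?thesis using mu_connected_Un[OF c(3) d(3)] by simp
  qed
  then show "u *\<^sub>R x + v *\<^sub>R y \<in> mu_connected_below \<mu>"
    unfolding mu_connected_below_def using eq nn by blast
qed

lemma hull_orbit_below:
  assumes "\<mu> \<in> fundamental_chamber \<alpha>v"
  shows "convex hull (weyl_orbit \<alpha> \<alpha>v \<mu>) \<subseteq> mu_connected_below \<mu>"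
proof (rule hull_minimal)
  show "weyl_orbit \<alpha> \<alpha>v \<mu> \<subseteq> mu_connected_below \<mu>"
  proof
    fix \<nu> assume "\<nu> \<in> weyl_orbit \<alpha> \<alpha>v \<mu>"
    then obtain xs where xs: "\<nu> = foldr s xs \<mu>" unfolding weyl_orbit_words by blast
    obtain \<eta> where \<eta>: "\<eta> \<in> mu_connected_below \<mu>" "\<forall>x. blinfun_apply \<eta> x = \<mu> (act (rev xs) x)"
      using word_below[OF assms] by blast
    have "\<nu> = \<eta>" by (rule blinfun_eqI) (simp add: \<eta>(2) xs word_apply)
    then show "\<nu> \<in> mu_connected_below \<mu>" using \<eta>(1) by simp
  qed
qed (rule convex_mu_connected_below)

end

section \<open>Convex sets stable under reflections\<close>

lemma common_denominator:
  fixes q :: "'n::finite \<Rightarrow> real"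
  assumes "\<And>i. q i \<in> \<rat>"
  shows "\<exists>N::nat. N > 0 \<and> (\<forall>i. real N * q i \<in> \<int>)"
proof -
  have "\<exists>N::nat. N > 0 \<and> (\<forall>i\<in>S. real N * q i \<in> \<int>)" for S
  proof (induction S rule: infinite_finite_induct)
    case (insert x S)
    then obtain N :: nat where N: "N > 0" "\<forall>i\<in>S. real N * q i \<in> \<int>" by blast
    obtain a :: int and b :: nat where ab: "b > 0" "q x = of_int a / of_nat b"
      using assms[of x] unfolding Rats_eq_int_div_nat by auto
    have "real (N * b) * q i \<in> \<int>" if "i \<in> insert x S" for i
    proof (cases "i = x")
      case True
      then have "real (N * b) * q i = of_int (int N * a)" using ab by simp
      then show ?thesis by (metis Ints_of_int)
    next
      case False
      then have "real N * q i \<in> \<int>" using N(2) that by blast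
      then have "real b * (real N * q i) \<in> \<int>" by (rule Ints_mult[OF Ints_of_nat])
      moreover have "real (N * b) * q i = real b * (real N * q i)" by simp
      ultimately show ?thesis by (simp only:)
    qed
    then show ?case using N(1) ab(1) by (intro exI[of _ "N * b"]) simp
  qed auto
  from this[of UNIV] show ?thesis by simp
qed

lemma nonzero_Rats_near:
  fixes r d :: real
  assumes "d > 0"
  shows "\<exists>q\<in>\<rat>. q \<noteq> 0 \<and> \<bar>q - r\<bar> < d"
proof -
  obtain p where p: "p \<in> \<rat>" "r < p" "p < r + d" using Rats_dense_in_real[of r "r + d"] assms by auto
  obtain p' where p': "p' \<in> \<rat>" "p < p'" "p' < r + d" using Rats_dense_in_real[of p "r + d"] p by auto
  show ?thesis
  proof (cases "p = 0")
    case True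
    then show ?thesis using p p' by (intro bexI[of _ p']) auto
  next
    case False
    then show ?thesis using p by (intro bexI[of _ p]) auto
  qed
qed

text \<open>The simple reflection of the subsystem \<open>J\<close>, written in the coefficients of
  a combination of simple roots.\<close>

definition coordinate_reflection :: "real^'n^'n \<Rightarrow> 'n set \<Rightarrow> 'n \<Rightarrow> real^'n \<Rightarrow> real^'n" where
  "coordinate_reflection A J j v = v - submatrix_mult A J (\<lambda>k. v $ k) j *\<^sub>R axis j 1"

definition submatrix_row :: "real^'n^'n \<Rightarrow> 'n set \<Rightarrow> 'n \<Rightarrow> real^'n" where
  "submatrix_row A J j = (\<chi> k. if k \<in> J then A $ j $ k else 0)"

text \<open>The adjoint action on functionals; it subtracts an integral row and so preserves
  integrality.\<close>

lemma inner_coordinate_reflection: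
  "a \<bullet> coordinate_reflection A J j v = (a - a $ j *\<^sub>R submatrix_row A J j) \<bullet> v"
proof -
  have "submatrix_row A J j \<bullet> v = (\<Sum>k\<in>UNIV. if k \<in> J then A $ j $ k * v $ k else 0)"
    by (simp add: submatrix_row_def inner_vec_def if_distrib[of "\<lambda>x. x * _"] cong: if_cong)
  also have "\<dots> = submatrix_mult A J (\<lambda>k. v $ k) j"
    by (simp add: submatrix_mult_def sum.If_cases)
  finally show ?thesis
    by (simp add: coordinate_reflection_def inner_diff_right inner_diff_left inner_axis)
qed

text \<open>If \<open>0 \<notin> S\<close>, the functionals that are nonnegative on \<open>S\<close> form a reflection-stable
  cone with a nonzero integral point \<open>a\<close>; minimizing the integer \<open>a \<bullet> x\<close> over such points forces
  \<open>a \<le> 0\<close> and hence \<open>a = 0\<close>. This replaces the finiteness of the Weyl group.\<close>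

lemma zero_mem_finite_type:
  fixes A :: "real^'n^'n" and S :: "(real^'n) set"
  assumes A: "gen_cartan_matrix A"
    and S: "convex S" "\<And>v i. v \<in> S \<Longrightarrow> i \<notin> J \<Longrightarrow> v $ i = 0"
      "\<And>v j. v \<in> S \<Longrightarrow> j \<in> J \<Longrightarrow> coordinate_reflection A J j v \<in> S"
    and x: "x \<in> S" "\<And>i. i \<in> J \<Longrightarrow> x $ i \<in> \<int>" "\<And>i. i \<in> J \<Longrightarrow> x $ i > 0"
      "\<And>i. i \<in> J \<Longrightarrow> submatrix_mult A J (\<lambda>k. x $ k) i > 0"
  shows "0 \<in> S"
proof (rule ccontr)
  assume "0 \<notin> S"
  \<comment> \<open>Taking the separating functional in the span of \<open>S\<close> makes it vanish
    outside \<open>J\<close>.\<close>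
  then obtain a0 where a0: "a0 \<in> span S" "a0 \<noteq> 0" "\<And>y. y \<in> S \<Longrightarrow> 0 \<le> a0 \<bullet> y"
    using separating_hyperplane_set_0_inspan[OF S(1)] x(1) by (metis empty_iff)
  define E where "E = {a. (\<forall>i. i \<notin> J \<longrightarrow> a $ i = 0) \<and> (\<forall>y\<in>S. 0 \<le> a \<bullet> y)}"
  define U where "U K = {v::real^'n. \<forall>i. i \<notin> K \<longrightarrow> v $ i = 0}" for K
  have subU: "subspace (U K)" for K by (simp add: U_def subspace_def)
  have "a0 \<in> U J"
    using span_minimal[OF _ subU, of S J] a0(1) S(2) by (auto simp: U_def)
  then have a0E: "a0 \<in> E" using a0(3) by (simp add: E_def U_def)
  have Erefl: "a - a $ j *\<^sub>R submatrix_row A J j \<in> E" if "a \<in> E" "j \<in> J" for a j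
  proof -
    have "0 \<le> (a - a $ j *\<^sub>R submatrix_row A J j) \<bullet> y" if "y \<in> S" for y
      using \<open>a \<in> E\<close> S(3)[OF that \<open>j \<in> J\<close>] unfolding inner_coordinate_reflection[symmetric] E_def by blast
    then show ?thesis using that by (simp add: E_def submatrix_row_def)
  qed
  have cone: "c *\<^sub>R a \<in> E" if "a \<in> E" "c \<ge> 0" for a c using that by (simp add: E_def)
  have convE: "convex E"
    unfolding convex_def E_def by (simp add: inner_add_left)
  have "0 \<in> E" by (simp add: E_def)
  \<comment> \<open>The aim is that \<open>E\<close> spans the coordinate subspace of
    \<open>I1\<close>: in such a subspace rational points are dense, so \<open>E\<close> has a
    rational point near any of its relative interior points.\<close>
  define I1 where "I1 = {j\<in>J. \<exists>a\<in>E. a $ j \<noteq> 0}"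
  have EU: "E \<subseteq> U I1" unfolding U_def I1_def E_def by blast
  then have spanU: "span E \<subseteq> U I1" by (rule span_minimal[OF _ subU])
  have row: "submatrix_row A J j \<in> span E" if j: "j \<in> I1" for j
  proof -
    obtain a where a: "a \<in> E" "a $ j \<noteq> 0" "j \<in> J" using j unfolding I1_def by blast
    have "a - (a - a $ j *\<^sub>R submatrix_row A J j) \<in> span E"
      using a Erefl by (intro span_diff span_base)
    then have "a $ j *\<^sub>R submatrix_row A J j \<in> span E" by simp
    then have "(1 / a $ j) *\<^sub>R (a $ j *\<^sub>R submatrix_row A J j) \<in> span E"
      by (rule span_scale)
    then show ?thesis using a(2) by simp
  qed
  have "I1 \<subseteq> J" unfolding I1_def by blast
  \<comment> \<open>Reflecting functionals puts the rows with index in \<open>I1\<close> into the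
    span of \<open>E\<close>. Invertibility, witnessed by \<open>x\<close>, expresses the unit
    vectors through them.\<close>
  have "det (principal_ext A I1) \<noteq> 0"
  proof (rule det_principal_ext_nonzero[OF A, of I1 "\<lambda>k. x $ k"])
    fix i assume "i \<in> I1"
    then have "submatrix_mult A J (\<lambda>k. x $ k) i \<le> submatrix_mult A I1 (\<lambda>k. x $ k) i"
      using x(3) by (intro submatrix_mult_mono_subset[OF A \<open>I1 \<subseteq> J\<close>]) (auto simp: less_imp_le)
    then show "submatrix_mult A I1 (\<lambda>k. x $ k) i > 0" "x $ i > 0"
      using x(3,4)[of i] \<open>i \<in> I1\<close> \<open>I1 \<subseteq> J\<close> by auto
  qed
  then have "invertible (transpose (principal_ext A I1))"
    by (simp add: invertible_det_nz det_transpose)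
  then have surj: "surj ((*v) (transpose (principal_ext A I1)))"
    unfolding invertible_def matrix_right_invertible_surjective[symmetric] by blast
  have axis: "axis k 1 \<in> span E" if k: "k \<in> I1" for k
  proof -
    obtain z where z: "transpose (principal_ext A I1) *v z = axis k 1"
      using surj unfolding surj_def by metis
    have zk: "(\<Sum>j\<in>I1. z $ j * A $ j $ l) = (axis k 1 :: real^'n) $ l" if "l \<in> I1" for l
    proof -
      have "(transpose (principal_ext A I1) *v z) $ l
          = (\<Sum>j\<in>UNIV. (if j \<in> I1 \<and> l \<in> I1 then A $ j $ l else if j = l then 1 else 0) * z $ j)"
        unfolding matrix_vector_mult_def transpose_def principal_ext_def by simp
      also have "\<dots> = (\<Sum>j\<in>UNIV. if j \<in> I1 then z $ j * A $ j $ l else 0)"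
        using that by (intro sum.cong) auto
      also have "\<dots> = (\<Sum>j\<in>I1. z $ j * A $ j $ l)" by (simp add: sum.If_cases)
      finally show ?thesis using z by simp
    qed
    have "(\<Sum>j\<in>I1. z $ j *\<^sub>R submatrix_row A J j) $ l = (axis k 1 :: real^'n) $ l" for l
    proof (cases "l \<in> I1")
      case True
      then have "l \<in> J" using \<open>I1 \<subseteq> J\<close> by blast
      then show ?thesis using zk[OF True] by (simp add: submatrix_row_def)
    next
      case False
      have "submatrix_row A J j $ l = 0" if "j \<in> I1" for j
        using row[OF that] spanU False unfolding U_def by blast
      moreover have "l \<noteq> k" using False k by blast
      ultimately show ?thesis by (simp add: axis_def)
    qed
    then have "(\<Sum>j\<in>I1. z $ j *\<^sub>R submatrix_row A J j) = axis k 1" by (simp add: vec_eq_iff)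
    moreover have "(\<Sum>j\<in>I1. z $ j *\<^sub>R submatrix_row A J j) \<in> span E"
      by (intro span_sum span_scale row)
    ultimately show ?thesis by simp
  qed
  have Uspan: "U I1 \<subseteq> span E"
  proof
    fix v :: "real^'n" assume v: "v \<in> U I1"
    have "v = (\<Sum>i\<in>UNIV. v $ i *\<^sub>R axis i 1)"
      using basis_expansion[of v] by (simp add: scalar_mult_eq_scaleR)
    moreover have "v $ i *\<^sub>R axis i 1 \<in> span E" for i
    proof (cases "i \<in> I1")
      case True
      then show ?thesis by (intro span_scale axis)
    next
      case False
      then have "v $ i = 0" using v by (simp add: U_def)
      then show ?thesis by (simp add: span_zero)
    qed
    moreover from this have "(\<Sum>i\<in>UNIV. v $ i *\<^sub>R axis i 1) \<in> span E" by (rule span_sum)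
    ultimately show "v \<in> span E" by (simp only:)
  qed
  have aff: "affine hull E = span E"
    by (rule affine_hull_span_0) (simp add: \<open>0 \<in> E\<close> hull_inc)
  have "rel_interior E \<noteq> {}" using rel_interior_eq_empty[OF convE] \<open>0 \<in> E\<close> by blast
  then obtain p where "p \<in> rel_interior E" by blast
  then obtain T where p: "open T" "p \<in> T \<inter> E" "T \<inter> affine hull E \<subseteq> E"
    unfolding mem_rel_interior by blast
  from p(2) have "p \<in> T" by blast
  with p(1) obtain d where d: "d > 0" "ball p d \<subseteq> T" by (rule openE)
  \<comment> \<open>The norm is bounded by the sum of the coordinate errors, one for each
    index.\<close>
  define d' where "d' = d / (real CARD('n) + 1)"
  have "d' > 0" using d(1) by (simp add: d'_def)
  then have "\<forall>i. \<exists>q\<in>\<rat>. q \<noteq> 0 \<and> \<bar>q - p $ i\<bar> < d'" using nonzero_Rats_near by blast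
  then have "\<exists>r. \<forall>i. r i \<in> \<rat> \<and> r i \<noteq> 0 \<and> \<bar>r i - p $ i\<bar> < d'" unfolding Bex_def by (rule choice)
  then obtain r where r: "\<And>i. r i \<in> \<rat>" "\<And>i. r i \<noteq> 0" "\<And>i. \<bar>r i - p $ i\<bar> < d'" by blast
  define q :: "real^'n" where "q = (\<chi> i. if i \<in> I1 then r i else 0)"
  have pU: "p \<in> U I1" using p(2) EU by blast
  have "\<bar>(q - p) $ i\<bar> \<le> d'" for i
    using r(3)[of i] pU \<open>d' > 0\<close> by (auto simp: q_def U_def)
  then have "norm (q - p) \<le> (\<Sum>i\<in>(UNIV::'n set). d')"
    by (intro order_trans[OF norm_le_l1_cart] sum_mono) simp
  also have "\<dots> < d" using d(1) by (simp add: d'_def field_simps)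
  finally have "q \<in> ball p d" by (simp add: dist_norm norm_minus_commute)
  moreover have "q \<in> U I1" by (simp add: q_def U_def)
  ultimately have qE: "q \<in> E" using p(3) d(2) aff Uspan by blast
  have "I1 \<noteq> {}"
  proof
    assume "I1 = {}"
    then have "a0 = 0" using EU a0E by (auto simp: U_def vec_eq_iff)
    then show False using a0(2) by simp
  qed
  then obtain i1 where "i1 \<in> I1" by blast
  then have "q $ i1 \<noteq> 0" using r(2) by (simp add: q_def)
  have "q $ i \<in> \<rat>" for i using r(1) by (simp add: q_def)
  then obtain N :: nat where N: "N > 0" "\<forall>i. real N * q $ i \<in> \<int>"
    using common_denominator[of "\<lambda>i. q $ i"] by auto
  define F where "F = {a\<in>E. a \<noteq> 0 \<and> (\<forall>i. a $ i \<in> \<int>)}"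
  have "(real N *\<^sub>R q) $ i1 \<noteq> 0" using \<open>q $ i1 \<noteq> 0\<close> N(1) by simp
  then have "real N *\<^sub>R q \<noteq> 0" by (metis zero_index)
  then have NqF: "real N *\<^sub>R q \<in> F" using cone[OF qE] N by (simp add: F_def)
  have ax: "a \<bullet> x = (\<Sum>i\<in>J. a $ i * x $ i)" if "a \<in> E" for a
    unfolding inner_vec_def using that by (intro sum.mono_neutral_cong_right) (auto simp: E_def)
  have Fx: "a \<bullet> x \<in> \<int>" "a \<bullet> x \<ge> 0" if "a \<in> F" for a
  proof -
    have "a \<in> E" "\<And>i. a $ i \<in> \<int>" using that by (auto simp: F_def)
    then show "a \<bullet> x \<in> \<int>" using ax x(2) by (auto intro!: Ints_sum Ints_mult)
    show "a \<bullet> x \<ge> 0" using \<open>a \<in> E\<close> x(1) by (auto simp: E_def)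
  qed
  obtain a where aF: "a \<in> F" and "\<forall>b. b \<in> F \<longrightarrow> nat \<lfloor>a \<bullet> x\<rfloor> \<le> nat \<lfloor>b \<bullet> x\<rfloor>"
    using ex_has_least_nat[of "\<lambda>a. a \<in> F", OF NqF, of "\<lambda>a. nat \<lfloor>a \<bullet> x\<rfloor>"] by blast
  then have min: "a \<bullet> x \<le> b \<bullet> x" if bF: "b \<in> F" for b
  proof -
    obtain m where "a \<bullet> x = real_of_int m" using Fx(1)[OF aF] by (rule Ints_cases)
    moreover obtain n where "b \<bullet> x = real_of_int n" using Fx(1)[OF bF] by (rule Ints_cases)
    moreover have "nat \<lfloor>a \<bullet> x\<rfloor> \<le> nat \<lfloor>b \<bullet> x\<rfloor>"
      using \<open>\<forall>b. b \<in> F \<longrightarrow> nat \<lfloor>a \<bullet> x\<rfloor> \<le> nat \<lfloor>b \<bullet> x\<rfloor>\<close> bF by blast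
    ultimately show ?thesis using Fx(2)[OF aF] Fx(2)[OF bF] by simp
  qed
  have aE: "a \<in> E" "a \<noteq> 0" "\<And>i. a $ i \<in> \<int>" using aF by (auto simp: F_def)
  have nonpos: "a $ j \<le> 0" if j: "j \<in> J" for j
  proof -
    let ?b = "a - a $ j *\<^sub>R submatrix_row A J j"
    have "?b \<noteq> 0"
    proof
      assume "?b = 0"
      then have "a = a $ j *\<^sub>R submatrix_row A J j" by simp
      then have "a $ j = (a $ j *\<^sub>R submatrix_row A J j) $ j" by (rule arg_cong)
      then have "a $ j = 0" using j by (simp add: submatrix_row_def gcm_diag[OF A])
      then show False using \<open>?b = 0\<close> aE(2) by simp
    qed
    moreover have "?b $ i \<in> \<int>" for i
      using aE(3) gcm_Ints[OF A, of j i] by (auto simp: submatrix_row_def intro!: Ints_diff Ints_mult)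
    ultimately have "?b \<in> F" using Erefl[OF aE(1) j] by (simp add: F_def)
    \<comment> \<open>Reflecting \<open>a\<close> lowers its value at \<open>x\<close> by
      \<open>a $ j\<close> times a positive row of \<open>x\<close>. As the value is already
      minimal, \<open>a $ j\<close> cannot be positive.\<close>
    then have "a \<bullet> x \<le> a \<bullet> coordinate_reflection A J j x"
      unfolding inner_coordinate_reflection by (rule min)
    then have "a $ j * submatrix_mult A J (\<lambda>k. x $ k) j \<le> 0"
      by (simp add: coordinate_reflection_def inner_diff_right inner_axis mult.commute)
    then show ?thesis using x(4)[OF j] by (simp add: mult_le_0_iff)
  qed
  have nn: "0 \<le> - (a $ i * x $ i)" if "i \<in> J" for i
    using nonpos[OF that] x(3)[OF that] by (simp add: mult_nonpos_nonneg)
  then have "(\<Sum>i\<in>J. - (a $ i * x $ i)) \<ge> 0" by (rule sum_nonneg)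
  moreover have "(\<Sum>i\<in>J. - (a $ i * x $ i)) \<le> 0"
    using Fx(2)[OF aF] ax[OF aE(1)] by (simp add: sum_negf)
  ultimately have "(\<Sum>i\<in>J. - (a $ i * x $ i)) = 0" by (rule order_antisym[rotated])
  moreover have "(\<Sum>i\<in>J. - (a $ i * x $ i)) = 0 \<longleftrightarrow> (\<forall>i\<in>J. - (a $ i * x $ i) = 0)"
    by (rule sum_nonneg_eq_0_iff[OF finite nn])
  ultimately have "\<forall>i\<in>J. - (a $ i * x $ i) = 0" by (simp only:)
  then have "a $ i * x $ i = 0" if "i \<in> J" for i using that by simp
  then have "a $ i = 0" if "i \<in> J" for i using x(3)[OF that] that by force
  then have "a $ i = 0" for i using aE(1) unfolding E_def by blast
  then show False using aE(2) by (simp add: vec_eq_iff)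
qed

section \<open>Perturbation and rounding\<close>

lemma small_scale_pos:
  fixes p q :: "'a \<Rightarrow> real"
  assumes "finite S" "\<forall>i\<in>S. p i > 0"
  shows "\<exists>e>0. \<forall>i\<in>S. p i + e * q i > 0"
  using assms
proof (induction S rule: finite_induct)
  case empty
  show ?case by (intro exI[of _ 1]) simp
next
  case (insert k S)
  then obtain e where e: "e > 0" "\<forall>i\<in>S. p i + e * q i > 0" by auto
  define d where "d = min e (p k / (2 * (\<bar>q k\<bar> + 1)))"
  have pk: "p k > 0" using insert.prems by simp
  have d: "d > 0" "d \<le> e" using e(1) pk by (simp_all add: d_def)
  have "p i + d * q i > 0" if "i \<in> S" for i
  proof (cases "q i \<ge> 0")
    case True
    then have "d * q i \<ge> 0" using d(1) by simp
    moreover have "p i > 0" using insert.prems that by simp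
    ultimately show ?thesis by linarith
  next
    case False
    then have "e * q i \<le> d * q i" using d(2) by (intro mult_right_mono_neg) auto
    moreover have "p i + e * q i > 0" using e(2) that by blast
    ultimately show ?thesis by linarith
  qed
  moreover have "p k + d * q k > 0"
  proof -
    have "d * \<bar>q k\<bar> \<le> d * (\<bar>q k\<bar> + 1)" using d(1) by (intro mult_left_mono) auto
    also have "\<dots> \<le> (p k / (2 * (\<bar>q k\<bar> + 1))) * (\<bar>q k\<bar> + 1)"
      by (intro mult_right_mono) (auto simp: d_def)
    also have "\<dots> = p k / 2" by (simp add: field_simps add_nonneg_eq_0_iff)
    finally have "d * \<bar>q k\<bar> \<le> p k / 2" .
    moreover have "- (d * q k) \<le> d * \<bar>q k\<bar>"
      using abs_ge_minus_self[of "d * q k"] d(1) by (simp add: abs_mult)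
    ultimately show ?thesis using pk by linarith
  qed
  ultimately show ?case using d(1) by (intro exI[of _ d]) auto
qed

text \<open>Scale \<open>u\<close> and round up. Rounding changes row \<open>i\<close> by at most
  the absolute row sum \<open>B i\<close>, and \<open>N = 1 / e\<close> is large enough for the
  scaled rows to exceed this.\<close>

lemma integral_supersolution:
  fixes A :: "real^'n^'n"
  assumes "\<forall>i\<in>J. u i > 0" "\<forall>i\<in>J. submatrix_mult A J u i > 0"
  shows "\<exists>x. (\<forall>i\<in>J. x i \<in> \<int> \<and> x i > 0) \<and> (\<forall>i\<in>J. submatrix_mult A J x i > 0)"
proof -
  define B where "B i = (\<Sum>j\<in>J. \<bar>A $ i $ j\<bar>)" for i
  obtain e where e: "e > 0" "\<forall>i\<in>J. submatrix_mult A J u i + e * (- B i) > 0"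
    using small_scale_pos[OF finite assms(2), of "\<lambda>i. - B i"] by blast
  define N where "N = 1 / e"
  have "N > 0" using e(1) by (simp add: N_def)
  define x where "x i = real_of_int \<lceil>N * u i\<rceil>" for i
  have "x i > 0" if "i \<in> J" for i
  proof -
    have "N * u i > 0" using assms(1) that \<open>N > 0\<close> by simp
    then show ?thesis unfolding x_def using le_of_int_ceiling[of "N * u i"] by linarith
  qed
  moreover have "submatrix_mult A J x i > 0" if "i \<in> J" for i
  proof -
    have "A $ i $ j * x j \<ge> N * (A $ i $ j * u j) - \<bar>A $ i $ j\<bar>" for j
    proof -
      define r where "r = x j - N * u j"
      have "\<bar>r\<bar> \<le> 1" unfolding r_def x_def by linarith
      then have "\<bar>A $ i $ j * r\<bar> \<le> \<bar>A $ i $ j\<bar>"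
        using mult_left_mono[of "\<bar>r\<bar>" 1 "\<bar>A $ i $ j\<bar>"] by (simp add: abs_mult)
      moreover have "A $ i $ j * x j = N * (A $ i $ j * u j) + A $ i $ j * r"
        by (simp add: r_def algebra_simps)
      ultimately show ?thesis by linarith
    qed
    then have "(\<Sum>j\<in>J. N * (A $ i $ j * u j) - \<bar>A $ i $ j\<bar>) \<le> submatrix_mult A J x i"
      unfolding submatrix_mult_def by (intro sum_mono)
    moreover have "(\<Sum>j\<in>J. N * (A $ i $ j * u j) - \<bar>A $ i $ j\<bar>) = N * (submatrix_mult A J u i + e * (- B i))"
      using e(1) by (simp add: submatrix_mult_def B_def N_def sum_subtractf sum_distrib_left right_diff_distrib)
    moreover have "N * (submatrix_mult A J u i + e * (- B i)) > 0"
      using e(2) that \<open>N > 0\<close> by (intro mult_pos_pos) auto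
    ultimately show ?thesis by linarith
  qed
  moreover have "x i \<in> \<int>" for i by (simp add: x_def)
  ultimately show ?thesis by blast
qed

section \<open>Moving inside a convex reflection-stable set\<close>

context gcm_realization
begin

text \<open>These points make up the segment from \<eta> to its reflection.\<close>

lemma root_step:
  assumes H: "convex H" "\<forall>i. \<forall>\<eta>\<in>H. s i \<eta> \<in> H"
    and \<eta>: "\<eta> \<in> H" "0 \<le> t" "t \<le> \<eta> (\<alpha>v i)"
  shows "\<eta> - t *\<^sub>R \<alpha> i \<in> H"
proof (cases "\<eta> (\<alpha>v i) = 0")
  case True
  then have "t = 0" using \<eta> by linarith
  then show ?thesis using \<eta>(1) by simp
next
  case False
  then have pos: "\<eta> (\<alpha>v i) > 0" using \<eta> by linarith
  define w where "w = t / \<eta> (\<alpha>v i)"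
  have w: "w \<ge> 0" "1 - w \<ge> 0" "w * \<eta> (\<alpha>v i) = t" using pos \<eta> by (simp_all add: w_def)
  have "(1 - w) *\<^sub>R \<eta> + w *\<^sub>R s i \<eta> \<in> H"
    using H(2) \<eta>(1) w by (intro convexD[OF H(1)]) auto
  moreover have "(1 - w) *\<^sub>R \<eta> + w *\<^sub>R s i \<eta> = \<eta> - (w * \<eta> (\<alpha>v i)) *\<^sub>R \<alpha> i"
    by (simp add: simple_reflection_def algebra_simps)
  ultimately show ?thesis by (simp only: w(3))
qed

text \<open>The target is the average over all indices of single steps of size
  \<open>CARD('n) * y i\<close>, which explains the factor.\<close>

lemma simultaneous_step:
  assumes H: "convex H" "\<forall>i. \<forall>\<eta>\<in>H. s i \<eta> \<in> H"
    and \<eta>: "\<eta> \<in> H" "\<forall>i. y i \<ge> 0" "\<forall>i. y i > 0 \<longrightarrow> real CARD('n) * y i \<le> \<eta> (\<alpha>v i)"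
  shows "\<eta> - root_comb y \<in> H"
proof -
  let ?n = "real CARD('n)"
  have p: "\<eta> - (?n * y i) *\<^sub>R \<alpha> i \<in> H" for i
  proof (cases "y i > 0")
    case True
    then show ?thesis using \<eta> by (intro root_step[OF H]) auto
  next
    case False
    then have "y i = 0" using \<eta>(2) by (simp add: not_less order_antisym)
    then show ?thesis using \<eta>(1) by simp
  qed
  have "(\<Sum>i\<in>UNIV. (1 / ?n) *\<^sub>R (\<eta> - (?n * y i) *\<^sub>R \<alpha> i)) \<in> H"
    by (rule convex_sum[OF finite H(1)]) (use p in auto)
  moreover have "(1 / ?n) *\<^sub>R (\<eta> - (?n * y i) *\<^sub>R \<alpha> i) = (1 / ?n) *\<^sub>R \<eta> - y i *\<^sub>R \<alpha> i" for i
    by (simp add: scaleR_diff_right)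
  moreover have "(\<Sum>i\<in>(UNIV::'n set). (1 / ?n) *\<^sub>R \<eta>) = \<eta>"
    by (simp add: scaleR_sum_left[symmetric])
  ultimately show ?thesis by (simp add: sum_subtractf root_comb_def)
qed

text \<open>Values on coroots are affine along the segment, so those on the support stay above the
  least endpoint value \<open>m\<close>. Hence one step length \<open>b / N\<close> is admissible
  everywhere.\<close>

lemma segment_in_stable_set:
  assumes H: "convex H" "\<forall>i. \<forall>\<eta>\<in>H. s i \<eta> \<in> H"
    and \<eta>: "\<eta> \<in> H" "\<forall>i. b i \<ge> 0"
      "\<forall>i. b i > 0 \<longrightarrow> \<eta> (\<alpha>v i) > 0 \<and> (\<eta> - root_comb b) (\<alpha>v i) > 0"
  shows "\<eta> - root_comb b \<in> H"
proof (cases "\<exists>i. b i > 0")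
  case False
  then have "b = (\<lambda>i. 0)" using \<eta>(2) by (intro ext) (meson not_less order_antisym)
  then show ?thesis using \<eta>(1) by simp
next
  case True
  let ?z = "\<eta> - root_comb b" and ?n = "real CARD('n)"
  let ?M = "(\<lambda>i. min (\<eta> (\<alpha>v i)) (?z (\<alpha>v i))) ` {i. b i > 0}"
  define m where "m = Min ?M"
  have M: "finite ?M" "?M \<noteq> {}" using True by auto
  have "m \<in> ?M" unfolding m_def by (rule Min_in[OF M])
  then have "m > 0" using \<eta>(3) by auto
  have mle: "m \<le> \<eta> (\<alpha>v i)" "m \<le> ?z (\<alpha>v i)" if "b i > 0" for i
  proof -
    have "m \<le> min (\<eta> (\<alpha>v i)) (?z (\<alpha>v i))" unfolding m_def using that by (intro Min_le[OF M(1)]) blast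
    then show "m \<le> \<eta> (\<alpha>v i)" "m \<le> ?z (\<alpha>v i)" by simp_all
  qed
  obtain N :: nat where N: "?n * (\<Sum>i\<in>UNIV. b i) / m < real N" using reals_Archimedean2 by blast
  have "?n * (\<Sum>i\<in>UNIV. b i) / m \<ge> 0" using \<eta>(2) \<open>m > 0\<close> by (simp add: sum_nonneg)
  then have Npos: "real N > 0" using N by linarith
  have bN: "?n * (b i / real N) \<le> m" for i
  proof -
    have "b i \<le> (\<Sum>i\<in>UNIV. b i)" using \<eta>(2) by (intro member_le_sum) auto
    then have "?n * b i \<le> ?n * (\<Sum>i\<in>UNIV. b i)" by (rule mult_left_mono) simp
    also have "\<dots> \<le> real N * m" using N \<open>m > 0\<close> by (simp add: field_simps)
    finally show ?thesis using Npos by (simp add: field_simps)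
  qed
  have "\<eta> - (real k / real N) *\<^sub>R root_comb b \<in> H" if "k \<le> N" for k
    using that
  proof (induction k)
    case 0
    then show ?case using \<eta>(1) by simp
  next
    case (Suc k)
    define t where "t = real k / real N"
    have t: "0 \<le> t" "t \<le> 1" using Suc.prems Npos by (simp_all add: t_def)
    have mem: "\<eta> - t *\<^sub>R root_comb b \<in> H" using Suc unfolding t_def by simp
    have "\<eta> - t *\<^sub>R root_comb b - root_comb (\<lambda>i. b i / real N) \<in> H"
    proof (rule simultaneous_step[OF H mem])
      show "\<forall>i. b i / real N \<ge> 0" using \<eta>(2) by simp
      show "\<forall>i. b i / real N > 0 \<longrightarrow>
          ?n * (b i / real N) \<le> (\<eta> - t *\<^sub>R root_comb b) (\<alpha>v i)"
      proof (intro allI impI)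
        fix i assume "b i / real N > 0"
        then have "b i > 0" using Npos by (simp add: zero_less_divide_iff)
        have "(\<eta> - t *\<^sub>R root_comb b) (\<alpha>v i) = (1 - t) * \<eta> (\<alpha>v i) + t * ?z (\<alpha>v i)"
          by (simp add: blinfun.diff_left blinfun.scaleR_left algebra_simps)
        moreover have "(1 - t) * m \<le> (1 - t) * \<eta> (\<alpha>v i)" "t * m \<le> t * ?z (\<alpha>v i)"
          using t mle[OF \<open>b i > 0\<close>] by (simp_all add: mult_left_mono)
        moreover have "(1 - t) * m + t * m = m" by (simp add: algebra_simps)
        ultimately have "m \<le> (\<eta> - t *\<^sub>R root_comb b) (\<alpha>v i)" by linarith
        then show "?n * (b i / real N) \<le> (\<eta> - t *\<^sub>R root_comb b) (\<alpha>v i)"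
          using bN[of i] by linarith
      qed
    qed
    moreover have "\<eta> - t *\<^sub>R root_comb b - root_comb (\<lambda>i. b i / real N)
        = \<eta> - (real (Suc k) / real N) *\<^sub>R root_comb b"
      using root_comb_scale[of "1 / real N" b]
      by (simp add: t_def add_divide_distrib scaleR_left_distrib)
    ultimately show ?case by simp
  qed
  from this[of N] show ?thesis using Npos by simp
qed

text \<open>Induction on the number of zeros in \<open>I\<close>. Subtracting a little of
  \<alpha>_j, where \<open>j\<close> has positive value and a neighbour \<open>i\<close> of value 0,
  makes \<open>i\<close> positive and creates no new zero. The bound \<delta> keeps the total
  subtraction below given coefficients.\<close>

lemma spread_positive:
  assumes H: "convex H" "\<forall>i. \<forall>\<eta>\<in>H. s i \<eta> \<in> H"
    and \<eta>: "\<eta> \<in> H" "\<forall>i\<in>I. \<eta> (\<alpha>v i) \<ge> 0" "mu_connected A (stabilizer_roots \<alpha>v \<eta>) I" "\<delta> > 0"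
  shows "\<exists>c. (\<forall>i. 0 \<le> c i \<and> c i \<le> \<delta>) \<and> (\<forall>i. i \<notin> I \<longrightarrow> c i = 0) \<and> \<eta> - root_comb c \<in> H \<and>
    (\<forall>i\<in>I. (\<eta> - root_comb c) (\<alpha>v i) > 0)"
  using \<eta>
proof (induction "card (I \<inter> stabilizer_roots \<alpha>v \<eta>)" arbitrary: \<eta> \<delta> rule: less_induct)
  case less
  let ?Z = "\<lambda>\<eta>. I \<inter> stabilizer_roots \<alpha>v \<eta>"
  show ?case
  proof (cases "?Z \<eta> = {}")
    case True
    have "\<eta> (\<alpha>v i) > 0" if "i \<in> I" for i
    proof -
      have "i \<notin> stabilizer_roots \<alpha>v \<eta>" using True that by blast
      moreover have "\<eta> (\<alpha>v i) \<ge> 0" using less.prems(2) that by blast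
      ultimately show ?thesis by (simp add: stabilizer_roots_def)
    qed
    then show ?thesis using less.prems(1,4) by (intro exI[of _ "\<lambda>i. 0"]) simp
  next
    case False
    obtain i j where ij: "i \<in> ?Z \<eta>" "j \<in> I - ?Z \<eta>" "A $ i $ j \<noteq> 0" "i \<noteq> j"
      by (rule mu_connected_boundary_edge[OF gcm less.prems(3) _ _ False]) auto
    then have Aneg: "A $ i $ j < 0" using gcm_offdiag[OF gcm, of i j] by simp
    have \<eta>j: "\<eta> (\<alpha>v j) > 0"     proof -
      have "\<eta> (\<alpha>v j) \<ge> 0" using less.prems(2) ij(2) by blast
      moreover have "\<eta> (\<alpha>v j) \<noteq> 0" using ij(2) by (simp add: stabilizer_roots_def)
      ultimately show ?thesis by linarith
    qed
    \<comment> \<open>Half of \<delta> is spent here and the other half is left to the recursion,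
      which may use \<open>j\<close> again. The quarter leaves at least half of the value at
      \<open>j\<close>, since that value drops by \<open>2 * e\<close>.\<close>
    define e where "e = min (\<delta> / 2) (\<eta> (\<alpha>v j) / 4)"
    have e: "e > 0" "e \<le> \<delta> / 2" "4 * e \<le> \<eta> (\<alpha>v j)" using \<eta>j less.prems(4) by (auto simp: e_def)
    define \<eta>' where "\<eta>' = \<eta> - e *\<^sub>R \<alpha> j"
    have mem: "\<eta>' \<in> H" unfolding \<eta>'_def using e by (intro root_step[OF H less.prems(1)]) auto
    have val: "\<eta>' (\<alpha>v k) = \<eta> (\<alpha>v k) - e * A $ k $ j" for k
      by (simp add: \<eta>'_def blinfun.diff_left blinfun.scaleR_left pairing)
    have j: "\<eta>' (\<alpha>v j) > 0" using e by (simp add: val gcm_diag[OF gcm])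
    have other: "\<eta>' (\<alpha>v k) \<ge> \<eta> (\<alpha>v k)" if "k \<noteq> j" for k
      using gcm_offdiag[OF gcm that] e(1) by (simp add: val mult_nonneg_nonpos)
    have nn: "\<forall>k\<in>I. \<eta>' (\<alpha>v k) \<ge> 0"
    proof
      fix k assume "k \<in> I"
      then have "\<eta> (\<alpha>v k) \<ge> 0" using less.prems(2) by blast
      then show "\<eta>' (\<alpha>v k) \<ge> 0" using j other[of k] by (cases "k = j") simp_all
    qed
    have sub: "?Z \<eta>' \<subseteq> ?Z \<eta>"
    proof
      fix k assume k: "k \<in> ?Z \<eta>'"
      then have "k \<noteq> j" using j by (auto simp: stabilizer_roots_def)
      then have "\<eta> (\<alpha>v k) \<le> 0" using other[of k] k by (simp add: stabilizer_roots_def)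
      moreover have "\<eta> (\<alpha>v k) \<ge> 0" using k less.prems(2) by blast
      ultimately show "k \<in> ?Z \<eta>" using k by (simp add: stabilizer_roots_def)
    qed
    have "\<eta>' (\<alpha>v i) > 0" using ij(1) e(1) Aneg by (simp add: val stabilizer_roots_def mult_pos_neg)
    then have "i \<notin> ?Z \<eta>'" by (simp add: stabilizer_roots_def)
    with sub ij(1) have "?Z \<eta>' \<subset> ?Z \<eta>" by blast
    then have card: "card (?Z \<eta>') < card (?Z \<eta>)" by (intro psubset_card_mono) auto
    have conn: "mu_connected A (stabilizer_roots \<alpha>v \<eta>') I"
      using less.prems(3) sub unfolding mu_connected_iff by blast
    have "\<delta> / 2 > 0" using less.prems(4) by simp
    from less.hyps[OF card mem nn conn this] obtain c where c: "\<forall>i. 0 \<le> c i \<and> c i \<le> \<delta> / 2"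
      "\<forall>i. i \<notin> I \<longrightarrow> c i = 0" "\<eta>' - root_comb c \<in> H" "\<forall>i\<in>I. (\<eta>' - root_comb c) (\<alpha>v i) > 0"
      by blast
    define d where "d i = c i + (if i = j then e else 0)" for i
    have "root_comb d = root_comb c + e *\<^sub>R \<alpha> j" unfolding d_def root_comb_add root_comb_single ..
    then have eq: "\<eta> - root_comb d = \<eta>' - root_comb c" by (simp add: \<eta>'_def)
    have "0 \<le> d i \<and> d i \<le> \<delta>" for i
    proof -
      have "0 \<le> c i" "c i \<le> \<delta> / 2" using c(1) by auto
      then show ?thesis using e less.prems(4) by (cases "i = j") (simp_all add: d_def)
    qed
    moreover have "\<forall>i. i \<notin> I \<longrightarrow> d i = 0" using c(2) ij(2) by (auto simp: d_def)
    ultimately show ?thesis using c(3,4) by (intro exI[of _ d]) (simp add: eq)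
  qed
qed

lemma strictly_dominant_below_in_stable_set:
  assumes H: "convex H" "\<forall>i. \<forall>\<eta>\<in>H. s i \<eta> \<in> H"
    and \<mu>: "\<mu> \<in> H" "\<mu> \<in> fundamental_chamber \<alpha>v"
    and c: "\<forall>i. c i \<ge> 0" "mu_connected A (stabilizer_roots \<alpha>v \<mu>) {i. c i > 0}"
      "\<forall>i. c i > 0 \<longrightarrow> (\<mu> - root_comb c) (\<alpha>v i) > 0"
  shows "\<mu> - root_comb c \<in> H"
proof (cases "\<exists>i. c i > 0")
  case False
  then have "c = (\<lambda>i. 0)" using c(1) by (intro ext) (meson not_less order_antisym)
  then show ?thesis using \<mu>(1) by simp
next
  case True
  let ?I = "{i. c i > 0}"
  \<comment> \<open>With the least coefficient of the support as bound, spreading never overshoots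
    \<open>c\<close>, so the remaining difference is nonnegative.\<close>
  define \<delta> where "\<delta> = Min (c ` ?I)"
  have fin: "finite (c ` ?I)" "c ` ?I \<noteq> {}" using True by auto
  have "\<delta> \<in> c ` ?I" unfolding \<delta>_def by (rule Min_in[OF fin])
  then have "\<delta> > 0" by blast
  have \<delta>le: "\<delta> \<le> c i" if "c i > 0" for i unfolding \<delta>_def using that by (intro Min_le[OF fin(1)]) blast
  have "\<forall>i\<in>?I. \<mu> (\<alpha>v i) \<ge> 0" using \<mu>(2) by (simp add: fundamental_chamber_def)
  from spread_positive[OF H \<mu>(1) this c(2) \<open>\<delta> > 0\<close>]
  obtain d where d: "\<forall>i. 0 \<le> d i \<and> d i \<le> \<delta>" "\<forall>i. i \<notin> ?I \<longrightarrow> d i = 0"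
    "\<mu> - root_comb d \<in> H" "\<forall>i\<in>?I. (\<mu> - root_comb d) (\<alpha>v i) > 0"
    by (elim exE conjE) (rule that)
  have eq: "\<mu> - root_comb d - root_comb (\<lambda>i. c i - d i) = \<mu> - root_comb c"
    by (simp add: root_comb_diff)
  have pos: "d i \<le> c i" "c i - d i > 0 \<Longrightarrow> c i > 0" for i
  proof -
    show "d i \<le> c i"
    proof (cases "c i > 0")
      case True
      then show ?thesis using \<delta>le[OF True] d(1) by (meson order_trans)
    next
      case False
      then show ?thesis using d(2) c(1) by simp
    qed
    have "d i \<ge> 0" using d(1) by blast
    then show "c i - d i > 0 \<Longrightarrow> c i > 0" by linarith
  qed
  have "\<mu> - root_comb d - root_comb (\<lambda>i. c i - d i) \<in> H"
  proof (rule segment_in_stable_set[OF H d(3)])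
    show "\<forall>i. c i - d i \<ge> 0" using pos(1) by simp
    show "\<forall>i. c i - d i > 0 \<longrightarrow> (\<mu> - root_comb d) (\<alpha>v i) > 0 \<and>
      (\<mu> - root_comb d - root_comb (\<lambda>i. c i - d i)) (\<alpha>v i) > 0"
      unfolding eq using pos(2) d(4) c(3) by blast
  qed
  then show ?thesis by (simp only: eq)
qed

text \<open>Otherwise subtract from \<open>c\<close> the largest possible multiple of a subsolution on \<open>J\<close>:
  the zero set of the difference lies in \<open>J\<^sub>0\<close> and is a union of components of the support.\<close>

lemma zero_set_finite_type:
  assumes \<mu>: "\<mu> \<in> fundamental_chamber \<alpha>v"
    and c: "\<forall>i. c i \<ge> 0" "mu_connected A (stabilizer_roots \<alpha>v \<mu>) {i. c i > 0}"
  defines "J \<equiv> {i. c i > 0 \<and> (\<mu> - root_comb c) (\<alpha>v i) = 0}"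
  shows "\<exists>u. (\<forall>i\<in>J. u i > 0) \<and> (\<forall>i\<in>J. submatrix_mult A J u i > 0)"
proof (rule ccontr)
  assume "\<not> ?thesis"
  then obtain v k where v: "\<forall>i\<in>J. v i \<ge> 0" "k \<in> J" "v k > 0" "\<forall>i\<in>J. submatrix_mult A J v i \<le> 0"
    using gcm_alternative[OF gcm, of J] by blast
  let ?I = "{i. c i > 0}"
  have "J \<subseteq> ?I" unfolding J_def by blast
  have cJ: "c i > 0" if "i \<in> J" for i using that unfolding J_def by blast
  obtain t i0 where t: "i0 \<in> J" "t > 0" "c i0 - t * v i0 = 0" "\<And>j. j \<in> J \<Longrightarrow> c j - t * v j \<ge> 0"
    by (rule ratio_min[of J v k "\<lambda>t. t > 0" c]) (use v cJ in \<open>auto intro: less_imp_le\<close>)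
  define w where "w j = c j - t * v j" for j
  have w: "w j \<ge> 0" if "j \<in> J" for j using t(4)[OF that] by (simp add: w_def)
  define Z where "Z = {i\<in>J. w i = 0}"
  have Z: "\<mu> (\<alpha>v i) = 0 \<and> (\<forall>j\<in>?I - Z. A $ i $ j = 0)" if "i \<in> Z" for i
  proof -
    have iJ: "i \<in> J" "w i = 0" using that by (auto simp: Z_def)
    have "submatrix_mult A J w i = submatrix_mult A J c i - t * submatrix_mult A J v i"
      unfolding w_def by (rule submatrix_mult_diff)
    moreover have "t * submatrix_mult A J v i \<le> 0" using v(4) iJ(1) t(2) by (simp add: mult_nonneg_nonpos)
    moreover have "submatrix_mult A J w i \<le> 0"
      by (rule submatrix_mult_at_zero(1)[OF gcm w]) (simp_all add: iJ)
    ultimately have le: "submatrix_mult A J c i \<le> submatrix_mult A J w i"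
      "submatrix_mult A J w i \<le> 0" by linarith+
    have le2: "submatrix_mult A (?I - J) c i \<le> 0"
      by (rule submatrix_mult_at_zero(1)[OF gcm]) (use c(1) iJ in auto)
    have "submatrix_mult A UNIV c i = submatrix_mult A ?I c i"
      unfolding submatrix_mult_def using c(1) by (intro sum.mono_neutral_right) (auto simp: less_le)
    also have "\<dots> = submatrix_mult A (?I - J) c i + submatrix_mult A J c i"
      unfolding submatrix_mult_def by (rule sum.subset_diff[OF \<open>J \<subseteq> ?I\<close>]) simp
    finally have "\<mu> (\<alpha>v i) = submatrix_mult A (?I - J) c i + submatrix_mult A J c i"
      using iJ(1) by (simp add: J_def blinfun.diff_left root_comb_coroot)
    \<comment> \<open>A nonnegative number equals a sum of two nonpositive ones, so all inequalities
      at \<open>i\<close> are equalities and no support node outside \<open>Z\<close> is adjacent to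
      \<open>i\<close>.\<close>
    moreover have "\<mu> (\<alpha>v i) \<ge> 0" using \<mu> by (simp add: fundamental_chamber_def)
    ultimately have zero: "\<mu> (\<alpha>v i) = 0" "submatrix_mult A J w i \<ge> 0" "submatrix_mult A (?I - J) c i \<ge> 0"
      using le le2 by linarith+
    have "A $ i $ j = 0" if j: "j \<in> ?I - Z" for j
    proof (cases "j \<in> J")
      case True
      then have "w j > 0" using j w[OF True] by (auto simp: Z_def less_le)
      show ?thesis
        by (rule submatrix_mult_at_zero(2)[OF gcm w _ zero(2) True \<open>w j > 0\<close>]) (simp_all add: iJ)
    next
      case False
      then have "j \<in> ?I - J" "c j > 0" using j by auto
      show ?thesis
        by (rule submatrix_mult_at_zero(2)[OF gcm _ _ zero(3) \<open>j \<in> ?I - J\<close> \<open>c j > 0\<close>]) (use c(1) iJ in auto)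
    qed
    then show ?thesis using zero(1) by blast
  qed
  have "Z \<subseteq> ?I" "Z \<subseteq> stabilizer_roots \<alpha>v \<mu>" "Z \<noteq> {}"
    using \<open>J \<subseteq> ?I\<close> Z t(1,3) by (auto simp: Z_def stabilizer_roots_def w_def)
  then obtain i j where "i \<in> Z" "j \<in> ?I - Z" "A $ i $ j \<noteq> 0"
    by (rule mu_connected_boundary_edge[OF gcm c(2)])
  then show False using Z by blast
qed

text \<open>Raise \<nu> by a small root combination \<open>e * y\<close> supported on its zero set
  \<open>J\<close>, so that it becomes strictly positive on the support and thus lies in
  \<open>H\<close>. The reflections in \<open>J\<close> fix \<nu>, and the fixed-point lemma returns
  from the raised point to \<nu>.\<close>

lemma dominant_below_in_stable_set:
  assumes H: "convex H" "\<forall>i. \<forall>\<eta>\<in>H. s i \<eta> \<in> H"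
    and \<mu>: "\<mu> \<in> H" "\<mu> \<in> fundamental_chamber \<alpha>v"
    and \<nu>: "\<nu> \<in> mu_connected_below \<mu>" "\<nu> \<in> fundamental_chamber \<alpha>v"
  shows "\<nu> \<in> H"
proof -
  obtain c where c: "\<nu> = \<mu> - root_comb c" "\<forall>i. c i \<ge> 0"
    "mu_connected A (stabilizer_roots \<alpha>v \<mu>) {i. c i > 0}"
    using \<nu>(1) unfolding mu_connected_below_def by blast
  define J where "J = {i. c i > 0 \<and> \<nu> (\<alpha>v i) = 0}"
  obtain u where "\<forall>i\<in>J. u i > 0" "\<forall>i\<in>J. submatrix_mult A J u i > 0"
    using zero_set_finite_type[OF \<mu>(2) c(2,3)] unfolding J_def c(1) by blast
  then obtain x where x: "\<forall>i\<in>J. x i \<in> \<int> \<and> x i > 0" "\<forall>i\<in>J. submatrix_mult A J x i > 0"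
    using integral_supersolution[of J u A] by blast
  define y where "y i = (if i \<in> J then x i else 0)" for i
  have yJ: "submatrix_mult A UNIV y i = submatrix_mult A J x i" for i
  proof -
    have "submatrix_mult A UNIV y i = (\<Sum>j\<in>J. A $ i $ j * y j)"
      unfolding submatrix_mult_def by (rule sum.mono_neutral_right) (auto simp: y_def)
    then show ?thesis by (simp add: submatrix_mult_def y_def)
  qed
  let ?I = "{i. c i > 0}"
  \<comment> \<open>Two bounds on the shift: \<open>e1\<close> keeps the support of \<open>c\<close>
    intact, \<open>e2\<close> keeps the values outside \<open>J\<close> positive. Inside
    \<open>J\<close> any positive shift works.\<close>
  have "\<exists>e>0. \<forall>i\<in>?I. c i + e * (- y i) > 0" by (rule small_scale_pos) auto
  then obtain e1 where e1: "e1 > 0" "\<forall>i\<in>?I. c i + e1 * (- y i) > 0" by blast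
  have "\<exists>e>0. \<forall>i\<in>?I - J. \<nu> (\<alpha>v i) + e * submatrix_mult A J x i > 0"
  proof (rule small_scale_pos)
    show "\<forall>i\<in>?I - J. \<nu> (\<alpha>v i) > 0"
      using \<nu>(2) by (auto simp: J_def fundamental_chamber_def less_le)
  qed simp
  then obtain e2 where e2: "e2 > 0" "\<forall>i\<in>?I - J. \<nu> (\<alpha>v i) + e2 * submatrix_mult A J x i > 0" by blast
  define e where "e = min e1 e2"
  have e: "e > 0" "e \<le> e1" "e \<le> e2" using e1(1) e2(1) by (auto simp: e_def)
  have y0: "y i \<ge> 0" for i using x(1) by (simp add: y_def less_imp_le)
  define d where "d i = c i - e * y i" for i
  have dpos: "d i > 0" if "c i > 0" for i
  proof -
    have "e * y i \<le> e1 * y i" using e(2) y0 by (rule mult_right_mono)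
    moreover have "c i + e1 * (- y i) > 0" using e1(2) that by blast
    ultimately show ?thesis by (simp add: d_def)
  qed
  have dz: "d i = 0" if "\<not> c i > 0" for i
  proof -
    have "c i = 0" using that c(2) by (simp add: not_less order_antisym)
    then have "y i = 0" by (simp add: y_def J_def)
    with \<open>c i = 0\<close> show ?thesis by (simp add: d_def)
  qed
  have supp: "{i. d i > 0} = ?I" using dpos dz by force
  have rd: "\<mu> - root_comb d = \<nu> + e *\<^sub>R root_comb y"
    using root_comb_scale[of e y] by (simp add: d_def[abs_def] root_comb_diff c(1))
  have "(\<nu> + e *\<^sub>R root_comb y) (\<alpha>v i) > 0" if "c i > 0" for i
  proof -
    have eq: "(\<nu> + e *\<^sub>R root_comb y) (\<alpha>v i) = \<nu> (\<alpha>v i) + e * submatrix_mult A J x i"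
      by (simp add: blinfun.add_left blinfun.scaleR_left root_comb_coroot yJ)
    show ?thesis
    proof (cases "i \<in> J")
      case True
      then show ?thesis using x(2) e(1) unfolding eq by (simp add: J_def)
    next
      case False
      then have i: "\<nu> (\<alpha>v i) > 0" "\<nu> (\<alpha>v i) + e2 * submatrix_mult A J x i > 0"
        using \<nu>(2) e2(2) that by (auto simp: J_def fundamental_chamber_def less_le)
      show ?thesis
      proof (cases "submatrix_mult A J x i \<ge> 0")
        case True
        then have "e * submatrix_mult A J x i \<ge> 0" using e(1) by simp
        then show ?thesis using i(1) unfolding eq by linarith
      next
        case False
        then have "e2 * submatrix_mult A J x i \<le> e * submatrix_mult A J x i"
          using e(3) by (intro mult_right_mono_neg) auto
        then show ?thesis using i(2) unfolding eq by linarith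
      qed
    qed
  qed
  then have pos: "d i > 0 \<longrightarrow> (\<nu> + e *\<^sub>R root_comb y) (\<alpha>v i) > 0" for i
    using dz[of i] by force
  have "\<mu> - root_comb d \<in> H"
  proof (rule strictly_dominant_below_in_stable_set[OF H \<mu>])
    show "\<forall>i. d i \<ge> 0"
    proof
      fix i show "d i \<ge> 0" using dpos[of i] dz[of i] by (cases "c i > 0") auto
    qed
    show "mu_connected A (stabilizer_roots \<alpha>v \<mu>) {i. d i > 0}" unfolding supp by (rule c(3))
    show "\<forall>i. d i > 0 \<longrightarrow> (\<mu> - root_comb d) (\<alpha>v i) > 0" unfolding rd using pos by blast
  qed
  then have mem: "\<nu> + e *\<^sub>R root_comb y \<in> H" by (simp only: rd)
  \<comment> \<open>\<open>H\<close> seen from \<nu> in root coordinates on \<open>J\<close>,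
    rescaled by \<open>e\<close> so that the raised point has the integral coordinates
    \<open>y\<close>.\<close>
  define S where "S = {v::real^'n. (\<forall>i. i \<notin> J \<longrightarrow> v $ i = 0) \<and> \<nu> + e *\<^sub>R root_comb (\<lambda>i. v $ i) \<in> H}"
  have "0 \<in> S"
  proof (rule zero_mem_finite_type[OF gcm, of S J "\<chi> i. y i"])
    show "convex S"
    proof (rule convexI)
      fix v w and a b :: real
      assume v: "v \<in> S" and w: "w \<in> S" and ab: "0 \<le> a" "0 \<le> b" "a + b = 1"
      have "a *\<^sub>R (\<nu> + e *\<^sub>R root_comb (\<lambda>i. v $ i)) + b *\<^sub>R (\<nu> + e *\<^sub>R root_comb (\<lambda>i. w $ i)) \<in> H"
        using v w ab unfolding S_def by (intro convexD[OF H(1)]) auto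
      moreover have "a *\<^sub>R (\<nu> + e *\<^sub>R root_comb (\<lambda>i. v $ i)) + b *\<^sub>R (\<nu> + e *\<^sub>R root_comb (\<lambda>i. w $ i))
        = (a + b) *\<^sub>R \<nu> + e *\<^sub>R root_comb (\<lambda>i. (a *\<^sub>R v + b *\<^sub>R w) $ i)"
      proof -
        have "(\<lambda>i. (a *\<^sub>R v + b *\<^sub>R w) $ i) = (\<lambda>i. a * v $ i + b * w $ i)" by (rule ext) simp
        then have "root_comb (\<lambda>i. (a *\<^sub>R v + b *\<^sub>R w) $ i)
            = a *\<^sub>R root_comb (\<lambda>i. v $ i) + b *\<^sub>R root_comb (\<lambda>i. w $ i)"
          using root_comb_lincomb[of a "\<lambda>i. v $ i" b "\<lambda>i. w $ i"] by (simp only:)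
        then show ?thesis by (simp add: algebra_simps)
      qed
      ultimately have "(a + b) *\<^sub>R \<nu> + e *\<^sub>R root_comb (\<lambda>i. (a *\<^sub>R v + b *\<^sub>R w) $ i) \<in> H"
        by (simp only:)
      then have "\<nu> + e *\<^sub>R root_comb (\<lambda>i. (a *\<^sub>R v + b *\<^sub>R w) $ i) \<in> H"
        unfolding ab(3) scaleR_one .
      moreover have "\<forall>i. i \<notin> J \<longrightarrow> (a *\<^sub>R v + b *\<^sub>R w) $ i = 0" using v w by (simp add: S_def)
      ultimately show "a *\<^sub>R v + b *\<^sub>R w \<in> S" unfolding S_def by blast
    qed
    show "v $ i = 0" if "v \<in> S" "i \<notin> J" for v i using that by (simp add: S_def)
    show "coordinate_reflection A J j v \<in> S" if v: "v \<in> S" and j: "j \<in> J" for v j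
    proof -
      define t where "t = submatrix_mult A J (\<lambda>k. v $ k) j"
      have "submatrix_mult A UNIV (\<lambda>k. v $ k) j = t"
        unfolding t_def submatrix_mult_def
        by (rule sum.mono_neutral_right) (use v in \<open>auto simp: S_def\<close>)
      moreover have "\<nu> (\<alpha>v j) = 0" using j by (simp add: J_def)
      ultimately have "s j (\<nu> + e *\<^sub>R root_comb (\<lambda>i. v $ i))
          = \<nu> + e *\<^sub>R (root_comb (\<lambda>i. v $ i) - t *\<^sub>R \<alpha> j)"
        by (simp add: simple_reflection_def blinfun.add_left blinfun.scaleR_left root_comb_coroot
            scaleR_diff_right)
      moreover have "root_comb (\<lambda>i. coordinate_reflection A J j v $ i)
          = root_comb (\<lambda>i. v $ i) - t *\<^sub>R \<alpha> j"
      proof -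
        have "(\<lambda>i. coordinate_reflection A J j v $ i) = (\<lambda>i. v $ i - (if i = j then t else 0))"
          by (rule ext) (auto simp: coordinate_reflection_def t_def axis_def)
        then show ?thesis
          using root_comb_diff[of "\<lambda>i. v $ i" "\<lambda>i. if i = j then t else 0"]
          by (simp only: root_comb_single)
      qed
      moreover have "s j (\<nu> + e *\<^sub>R root_comb (\<lambda>i. v $ i)) \<in> H"
        using H(2) v unfolding S_def by blast
      ultimately have \<nu>H: "\<nu> + e *\<^sub>R root_comb (\<lambda>i. coordinate_reflection A J j v $ i) \<in> H"
        by (simp only:)
      have "coordinate_reflection A J j v $ i = 0" if "i \<notin> J" for i
        using v j that by (auto simp: coordinate_reflection_def S_def axis_def)
      then show ?thesis using \<nu>H unfolding S_def by blast
    qed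
    have "(\<lambda>i. (\<chi> i. y i) $ i) = y" by (rule ext) simp
    then have "\<nu> + e *\<^sub>R root_comb (\<lambda>i. (\<chi> i. y i) $ i) \<in> H" using mem by (simp only:)
    moreover have "\<forall>i. i \<notin> J \<longrightarrow> (\<chi> i. y i) $ i = 0" by (simp add: y_def)
    ultimately show "(\<chi> i. y i) \<in> S" unfolding S_def by blast
    have "submatrix_mult A J (\<lambda>k. (\<chi> i. y i) $ k) i = submatrix_mult A J x i" for i
      by (intro submatrix_mult_cong) (simp add: y_def)
    then show "submatrix_mult A J (\<lambda>k. (\<chi> i. y i) $ k) i > 0" if "i \<in> J" for i using x(2) that by simp
    show "(\<chi> i. y i) $ i \<in> \<int>" "(\<chi> i. y i) $ i > 0" if "i \<in> J" for i
      using x(1) that by (simp_all add: y_def)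
  qed
  then have "\<nu> + e *\<^sub>R root_comb (\<lambda>i. (0::real^'n) $ i) \<in> H" unfolding S_def by blast
  moreover have "(\<lambda>i. (0::real^'n) $ i) = (\<lambda>i. 0)" by (rule ext) simp
  ultimately show ?thesis by (simp only: root_comb_0 scaleR_zero_right add_0_right)
qed

lemma hull_orbit_dominant:
  assumes "\<mu> \<in> fundamental_chamber \<alpha>v"
  shows "convex hull (weyl_orbit \<alpha> \<alpha>v \<mu>) \<inter> fundamental_chamber \<alpha>v
    = mu_connected_below \<mu> \<inter> fundamental_chamber \<alpha>v"
proof
  show "convex hull (weyl_orbit \<alpha> \<alpha>v \<mu>) \<inter> fundamental_chamber \<alpha>v
    \<subseteq> mu_connected_below \<mu> \<inter> fundamental_chamber \<alpha>v"
    using hull_orbit_below[OF assms] by blast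
  have "\<mu> \<in> convex hull (weyl_orbit \<alpha> \<alpha>v \<mu>)" using mem_orbit by (rule hull_inc)
  then show "mu_connected_below \<mu> \<inter> fundamental_chamber \<alpha>v
    \<subseteq> convex hull (weyl_orbit \<alpha> \<alpha>v \<mu>) \<inter> fundamental_chamber \<alpha>v"
    using dominant_below_in_stable_set[OF convex_convex_hull _ _ assms] hull_orbit_reflection
    by blast
qed

end

section \<open>Closedness\<close>

text \<open>A vector orthogonal to the range of \<open>T\<close> is a linear relation among the
  \<alpha> i, so independence makes \<open>T\<close> onto.\<close>

lemma dual_family_exists:
  fixes \<alpha> :: "'n::finite \<Rightarrow> ('h::euclidean_space \<Rightarrow>\<^sub>L real)"
  assumes inj: "inj \<alpha>" and ind: "independent (range \<alpha>)"
  shows "\<exists>h. \<forall>i j. blinfun_apply (\<alpha> i) (h j) = (if i = j then 1 else 0)"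
proof -
  define T :: "'h \<Rightarrow> real^'n" where "T x = (\<chi> i. \<alpha> i x)" for x
  have lin: "linear T"
    by (rule linearI) (simp_all add: T_def vec_eq_iff blinfun.add_right blinfun.scaleR_right)
  have "range T = UNIV"
  proof (rule ccontr)
    assume ne: "range T \<noteq> UNIV"
    have sub: "subspace (range T)" by (rule linear_subspace_image[OF lin subspace_UNIV])
    then have eq: "span (range T) = range T" by (rule span_eq_iff[THEN iffD2])
    have "span (range T) \<noteq> UNIV" unfolding eq by (rule ne)
    from span_not_UNIV_orthogonal[OF this] obtain a where a: "a \<noteq> 0" "\<forall>x\<in>span (range T). a \<bullet> x = 0"
      by (elim bexE exE conjE) (rule that, assumption+)
    have "(\<Sum>i\<in>UNIV. a $ i *\<^sub>R \<alpha> i) = 0"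
    proof (rule blinfun_eqI)
      fix x
      have "T x \<in> span (range T)" by (rule span_base) simp
      then have "a \<bullet> T x = 0" using a(2) by blast
      then show "blinfun_apply (\<Sum>i\<in>UNIV. a $ i *\<^sub>R \<alpha> i) x = blinfun_apply 0 x"
        by (simp add: blinfun.sum_left blinfun.scaleR_left T_def inner_vec_def)
    qed
    then have "(\<Sum>v\<in>range \<alpha>. (a $ (inv_into UNIV \<alpha> v)) *\<^sub>R v) = 0"
      using inj by (simp add: sum.reindex)
    then have "a $ inv_into UNIV \<alpha> v = 0" if "v \<in> range \<alpha>" for v
      using independentD[OF ind, of "range \<alpha>" "\<lambda>v. a $ inv_into UNIV \<alpha> v" v] that by simp
    from this[of "\<alpha> i" for i] have "a $ i = 0" for i using inj by simp
    then show False using a(1) by (simp add: vec_eq_iff)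
  qed
  then have "\<exists>x. T x = axis j 1" for j unfolding surj_def by metis
  then have "\<exists>h. \<forall>j. T (h j) = axis j 1" by (intro choice allI)
  then obtain h where "\<forall>j. T (h j) = axis j 1" by blast
  then have "T (h j) $ i = axis j 1 $ i" for i j by simp
  then show ?thesis by (intro exI[of _ h]) (auto simp: T_def axis_def)
qed

lemma biggest_mu_connected_path:
  assumes A: "gen_cartan_matrix A" and "i \<in> biggest_mu_connected A J0"
  shows "\<exists>j\<in>biggest_mu_connected A J0 - J0. (i, j) \<in> (dynkin_edges A (biggest_mu_connected A J0))\<^sup>*"
  using biggest_mu_connected(2)[OF A, of J0] assms(2) unfolding mu_connected_iff by (rule bspec)

text \<open>Any node of \<open>biggest_mu_connected A J0\<close> is joined to a node outside
  \<open>J0\<close>, so a component inside \<open>J0\<close> is a proper subset; its submatrix is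
  then of finite type in each of the three cases.\<close>

lemma finite_part_of_type:
  fixes A :: "real^'n^'n"
  assumes A: "gen_cartan_matrix A"
    and ty: "finite_type A UNIV \<or> affine_type A UNIV \<or> strongly_hyperbolic_type A"
  shows "finite_part A (biggest_mu_connected A J0 \<inter> J0) = biggest_mu_connected A J0 \<inter> J0"
  unfolding finite_part_eq_iff[OF A]
proof
  let ?P = "biggest_mu_connected A J0"
  fix C assume C: "C \<in> dynkin_components A (?P \<inter> J0)"
  have ind: "indecomposable A C" by (rule indecomposable_dynkin_component[OF A C])
  then have "C \<noteq> {}" unfolding indecomposable_def by blast
  have sub: "C \<subseteq> ?P \<inter> J0" by (rule dynkin_component_subset[OF C])
  obtain i where "i \<in> C" using \<open>C \<noteq> {}\<close> by blast
  then obtain j where "j \<notin> J0" using biggest_mu_connected_path[OF A, of i J0] sub by blast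
  then have proper: "C \<subset> UNIV" using sub by blast
  from ty show "finite_type A C"
  proof (elim disjE)
    assume "finite_type A UNIV"
    then show ?thesis by (rule finite_type_subset[OF A _ subset_UNIV ind])
  next
    assume "affine_type A UNIV"
    then show ?thesis by (rule finite_type_proper_subset_affine[OF A _ proper ind])
  next
    assume "strongly_hyperbolic_type A"
    then show ?thesis using \<open>C \<noteq> {}\<close> proper ind unfolding strongly_hyperbolic_type_def by blast
  qed
qed

section \<open>Closed root cones and the equivalence\<close>

context gcm_realization
begin

lemma closed_fundamental_chamber: "closed (fundamental_chamber \<alpha>v)"
proof -
  have "fundamental_chamber \<alpha>v = (\<Inter>i. {\<eta>. 0 \<le> blinfun_apply \<eta> (\<alpha>v i)})"
    unfolding fundamental_chamber_def by auto
  moreover have "closed {\<eta>::'h \<Rightarrow>\<^sub>L real. 0 \<le> blinfun_apply \<eta> (\<alpha>v i)}" for i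
    by (rule closed_Collect_le) (intro continuous_intros)+
  ultimately show ?thesis by (simp add: closed_INT)
qed

text \<open>The space \<open>'h \<Rightarrow>\<^sub>L real\<close> is not an instance of \<open>euclidean_space\<close>, so
  closedness of finitely generated cones is obtained by reading off coefficients continuously as
  values at a dual family \<open>h\<close>.\<close>

lemma root_comb_dual:
  assumes "\<forall>i j. blinfun_apply (\<alpha> i) (h j) = (if i = j then 1 else 0)"
  shows "root_comb c (h j) = c j"
proof -
  have "root_comb c (h j) = (\<Sum>i\<in>UNIV. c i * blinfun_apply (\<alpha> i) (h j))"
    by (simp add: root_comb_def blinfun.sum_left blinfun.scaleR_left)
  also have "\<dots> = (\<Sum>i\<in>UNIV. if i = j then c i else 0)"
    by (rule sum.cong[OF refl]) (use assms in auto)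
  finally show ?thesis by simp
qed

lemma closed_root_cone:
  assumes h: "\<forall>i j. blinfun_apply (\<alpha> i) (h j) = (if i = j then 1 else 0)"
  shows "closed {\<mu> - root_comb c | c. (\<forall>i. c i \<ge> 0) \<and> {i. c i > 0} \<subseteq> S}"
proof -
  \<comment> \<open>The first set on the right says that \<mu> - \<eta> is the root combination with
    the coefficients read off at \<open>h\<close>; the other two impose their signs and their
    support.\<close>
  have "{\<mu> - root_comb c | c. (\<forall>i. c i \<ge> 0) \<and> {i. c i > 0} \<subseteq> S}
    = {\<eta>. \<eta> = \<mu> - root_comb (\<lambda>i. (\<mu> - \<eta>) (h i))} \<inter> (\<Inter>i. {\<eta>. 0 \<le> (\<mu> - \<eta>) (h i)})
      \<inter> (\<Inter>i\<in>-S. {\<eta>. (\<mu> - \<eta>) (h i) \<le> 0})" (is "?L = ?R")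
  proof
    show "?L \<subseteq> ?R"
    proof
      fix \<eta> assume "\<eta> \<in> ?L"
      then obtain c where c: "\<eta> = \<mu> - root_comb c" "\<forall>i. c i \<ge> 0" "{i. c i > 0} \<subseteq> S" by blast
      have ev: "(\<mu> - \<eta>) (h i) = c i" for i using root_comb_dual[OF h, of c i] by (simp add: c(1))
      have "c i \<le> 0" if "i \<notin> S" for i
      proof (rule ccontr)
        assume "\<not> c i \<le> 0"
        then have "i \<in> {i. c i > 0}" by simp
        then have "i \<in> S" by (rule subsetD[OF c(3)])
        with that show False by contradiction
      qed
      then have "\<forall>i\<in>-S. (\<mu> - \<eta>) (h i) \<le> 0" unfolding ev by blast
      moreover have "\<forall>i. 0 \<le> (\<mu> - \<eta>) (h i)" unfolding ev by (rule c(2))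
      moreover have "(\<lambda>i. (\<mu> - \<eta>) (h i)) = c" by (rule ext) (rule ev)
      then have "\<eta> = \<mu> - root_comb (\<lambda>i. (\<mu> - \<eta>) (h i))" using c(1) by (simp only:)
      ultimately show "\<eta> \<in> ?R" by blast
    qed
    show "?R \<subseteq> ?L"
    proof
      fix \<eta> assume R: "\<eta> \<in> ?R"
      have "{i. (\<mu> - \<eta>) (h i) > 0} \<subseteq> S"
      proof
        fix i assume i: "i \<in> {i. (\<mu> - \<eta>) (h i) > 0}"
        show "i \<in> S"
        proof (rule ccontr)
          assume "i \<notin> S"
          then have "(\<mu> - \<eta>) (h i) \<le> 0" using R by blast
          with i show False by simp
        qed
      qed
      moreover have "\<forall>i. (\<mu> - \<eta>) (h i) \<ge> 0" "\<eta> = \<mu> - root_comb (\<lambda>i. (\<mu> - \<eta>) (h i))" using R by blast+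
      ultimately show "\<eta> \<in> ?L" by (intro CollectI exI[of _ "\<lambda>i. (\<mu> - \<eta>) (h i)"]) blast
    qed
  qed
  moreover have "closed {\<eta>. \<eta> = \<mu> - root_comb (\<lambda>i. (\<mu> - \<eta>) (h i))}"
    unfolding root_comb_def by (rule closed_Collect_eq) (intro continuous_intros)+
  moreover have "closed {\<eta>. 0 \<le> (\<mu> - \<eta>) (h i)}" for i
    by (rule closed_Collect_le) (intro continuous_intros)+
  moreover have "closed {\<eta>. (\<mu> - \<eta>) (h i) \<le> 0}" for i
    by (rule closed_Collect_le) (intro continuous_intros)+
  ultimately show ?thesis by (simp only:) (intro closed_Int closed_INT ballI)
qed

text \<open>If some nodes \<open>X\<close> of the support cannot reach a node outside
  \<open>J0\<close>, then \<open>- c\<close> on \<open>X\<close>, extended by 0, has nonnegative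
  rows on a component of finite type: by dominance on \<open>X\<close>, by signs elsewhere. Finite
  type then forbids its negative entry.\<close>

lemma mu_connected_if_components_finite:
  defines "P \<equiv> \<lambda>\<mu>. biggest_mu_connected A (stabilizer_roots \<alpha>v \<mu>)"
  assumes fin: "\<forall>C\<in>dynkin_components A (P \<mu> \<inter> stabilizer_roots \<alpha>v \<mu>). finite_type A C"
    and c: "\<forall>i. c i \<ge> 0" "{i. c i > 0} \<subseteq> P \<mu>"
    and dom: "\<mu> - root_comb c \<in> fundamental_chamber \<alpha>v"
  shows "mu_connected A (stabilizer_roots \<alpha>v \<mu>) {i. c i > 0}"
proof (rule ccontr)
  let ?J0 = "stabilizer_roots \<alpha>v \<mu>" and ?I = "{i. c i > 0}"
  let ?K = "P \<mu> \<inter> ?J0"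
  assume nc: "\<not> ?thesis"
  define X where "X = {i\<in>?I. \<not> (\<exists>j\<in>?I - ?J0. (i, j) \<in> (dynkin_edges A ?I)\<^sup>*)}"
  obtain i0 where i0: "i0 \<in> X" using nc unfolding mu_connected_iff X_def by blast
  have XI: "X \<subseteq> ?I" unfolding X_def by blast
  have XJ: "X \<subseteq> ?J0" unfolding X_def by blast
  then have XK: "X \<subseteq> ?K" using XI c(2) by blast
  have Xadj: "A $ i $ j = 0" if i: "i \<in> X" and j: "j \<in> ?I - X" for i j
  proof (rule ccontr)
    assume "A $ i $ j \<noteq> 0"
    then have e: "(i, j) \<in> dynkin_edges A ?I"
      using i j XI gcm_sym_zero[OF gcm, of i j] unfolding dynkin_edges_def by auto
    obtain k where "k \<in> ?I - ?J0" "(j, k) \<in> (dynkin_edges A ?I)\<^sup>*" using j unfolding X_def by blast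
    then have "(i, k) \<in> (dynkin_edges A ?I)\<^sup>*" using e by (simp add: converse_rtrancl_into_rtrancl)
    with \<open>k \<in> ?I - ?J0\<close> show False using i unfolding X_def by blast
  qed
  define D where "D = (dynkin_edges A ?K)\<^sup>* `` {i0}"
  have D: "D \<in> dynkin_components A ?K"
    unfolding dynkin_components_iff D_def using i0 XK by blast
  have i0D: "i0 \<in> D" unfolding D_def by blast
  define v where "v i = (if i \<in> X then - c i else 0)" for i
  have "submatrix_mult A D v i \<ge> 0" if i: "i \<in> D" for i
  proof (cases "i \<in> X")
    case True
    \<comment> \<open>Nodes of \<open>X\<close> outside \<open>D\<close> are not adjacent to
      \<open>i\<close>, and neither are support nodes outside \<open>X\<close>. So the row over
      \<open>D\<close> agrees with minus the full row of \<open>c\<close>.\<close>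
    have "(\<Sum>j\<in>D. A $ i $ j * v j) = (\<Sum>j\<in>UNIV. A $ i $ j * v j)"
    proof (rule sum.mono_neutral_left)
      show "\<forall>j\<in>UNIV - D. A $ i $ j * v j = 0"
      proof
        fix j assume j: "j \<in> UNIV - D"
        show "A $ i $ j * v j = 0"
        proof (cases "j \<in> X")
          case True
          then have "j \<in> ?K - D" using XK j by blast
          then show ?thesis using dynkin_component_isolated[OF gcm D i] by simp
        qed (simp add: v_def)
      qed
    qed simp_all
    also have "\<dots> = (\<Sum>j\<in>UNIV. - (A $ i $ j * c j))"
    proof (rule sum.cong)
      fix j :: 'n
      show "A $ i $ j * v j = - (A $ i $ j * c j)"
      proof (cases "j \<in> X")
        case False
        have "A $ i $ j * c j = 0"
        proof (cases "c j > 0")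
          case pos: True
          then show ?thesis using Xadj[OF \<open>i \<in> X\<close>, of j] False by simp
        next
          case nonpos: False
          then have "c j = 0" using c(1) by (simp add: not_less order_antisym)
          then show ?thesis by simp
        qed
        then show ?thesis using False by (simp add: v_def)
      qed (simp add: v_def)
    qed simp
    also have "\<dots> = - submatrix_mult A UNIV c i" by (simp add: submatrix_mult_def sum_negf)
    also have "\<dots> = (\<mu> - root_comb c) (\<alpha>v i)"
      using True XJ by (auto simp: blinfun.diff_left root_comb_coroot stabilizer_roots_def)
    also have "\<dots> \<ge> 0" using dom by (simp add: fundamental_chamber_def)
    finally show ?thesis unfolding submatrix_mult_def .
  next
    case False
    have "A $ i $ j * v j \<ge> 0" for j
    proof (cases "j \<in> X")
      case True
      then have "A $ i $ j \<le> 0" using False gcm_offdiag[OF gcm, of i j] by metis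
      moreover have "v j \<le> 0" using c(1) by (simp add: v_def)
      ultimately show ?thesis by (rule mult_nonpos_nonpos)
    qed (simp add: v_def)
    then show ?thesis unfolding submatrix_mult_def by (intro sum_nonneg)
  qed
  moreover have "finite_type A D" using fin D by blast
  ultimately have "(\<forall>i\<in>D. v i > 0) \<or> (\<forall>i\<in>D. v i = 0)" unfolding finite_type_def by blast
  moreover have "v i0 < 0" using i0 XI by (auto simp: v_def)
  ultimately show False using i0D by force
qed

lemma closed_if_components_finite:
  assumes \<mu>: "\<mu> \<in> fundamental_chamber \<alpha>v"
    and h: "\<forall>i j. blinfun_apply (\<alpha> i) (h j) = (if i = j then 1 else 0)"
    and fin: "\<forall>C\<in>dynkin_components A (biggest_mu_connected A (stabilizer_roots \<alpha>v \<mu>) \<inter>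
      stabilizer_roots \<alpha>v \<mu>). finite_type A C"
  shows "closed (convex hull (weyl_orbit \<alpha> \<alpha>v \<mu>) \<inter> fundamental_chamber \<alpha>v)"
proof -
  let ?P = "biggest_mu_connected A (stabilizer_roots \<alpha>v \<mu>)"
  let ?R = "{\<mu> - root_comb c | c. (\<forall>i. c i \<ge> 0) \<and> {i. c i > 0} \<subseteq> ?P}"
  have "mu_connected_below \<mu> \<subseteq> ?R"
    unfolding mu_connected_below_def using biggest_mu_connected(3)[OF gcm] by blast
  moreover have "?R \<inter> fundamental_chamber \<alpha>v \<subseteq> mu_connected_below \<mu>"
  proof
    fix \<eta> assume "\<eta> \<in> ?R \<inter> fundamental_chamber \<alpha>v"
    then obtain c where c: "\<eta> = \<mu> - root_comb c" "\<forall>i. c i \<ge> 0" "{i. c i > 0} \<subseteq> ?P"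
      "\<eta> \<in> fundamental_chamber \<alpha>v" by blast
    have "mu_connected A (stabilizer_roots \<alpha>v \<mu>) {i. c i > 0}"
      using mu_connected_if_components_finite[OF fin c(2,3)] c(1,4) by simp
    then show "\<eta> \<in> mu_connected_below \<mu>" unfolding mu_connected_below_def using c(1,2) by blast
  qed
  ultimately have "mu_connected_below \<mu> \<inter> fundamental_chamber \<alpha>v = ?R \<inter> fundamental_chamber \<alpha>v"
    by blast
  then show ?thesis
    unfolding hull_orbit_dominant[OF \<mu>]
    using closed_Int[OF closed_root_cone[OF h] closed_fundamental_chamber] by simp
qed

text \<open>A component \<open>D\<close> of \<open>\<Pi>\<^sup>* \<inter> J\<^sub>0\<close> of non-finite type carries
  \<open>u > 0\<close> with \<open>A\<^sub>D u \<le> 0\<close>. The dominant point \<open>\<mu> - \<Sum> u\<^sub>i \<alpha>\<^sub>i\<close> is not in the hull,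
  but adding \<open>\<epsilon> \<alpha>\<^sub>p\<close> to the subtracted sum, with \<open>p \<notin> J\<^sub>0\<close> adjacent to \<open>D\<close>,
  puts it there.\<close>

lemma components_finite_if_closed:
  assumes \<mu>: "\<mu> \<in> fundamental_chamber \<alpha>v"
    and h: "\<forall>i j. blinfun_apply (\<alpha> i) (h j) = (if i = j then 1 else 0)"
    and closed: "closed (convex hull (weyl_orbit \<alpha> \<alpha>v \<mu>) \<inter> fundamental_chamber \<alpha>v)"
    and D: "D \<in> dynkin_components A (biggest_mu_connected A (stabilizer_roots \<alpha>v \<mu>) \<inter>
      stabilizer_roots \<alpha>v \<mu>)"
  shows "finite_type A D"
proof (rule ccontr)
  assume nf: "\<not> finite_type A D"
  let ?J0 = "stabilizer_roots \<alpha>v \<mu>"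
  let ?P = "biggest_mu_connected A ?J0"
  let ?K = "?P \<inter> ?J0"
  have sub: "D \<subseteq> ?K" by (rule dynkin_component_subset[OF D])
  have ind: "indecomposable A D" by (rule indecomposable_dynkin_component[OF gcm D])
  obtain u where u: "\<forall>i\<in>D. u i > 0" "\<forall>i\<in>D. submatrix_mult A D u i \<le> 0"
    using not_finite_type_subsolution[OF gcm ind nf] by blast
  have "D \<noteq> {}" using ind unfolding indecomposable_def by blast
  have "D \<subseteq> ?P" "D \<subseteq> ?J0" using sub by blast+
  obtain i p where ip: "i \<in> D" "p \<in> ?P - D" "A $ i $ p \<noteq> 0" "i \<noteq> p"
    by (rule mu_connected_boundary_edge
        [OF gcm biggest_mu_connected(2)[OF gcm] \<open>D \<subseteq> ?P\<close> \<open>D \<subseteq> ?J0\<close> \<open>D \<noteq> {}\<close>])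
  have pJ: "p \<notin> ?J0"
  proof
    assume "p \<in> ?J0"
    then have "p \<in> ?K - D" using ip(2) by blast
    then show False using dynkin_component_isolated[OF gcm D ip(1)] ip(3) by blast
  qed
  have \<mu>nn: "\<mu> (\<alpha>v k) \<ge> 0" for k using \<mu> by (simp add: fundamental_chamber_def)
  have \<mu>p: "\<mu> (\<alpha>v p) > 0" using pJ \<mu>nn[of p] by (simp add: stabilizer_roots_def less_le)
  \<comment> \<open>For \<open>e > 0\<close> the node \<open>p\<close> links \<open>D\<close> to the
    outside of \<open>J0\<close>. At \<open>e = 0\<close> the support is \<open>D\<close>
    alone.\<close>
  define c where "c e k = (if k \<in> D then u k else 0) + (if k = p then e else 0)" for e k
  have csub: "submatrix_mult A UNIV (c e) k = submatrix_mult A D u k + A $ k $ p * e" for e k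
  proof -
    have "submatrix_mult A UNIV (c e) k
        = (\<Sum>j\<in>UNIV. (if j \<in> D then A $ k $ j * u j else 0) + (if j = p then A $ k $ p * e else 0))"
      unfolding submatrix_mult_def c_def by (rule sum.cong) (auto simp: algebra_simps)
    then show ?thesis by (simp add: sum.distrib sum.If_cases submatrix_mult_def)
  qed
  have ev: "(\<mu> - root_comb (c e)) (\<alpha>v k) = \<mu> (\<alpha>v k) - submatrix_mult A D u k - A $ k $ p * e" for e k
    by (simp add: blinfun.diff_left root_comb_coroot csub)
  have Du: "submatrix_mult A D u k \<le> 0" for k
  proof (cases "k \<in> D")
    case False
    show ?thesis by (rule submatrix_mult_at_zero(1)[OF gcm]) (use u(1) False in \<open>auto simp: less_imp_le\<close>)
  qed (use u(2) in blast)
  have mem: "\<mu> - root_comb (c e) \<in> convex hull (weyl_orbit \<alpha> \<alpha>v \<mu>) \<inter> fundamental_chamber \<alpha>v"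
    if e: "0 < e" "2 * e \<le> \<mu> (\<alpha>v p)" for e
  proof -
    have "(\<mu> - root_comb (c e)) (\<alpha>v k) \<ge> 0" for k
    proof (cases "k = p")
      case True
      then show ?thesis using e Du[of p] by (simp add: ev gcm_diag[OF gcm])
    next
      case False
      then have "A $ k $ p * e \<le> 0" using gcm_offdiag[OF gcm False] e(1) by (simp add: mult_nonpos_nonneg)
      then show ?thesis using Du[of k] \<mu>nn[of k] unfolding ev by linarith
    qed
    then have dom: "\<mu> - root_comb (c e) \<in> fundamental_chamber \<alpha>v" by (simp add: fundamental_chamber_def)
    have supp: "{k. c e k > 0} = insert p D"
      using u(1) e(1) ip(2) by (auto simp: c_def split: if_splits)
    have "(k, p) \<in> (dynkin_edges A (insert p D))\<^sup>*" if k: "k \<in> insert p D" for k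
    proof (cases "k = p")
      case False
      then have "k \<in> D" using k by blast
      \<comment> \<open>A path in the larger diagram that starts in the component never leaves it,
        so its edges are edges of \<open>D\<close>.\<close>
      have "(k, i) \<in> (dynkin_edges A D)\<^sup>*"
      proof -
        have "(k, i) \<in> (dynkin_edges A ?K)\<^sup>*"
          using dynkin_component_eq[OF gcm D \<open>k \<in> D\<close>] ip(1) by blast
        then have "i \<in> D \<and> (k, i) \<in> (dynkin_edges A D)\<^sup>*"
        proof (induction rule: rtrancl_induct)
          case base
          then show ?case using \<open>k \<in> D\<close> by simp
        next
          case (step y z)
          have "z \<in> D" using dynkin_component_eq[OF gcm D, of y] step by blast
          then have "(y, z) \<in> dynkin_edges A D" using step unfolding dynkin_edges_def by blast
          with step \<open>z \<in> D\<close> show ?case by (meson rtrancl_into_rtrancl)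
        qed
        then show ?thesis by blast
      qed
      then have "(k, i) \<in> (dynkin_edges A (insert p D))\<^sup>*"
        using rtrancl_mono[OF dynkin_edges_mono[OF subset_insertI[of D p], of A]] by blast
      moreover have "(i, p) \<in> dynkin_edges A (insert p D)"
        using ip gcm_sym_zero[OF gcm, of i p] unfolding dynkin_edges_def by blast
      ultimately show ?thesis by (rule rtrancl_into_rtrancl)
    qed simp
    then have "mu_connected A ?J0 {k. c e k > 0}" unfolding supp mu_connected_iff using pJ by blast
    moreover have "\<forall>k. c e k \<ge> 0" using u(1) e(1) by (auto simp: c_def less_imp_le)
    ultimately have "\<mu> - root_comb (c e) \<in> mu_connected_below \<mu>"
      unfolding mu_connected_below_def by blast
    then show ?thesis using dom hull_orbit_dominant[OF \<mu>] by blast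
  qed
  have rc: "root_comb (c e) = root_comb (c 0) + e *\<^sub>R \<alpha> p" for e
  proof -
    have "c e = (\<lambda>k. c 0 k + (if k = p then e else 0))" by (auto simp: c_def)
    then show ?thesis by (simp add: root_comb_add root_comb_single)
  qed
  \<comment> \<open>The factor one half ensures \<open>2 * e n \<le> \<mu> (\<alpha>v p)\<close>,
    which is dominance at \<open>p\<close>, where the diagonal entry 2 costs
    \<open>2 * e n\<close>.\<close>
  define e where "e n = (\<mu> (\<alpha>v p) / 2) * inverse (real (Suc n))" for n
  have "e \<longlonglongrightarrow> (\<mu> (\<alpha>v p) / 2) * 0"
    unfolding e_def by (intro tendsto_mult_left LIMSEQ_inverse_real_of_nat)
  then have e0: "e \<longlonglongrightarrow> 0" by simp
  have "(\<lambda>n. \<mu> - (root_comb (c 0) + e n *\<^sub>R \<alpha> p)) \<longlonglongrightarrow> \<mu> - (root_comb (c 0) + 0 *\<^sub>R \<alpha> p)"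
    by (intro tendsto_diff tendsto_add tendsto_scaleR tendsto_const e0)
  then have lim: "(\<lambda>n. \<mu> - root_comb (c (e n))) \<longlonglongrightarrow> \<mu> - root_comb (c 0)"
    unfolding rc[symmetric] .
  have en: "0 < e n" "2 * e n \<le> \<mu> (\<alpha>v p)" for n
    using \<mu>p by (simp_all add: e_def field_simps)
  have "\<mu> - root_comb (c (e n)) \<in> convex hull (weyl_orbit \<alpha> \<alpha>v \<mu>) \<inter> fundamental_chamber \<alpha>v" for n
    by (rule mem[OF en])
  then have "\<mu> - root_comb (c 0) \<in> convex hull (weyl_orbit \<alpha> \<alpha>v \<mu>) \<inter> fundamental_chamber \<alpha>v"
    by (rule closed_sequentially[OF closed _ lim])
  then have "\<mu> - root_comb (c 0) \<in> mu_connected_below \<mu>" using hull_orbit_below[OF \<mu>] by blast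
  then obtain d where d: "\<mu> - root_comb (c 0) = \<mu> - root_comb d" "mu_connected A ?J0 {k. d k > 0}"
    unfolding mu_connected_below_def by blast
  \<comment> \<open>Membership of the limit supplies some coefficients \<open>d\<close>; evaluation
    at the dual family identifies them with \<open>c 0\<close>.\<close>
  then have "root_comb d (h k) = root_comb (c 0) (h k)" for k by simp
  then have "d k = c 0 k" for k by (simp only: root_comb_dual[OF h])
  moreover have "{k. c 0 k > 0} = D" using u(1) by (auto simp: c_def split: if_splits)
  ultimately have "mu_connected A ?J0 D" using d(2) by simp
  then show False using \<open>D \<subseteq> ?J0\<close> \<open>D \<noteq> {}\<close> unfolding mu_connected_iff by blast
qed

end

theorem corollary3p13:
  fixes A :: "real^'n^'n"
    and \<alpha> :: "'n \<Rightarrow> ('h::euclidean_space \<Rightarrow>\<^sub>L real)"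
    and \<alpha>v :: "'n \<Rightarrow> 'h"
    and \<mu> :: "'h \<Rightarrow>\<^sub>L real"
  assumes "gen_cartan_matrix A"
    and "realization A \<alpha> \<alpha>v"
    and "\<mu> \<in> fundamental_chamber \<alpha>v"
  shows "(finite_part A (biggest_mu_connected A (stabilizer_roots \<alpha>v \<mu>) \<inter> stabilizer_roots \<alpha>v \<mu>)
             = biggest_mu_connected A (stabilizer_roots \<alpha>v \<mu>) \<inter> stabilizer_roots \<alpha>v \<mu>
            \<longleftrightarrow> closed (convex hull (weyl_orbit \<alpha> \<alpha>v \<mu>) \<inter> fundamental_chamber \<alpha>v)) \<and>
         (finite_type A UNIV \<or> affine_type A UNIV \<or> strongly_hyperbolic_type A
            \<longrightarrow> closed (convex hull (weyl_orbit \<alpha> \<alpha>v \<mu>) \<inter> fundamental_chamber \<alpha>v))"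
proof -
  interpret gcm_realization A \<alpha> \<alpha>v
    using assms(1,2) by unfold_locales (simp_all add: realization_def)
  have "inj \<alpha>" "independent (range \<alpha>)" using assms(2) unfolding realization_def by simp_all
  from dual_family_exists[OF this]
  obtain h where h: "\<forall>i j. blinfun_apply (\<alpha> i) (h j) = (if i = j then 1 else 0)"
    by (rule exE)
  have iff: "finite_part A (biggest_mu_connected A (stabilizer_roots \<alpha>v \<mu>) \<inter> stabilizer_roots \<alpha>v \<mu>)
             = biggest_mu_connected A (stabilizer_roots \<alpha>v \<mu>) \<inter> stabilizer_roots \<alpha>v \<mu>
            \<longleftrightarrow> closed (convex hull (weyl_orbit \<alpha> \<alpha>v \<mu>) \<inter> fundamental_chamber \<alpha>v)"
    unfolding finite_part_eq_iff[OF assms(1)]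
    by (rule iffI, erule closed_if_components_finite[OF assms(3) h], rule ballI,
        erule components_finite_if_closed[OF assms(3) h])
  show ?thesis
  proof (intro conjI impI)
    assume "finite_type A UNIV \<or> affine_type A UNIV \<or> strongly_hyperbolic_type A"
    from finite_part_of_type[OF assms(1) this]
    show "closed (convex hull (weyl_orbit \<alpha> \<alpha>v \<mu>) \<inter> fundamental_chamber \<alpha>v)"
      by (rule iff[THEN iffD1])
  qed (rule iff)
qed

end
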